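(* Let $\Omega\subset\mathbb{R}^2$ be open, let $\gamma>0$, let $i\in\{0,1\}$, and let $A_i=\partial\Phi_i$ be the subdifferential in $L^2(\Omega)$ of the functional $\Phi_i$ (defined in the context). Suppose $u_0\in D(A_i)$. Then there exists a unique function $u:[0,\infty)\to L^2(\Omega)$ such that: (1) $u(t)\in D(A_i)$ for all $t>0$; (2) $\frac{du}{dt}\in L^\infty(0,\infty;L^2(\Omega))$ and $\left\|\frac{du}{dt}\right\|_{L^\infty(0,\infty;L^2(\Omega))}\le \|A_i^o(u_0)\|_{L^2(\Omega)}$; (3) $-\frac{du}{dt}(t)\in A_i(u(t))$ for a.e. $t\in(0,\infty)$; (4) $u(0)=u_0$. In addition, $u$ has a right derivative $\frac{d^+u}{dt}$ (in $L^2(\Omega)$) at every $t\in[0,\infty)$, and $$\frac{d^+u}{dt}(t)+A_i^o(u(t))=0\qquad\text{for all } t\in[0,\infty).$$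
   Context: For $u\in L^2(\Omega)$ put $$\int_\Omega(|u_{x_1}|+|u_{x_2}|):=\sup\left\{\int_\Omega u\,\mathrm{div}\,z\,dx:\ z\in C^1_0(\Omega;\mathbb{R}^2),\ \max(|z_1|,|z_2|)\le 1 \text{ in }\Omega\right\}\in[0,\infty],$$ where $C^1_0$ denotes $C^1$ fields with compact support in $\Omega$. The functional $\Phi_0:L^2(\Omega)\to[0,\infty]$ is $\Phi_0(u)=\int_\Omega(|u_{x_1}|+|u_{x_2}|)$ if this quantity is finite, and $\Phi_0(u)=+\infty$ otherwise. The functional $\Phi_1:L^2(\Omega)\to[0,\infty]$ is $$\Phi_1(u)=\int_\Omega\Big(\frac{\gamma}{2}|\nabla u|^2+|u_{x_1}|+|u_{x_2}|\Big)dx\ \text{ if this is finite and } u\in H^1(\Omega),\qquad \Phi_1(u)=+\infty\ \text{ otherwise.}$$ $A_i=\partial\Phi_i$ is the (possibly multivalued) subdifferential: $w\in A_i(u)$ iff $\Phi_i(u)<\infty$ and $\Phi_i(v)\ge\Phi_i(u)+(w,v-u)_{L^2(\Omega)}$ for all $v\in L^2(\Omega)$. $D(A_i)=\{u: A_i(u)\neq\emptyset\}$. For $u\in D(A_i)$, $A_i^o(u)$ is the minimal section, i.e. the element of minimal $L^2$-norm of the closed convex set $A_i(u)$. Condition (2) is understood as: $u$ is Lipschitz continuous from $[0,\infty)$ to $L^2(\Omega)$, with a.e. derivative $du/dt$. *)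

theory Defs
  imports "HOL-Analysis.Analysis"
begin

section \<open>The space of square-integrable functions on the plane\<close>

definition square_integrable :: "(real^2 \<Rightarrow> real) \<Rightarrow> bool" where
  "square_integrable f \<longleftrightarrow>
     f \<in> borel_measurable lebesgue \<and> integrable lebesgue (\<lambda>x. (f x)\<^sup>2)"

definition l2_rel :: "(real^2 \<Rightarrow> real) \<Rightarrow> (real^2 \<Rightarrow> real) \<Rightarrow> bool" where
  "l2_rel f g \<longleftrightarrow> square_integrable f \<and> square_integrable g \<and> (AE x in lebesgue. f x = g x)"

lemma square_integrable_mult:
  assumes "square_integrable f" "square_integrable g"
  shows "integrable lebesgue (\<lambda>x. f x * g x)"
proof (rule Bochner_Integration.integrable_bound)
  show "integrable lebesgue (\<lambda>x. (f x)\<^sup>2 + (g x)\<^sup>2)"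
    using assms by (auto simp: square_integrable_def)
  show "(\<lambda>x. f x * g x) \<in> borel_measurable lebesgue"
    using assms by (auto simp: square_integrable_def)
  have "\<bar>f x * g x\<bar> \<le> (f x)\<^sup>2 + (g x)\<^sup>2" for x
  proof -
    have "2 * (\<bar>f x\<bar> * \<bar>g x\<bar>) \<le> \<bar>f x\<bar>\<^sup>2 + \<bar>g x\<bar>\<^sup>2"
      using sum_squares_bound[of "\<bar>f x\<bar>" "\<bar>g x\<bar>"] by simp
    moreover have "0 \<le> \<bar>f x\<bar> * \<bar>g x\<bar>"
      by simp
    ultimately show ?thesis
      unfolding abs_mult power2_abs by linarith
  qed
  then show "AE x in lebesgue. norm (f x * g x) \<le> norm ((f x)\<^sup>2 + (g x)\<^sup>2)"
    by simp
qed

lemma square_integrable_zero: "square_integrable (\<lambda>x. 0)"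
  by (simp add: square_integrable_def)

lemma square_integrable_scale: "square_integrable f \<Longrightarrow> square_integrable (\<lambda>x. c * f x)"
  by (auto simp: square_integrable_def power_mult_distrib)

lemma square_integrable_add:
  assumes "square_integrable f" "square_integrable g"
  shows "square_integrable (\<lambda>x. f x + g x)"
proof -
  have "integrable lebesgue (\<lambda>x. (f x)\<^sup>2 + (g x)\<^sup>2 + 2 * (f x * g x))"
    using assms square_integrable_mult[OF assms] by (auto simp: square_integrable_def)
  then show ?thesis
    using assms by (auto simp: square_integrable_def power2_sum mult.assoc)
qed

lemma square_integrable_uminus: "square_integrable f \<Longrightarrow> square_integrable (\<lambda>x. - f x)"
  by (simp add: square_integrable_def)

lemma square_integrable_diff:
  "square_integrable f \<Longrightarrow> square_integrable g \<Longrightarrow> square_integrable (\<lambda>x. f x - g x)"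
  using square_integrable_add[of f "\<lambda>x. - g x"] square_integrable_uminus[of g] by simp

quotient_type l2 = "real^2 \<Rightarrow> real" / partial: l2_rel
proof (rule part_equivpI)
  show "\<exists>f. l2_rel f f"
    using square_integrable_zero by (auto simp: l2_rel_def)
  show "symp l2_rel"
    by (auto simp: symp_def l2_rel_def)
  show "transp l2_rel"
    by (auto simp: transp_def l2_rel_def)
qed

instantiation l2 :: real_inner
begin

lift_definition zero_l2 :: l2 is "\<lambda>x. 0"
  using square_integrable_zero by (simp add: l2_rel_def)

lift_definition plus_l2 :: "l2 \<Rightarrow> l2 \<Rightarrow> l2" is "\<lambda>f g x. f x + g x"
  by (auto simp: l2_rel_def intro: square_integrable_add)

lift_definition minus_l2 :: "l2 \<Rightarrow> l2 \<Rightarrow> l2" is "\<lambda>f g x. f x - g x"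
  by (auto simp: l2_rel_def intro: square_integrable_diff)

lift_definition uminus_l2 :: "l2 \<Rightarrow> l2" is "\<lambda>f x. - f x"
  by (auto simp: l2_rel_def intro: square_integrable_uminus)

lift_definition scaleR_l2 :: "real \<Rightarrow> l2 \<Rightarrow> l2" is "\<lambda>c f x. c * f x"
  by (auto simp: l2_rel_def intro: square_integrable_scale)

lift_definition inner_l2 :: "l2 \<Rightarrow> l2 \<Rightarrow> real" is "\<lambda>f g. LINT x|lebesgue. f x * g x"
proof -
  fix f f' g g'
  assume "l2_rel f f'" "l2_rel g g'"
  then show "(LINT x|lebesgue. f x * g x) = (LINT x|lebesgue. f' x * g' x)"
    by (intro integral_cong_AE) (auto simp: l2_rel_def square_integrable_def)
qed

definition norm_l2 :: "l2 \<Rightarrow> real" where "norm_l2 f = sqrt (inner f f)"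
definition dist_l2 :: "l2 \<Rightarrow> l2 \<Rightarrow> real" where "dist_l2 f g = norm (f - g)"
definition sgn_l2 :: "l2 \<Rightarrow> l2" where "sgn_l2 f = inverse (norm f) *\<^sub>R f"
definition uniformity_l2 :: "(l2 \<times> l2) filter" where
  "uniformity_l2 = (INF e\<in>{0<..}. principal {(x, y). dist x y < e})"
definition open_l2 :: "l2 set \<Rightarrow> bool" where
  "open_l2 U \<longleftrightarrow> (\<forall>x\<in>U. \<forall>\<^sub>F (x', y) in uniformity. x' = x \<longrightarrow> y \<in> U)"

instance
proof
  fix a b :: real and f g h :: l2
  show "f + g + h = f + (g + h)"
    by transfer (auto simp: l2_rel_def add.assoc intro!: square_integrable_add)
  show "f + g = g + f"
    by transfer (auto simp: l2_rel_def add.commute intro!: square_integrable_add)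
  show "0 + f = f"
    by transfer (auto simp: l2_rel_def)
  show "- f + f = 0"
    by transfer (auto simp: l2_rel_def square_integrable_zero)
  show "f - g = f + - g"
    by transfer (auto simp: l2_rel_def square_integrable_diff)
  show "a *\<^sub>R (f + g) = a *\<^sub>R f + a *\<^sub>R g"
    by transfer (auto simp: l2_rel_def algebra_simps
        intro!: square_integrable_add square_integrable_scale)
  show "(a + b) *\<^sub>R f = a *\<^sub>R f + b *\<^sub>R f"
    by transfer (auto simp: l2_rel_def algebra_simps
        intro!: square_integrable_add square_integrable_scale)
  show "a *\<^sub>R b *\<^sub>R f = (a * b) *\<^sub>R f"
    by transfer (auto simp: l2_rel_def mult.assoc intro!: square_integrable_scale)
  show "1 *\<^sub>R f = f"
    by transfer (auto simp: l2_rel_def)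
  show "dist f g = norm (f - g)"
    by (rule dist_l2_def)
  show "sgn f = inverse (norm f) *\<^sub>R f"
    by (rule sgn_l2_def)
  show "uniformity = (INF e\<in>{0<..}. principal {(x :: l2, y). dist x y < e})"
    by (rule uniformity_l2_def)
  show "open U \<longleftrightarrow> (\<forall>x\<in>U. \<forall>\<^sub>F (x', y) in uniformity. x' = x \<longrightarrow> y \<in> U)" for U :: "l2 set"
    by (rule open_l2_def)
  show "inner f g = inner g f"
    by transfer (simp add: mult.commute)
  show "inner (f + g) h = inner f h + inner g h"
    by transfer (auto simp: l2_rel_def distrib_right square_integrable_mult)
  show "inner (a *\<^sub>R f) g = a * inner f g"
    by transfer (simp add: mult.assoc)
  show "0 \<le> inner f f"
    by transfer simp
  show "inner f f = 0 \<longleftrightarrow> f = 0"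
  proof transfer
    fix f assume "l2_rel f f"
    then have f: "square_integrable f"
      by (simp add: l2_rel_def)
    then have "(LINT x|lebesgue. f x * f x) = 0 \<longleftrightarrow> (AE x in lebesgue. f x * f x = 0)"
      by (intro integral_nonneg_eq_0_iff_AE square_integrable_mult) auto
    then show "(LINT x|lebesgue. f x * f x) = 0 \<longleftrightarrow> l2_rel f (\<lambda>x. 0)"
      using f by (simp add: l2_rel_def square_integrable_zero)
  qed
  show "norm f = sqrt (inner f f)"
    by (rule norm_l2_def)
qed

end

text \<open>
  \<open>L\<^sup>2(\<Omega>)\<close> is identified, by extension by zero, with the closed subspace of \<open>L\<^sup>2(\<real>\<^sup>2)\<close> of the
  classes vanishing almost everywhere outside \<open>\<Omega>\<close>; on it norm, inner product and topology
  are those of \<open>L\<^sup>2(\<Omega>)\<close>. \<open>rep_l2\<close> chooses a representative of a class; it is used only in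
  expressions that do not depend on the choice.
\<close>

definition L2 :: "(real^2) set \<Rightarrow> l2 set" where
  "L2 \<Omega> = {u. AE x in lebesgue. x \<notin> \<Omega> \<longrightarrow> rep_l2 u x = 0}"


section \<open>Test fields, total variation and Sobolev functions\<close>

text \<open>
  An element of \<open>C\<^sup>1\<^sub>0(\<Omega>)\<close>, extended by zero, is a \<open>C\<^sup>1\<close> map on the whole plane whose support
  is a compact subset of \<open>\<Omega>\<close>.
\<close>

definition C1_compact :: "(real^2) set \<Rightarrow> (real^2 \<Rightarrow> 'a::real_normed_vector) set" where
  "C1_compact \<Omega> = {z. (\<forall>x. z differentiable (at x)) \<and>
     (\<forall>v. continuous_on UNIV (\<lambda>x. frechet_derivative z (at x) v)) \<and>
     compact (closure {x. z x \<noteq> 0}) \<and> closure {x. z x \<noteq> 0} \<subseteq> \<Omega>}"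

definition partial_deriv ::
    "2 \<Rightarrow> (real^2 \<Rightarrow> 'a::real_normed_vector) \<Rightarrow> real^2 \<Rightarrow> 'a" where
  "partial_deriv k z x = frechet_derivative z (at x) (axis k 1)"

definition divergence :: "(real^2 \<Rightarrow> real^2) \<Rightarrow> real^2 \<Rightarrow> real" where
  "divergence z x = partial_deriv 1 z x $ 1 + partial_deriv 2 z x $ 2"

definition aniso_TV :: "(real^2) set \<Rightarrow> l2 \<Rightarrow> ereal" where
  "aniso_TV \<Omega> u =
     (SUP z \<in> {z \<in> C1_compact \<Omega>. \<forall>x\<in>\<Omega>. max \<bar>z x $ 1\<bar> \<bar>z x $ 2\<bar> \<le> 1}.
        ereal (LINT x:\<Omega>|lebesgue. rep_l2 u x * divergence z x))"

definition has_weak_partial :: "(real^2) set \<Rightarrow> 2 \<Rightarrow> l2 \<Rightarrow> l2 \<Rightarrow> bool" where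
  "has_weak_partial \<Omega> k u g \<longleftrightarrow> g \<in> L2 \<Omega> \<and>
     (\<forall>\<phi> \<in> C1_compact \<Omega>. (LINT x:\<Omega>|lebesgue. rep_l2 u x * partial_deriv k \<phi> x) =
        - (LINT x:\<Omega>|lebesgue. rep_l2 g x * \<phi> x))"

definition weak_partial :: "(real^2) set \<Rightarrow> 2 \<Rightarrow> l2 \<Rightarrow> l2" where
  "weak_partial \<Omega> k u = (THE g. has_weak_partial \<Omega> k u g)"

definition H1 :: "(real^2) set \<Rightarrow> l2 set" where
  "H1 \<Omega> = {u \<in> L2 \<Omega>. \<forall>k. \<exists>g. has_weak_partial \<Omega> k u g}"


section \<open>The functionals and their subdifferentials\<close>

definition Phi0 :: "(real^2) set \<Rightarrow> l2 \<Rightarrow> ereal" where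
  "Phi0 \<Omega> u = (if aniso_TV \<Omega> u < \<infinity> then aniso_TV \<Omega> u else \<infinity>)"

text \<open>
  The integral of the nonnegative density is taken in \<open>[0, \<infinity>]\<close>, so an infinite integral
  gives the value \<open>\<infinity>\<close>.
\<close>

definition Phi1 :: "(real^2) set \<Rightarrow> real \<Rightarrow> l2 \<Rightarrow> ereal" where
  "Phi1 \<Omega> \<gamma> u =
     (if u \<in> H1 \<Omega> then
        enn2ereal (\<integral>\<^sup>+x\<in>\<Omega>. ennreal
          (let u1 = rep_l2 (weak_partial \<Omega> 1 u) x; u2 = rep_l2 (weak_partial \<Omega> 2 u) x
           in \<gamma> / 2 * (u1\<^sup>2 + u2\<^sup>2) + \<bar>u1\<bar> + \<bar>u2\<bar>) \<partial>lebesgue)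
      else \<infinity>)"

definition Phi :: "(real^2) set \<Rightarrow> real \<Rightarrow> nat \<Rightarrow> l2 \<Rightarrow> ereal" where
  "Phi \<Omega> \<gamma> i = (if i = 0 then Phi0 \<Omega> else Phi1 \<Omega> \<gamma>)"

definition subdifferential ::
    "'a::real_inner set \<Rightarrow> ('a \<Rightarrow> ereal) \<Rightarrow> 'a \<Rightarrow> 'a set" where
  "subdifferential H F u =
     {w \<in> H. u \<in> H \<and> F u < \<infinity> \<and> (\<forall>v\<in>H. F v \<ge> F u + ereal (inner w (v - u)))}"

definition op_domain :: "('a \<Rightarrow> 'a set) \<Rightarrow> 'a set" where
  "op_domain A = {u. A u \<noteq> {}}"

definition min_section :: "('a::real_normed_vector \<Rightarrow> 'a set) \<Rightarrow> 'a \<Rightarrow> 'a" where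
  "min_section A u = (THE w. w \<in> A u \<and> (\<forall>w'\<in>A u. norm w \<le> norm w'))"

definition A_op :: "(real^2) set \<Rightarrow> real \<Rightarrow> nat \<Rightarrow> l2 \<Rightarrow> l2 set" where
  "A_op \<Omega> \<gamma> i = subdifferential (L2 \<Omega>) (Phi \<Omega> \<gamma> i)"


section \<open>Strong solutions of the evolution equation\<close>

text \<open>
  Only the values \<open>u t\<close> with \<open>t \<ge> 0\<close> are relevant. Membership of \<open>du/dt\<close> in
  \<open>L\<^sup>\<infinity>(0,\<infinity>; L\<^sup>2)\<close> with norm at most \<open>C\<close> means that \<open>u\<close> is Lipschitz continuous, differentiable
  almost everywhere, and that its derivative is measurable and bounded in norm by \<open>C\<close> almost
  everywhere. Since \<open>L\<^sup>2(\<real>\<^sup>2)\<close> is separable, Borel measurability is strong measurability.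
\<close>

definition Linf_derivative_le :: "(real \<Rightarrow> 'a::real_normed_vector) \<Rightarrow> real \<Rightarrow> bool" where
  "Linf_derivative_le u C \<longleftrightarrow>
     (\<exists>L. L-lipschitz_on {0..} u) \<and>
     (AE t in lebesgue_on {0<..}. u differentiable (at t)) \<and>
     (\<lambda>t. vector_derivative u (at t)) \<in> borel_measurable (lebesgue_on {0<..}) \<and>
     (AE t in lebesgue_on {0<..}. norm (vector_derivative u (at t)) \<le> C)"

definition strong_solution ::
    "('a::real_normed_vector \<Rightarrow> 'a set) \<Rightarrow> 'a \<Rightarrow> (real \<Rightarrow> 'a) \<Rightarrow> bool" where
  "strong_solution A u0 u \<longleftrightarrow>
     (\<forall>t>0. u t \<in> op_domain A) \<and>
     Linf_derivative_le u (norm (min_section A u0)) \<and>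
     (AE t in lebesgue_on {0<..}. - vector_derivative u (at t) \<in> A (u t)) \<and>
     u 0 = u0"

end

theory Submission
  imports Defs
begin

text \<open>
  Both functionals are convex, and what the evolution sees of them is that their subdifferentials
  \<open>A\<close> are maximal monotone in the Hilbert space \<open>L2 \<Omega>\<close>: they are monotone, and for all \<open>x\<close> and
  \<open>\<tau> > 0\<close> the equation \<open>(x - y) / \<tau> \<in> A y\<close> has a solution \<open>y\<close>, the minimiser of
  \<open>\<Phi> + norm (\<cdot> - x)\<^sup>2 / (2 \<tau>)\<close>. The statement is then the generation theorem for such operators,
  \<open>evolution_equation\<close>, which is proved here for any complete subspace of an inner product space.

  \<^bold>\<open>Existence.\<close> Let \<open>N\<close> be the norm of the minimal section at the initial value. The slopes of the
  implicit Euler scheme lie in the graph of \<open>A\<close> and have norm at most \<open>N\<close>. Monotonicity alone shows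
  that halving the step \<open>\<tau>\<close> moves the scheme at time \<open>t\<close> by at most \<open>N * sqrt (t * \<tau>)\<close>
  (\<open>euler_halving\<close>), which is summable over dyadic steps. The limit \<open>flow\<close> is a Lipschitz semigroup on
  the domain of \<open>A\<close>, and it inherits the energy inequality of the scheme (\<open>flow_energy\<close>).

  \<^bold>\<open>Derivatives.\<close> The energy inequality, tested with the point of the graph given by the Yosida
  approximation at an endpoint \<open>z\<close> of a short time interval, shows that the difference quotient \<open>q\<close>
  of length \<open>h\<close> satisfies
  \<open>(norm (q - yosida \<tau> z))\<^sup>2 \<le> N\<^sup>2 - (norm (yosida \<tau> z))\<^sup>2 + 6 h N\<^sup>2 / \<tau>\<close>, where \<open>N\<close> now
  refers to the initial point of the interval (\<open>difference_quotient_near_yosida\<close>). As the Yosida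
  approximations converge in norm to the minimal section, letting first \<open>h\<close> and then \<open>\<tau>\<close> tend to \<open>0\<close>
  gives the right derivative at every time. With \<open>z\<close> the final point it gives the left derivative
  wherever the nonincreasing function \<open>t \<mapsto> norm (least (flow t x))\<close> is continuous, hence outside a
  countable set; this is where differentiability almost everywhere comes from.

  \<^bold>\<open>Uniqueness.\<close> The squared distance of two solutions is locally Lipschitz with a nonpositive
  derivative almost everywhere, hence nonincreasing (\<open>lipschitz_nonincreasing\<close>).

  \<^bold>\<open>The functionals.\<close> The total variation is a supremum of continuous linear functionals, so it is
  lower semicontinuous and minimising sequences of the uniformly convex proximal problem converge to
  minimisers. For the other functional the positive coefficient \<open>\<gamma>\<close> makes the proximal problem
  uniformly convex in \<open>u\<close> together with its two weak derivatives: a minimising sequence is Cauchy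
  along with its gradients, the relation between a function and its gradient is closed, and the
  \<open>L\<^sup>1\<close> part passes to the limit by Fatou. That this gradient is the one in the definition of the
  functional is the fundamental lemma of the calculus of variations (\<open>fundamental_lemma\<close>).
\<close>

section \<open>Identities in inner product spaces and differential inequalities\<close>

lemma norm_add_scaleR_power2:
  fixes a b :: "'a::real_inner"
  shows "(norm (a + c *\<^sub>R b))\<^sup>2 = (norm a)\<^sup>2 + 2 * c * inner b a + (c * norm b)\<^sup>2"
  using dot_norm[of a "c *\<^sub>R b"] by (simp add: power_mult_distrib inner_commute)

lemma norm_convex_combination_power2:
  fixes u v :: "'a::real_inner"
  shows "(norm ((1 - t) *\<^sub>R u + t *\<^sub>R v))\<^sup>2
    = (1 - t) * (norm u)\<^sup>2 + t * (norm v)\<^sup>2 - t * (1 - t) * (norm (u - v))\<^sup>2"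
  by (simp add: power2_norm_eq_inner inner_add_left inner_add_right inner_diff_left inner_diff_right
      inner_commute[of v u]) (simp add: algebra_simps)

lemma norm_midpoint_power2:
  fixes u v x :: "'a::real_inner"
  shows "(norm ((1/2) *\<^sub>R (u + v) - x))\<^sup>2
    = ((norm (u - x))\<^sup>2 + (norm (v - x))\<^sup>2) / 2 - (norm (u - v))\<^sup>2 / 4"
proof -
  have "x = (1/2) *\<^sub>R x + (1/2) *\<^sub>R x" by (simp flip: scaleR_add_left)
  then have e: "(1/2) *\<^sub>R (u + v) - x = (1 - 1/2) *\<^sub>R (u - x) + (1/2) *\<^sub>R (v - x)"
    by (simp add: algebra_simps)
  show ?thesis
    unfolding e norm_convex_combination_power2 by simp
qed

text \<open>
  The quadratic penalty provides the uniform convexity that makes minimising sequences Cauchy.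
\<close>

lemma proximal_term_midpoint:
  fixes u v x :: "'a::real_inner"
  assumes "\<tau> > 0"
  shows "(norm ((1/2) *\<^sub>R (u + v) - x))\<^sup>2 / (2 * \<tau>) + 1 / (8 * \<tau>) * (norm (u - v))\<^sup>2
    = ((norm (u - x))\<^sup>2 / (2 * \<tau>) + (norm (v - x))\<^sup>2 / (2 * \<tau>)) / 2"
  unfolding norm_midpoint_power2 using assms by (simp add: field_simps)

lemma Cauchy_of_summable_steps:
  fixes f :: "nat \<Rightarrow> 'a::real_normed_vector"
  assumes step: "\<And>k. norm (f (Suc k) - f k) \<le> b k" and b: "summable b"
  shows "Cauchy f"
proof (rule CauchyI')
  fix e :: real assume "e > 0"
  then obtain K where K: "\<And>m n. m \<ge> K \<Longrightarrow> norm (sum b {m..<n}) < e"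
    using b unfolding summable_Cauchy by blast
  have "dist (f m) (f n) < e" if "m \<ge> K" "n > m" for m n
  proof -
    have "norm (f n - f m) = norm (\<Sum>k=m..<n. f (Suc k) - f k)"
      using that by (simp add: sum_Suc_diff')
    also have "\<dots> \<le> sum b {m..<n}"
      by (rule sum_norm_le) (rule step)
    also have "\<dots> < e" using K[OF that(1), of n] by simp
    finally show ?thesis by (simp add: dist_norm norm_minus_commute)
  qed
  then show "\<exists>M. \<forall>m\<ge>M. \<forall>n>m. dist (f m) (f n) < e" by blast
qed

lemma has_vector_derivative_quotient:
  fixes f :: "real \<Rightarrow> 'a::real_normed_vector"
  assumes "((\<lambda>y. (1 / (y - x)) *\<^sub>R (f y - f x)) \<longlongrightarrow> D) (at x within S)"
  shows "(f has_vector_derivative D) (at x within S)"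
  unfolding has_vector_derivative_def has_derivative_iff_norm
proof
  show "bounded_linear (\<lambda>h. h *\<^sub>R D)" by (rule bounded_linear_scaleR_left)
  have "((\<lambda>y. norm ((1 / (y - x)) *\<^sub>R (f y - f x) - D)) \<longlongrightarrow> 0) (at x within S)"
    using assms by (simp add: LIM_zero tendsto_norm_zero)
  moreover have "\<forall>\<^sub>F y in at x within S. norm ((1 / (y - x)) *\<^sub>R (f y - f x) - D)
      = norm (f y - f x - (y - x) *\<^sub>R D) / norm (y - x)"
    unfolding eventually_at_filter
  proof (intro always_eventually allI impI)
    fix y assume "y \<noteq> x"
    then have "f y - f x - (y - x) *\<^sub>R D = (y - x) *\<^sub>R ((1 / (y - x)) *\<^sub>R (f y - f x) - D)"
      by (simp add: scaleR_diff_right)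
    then show "norm ((1 / (y - x)) *\<^sub>R (f y - f x) - D) = norm (f y - f x - (y - x) *\<^sub>R D) / norm (y - x)"
      using \<open>y \<noteq> x\<close> by simp
  qed
  ultimately show "((\<lambda>y. norm (f y - f x - (y - x) *\<^sub>R D) / norm (y - x)) \<longlongrightarrow> 0) (at x within S)"
    by (rule Lim_transform_eventually)
qed

text \<open>
  If \<open>h a < h b\<close>, some level \<open>c\<close> in between avoids \<open>h ` E\<close>, which is a null set because \<open>h\<close> is
  Lipschitz. At the last point where \<open>h \<le> c\<close> the derivative exists and is negative, so \<open>h\<close> stays
  below \<open>c\<close> a little longer, a contradiction.
\<close>

lemma lipschitz_decreasing:
  fixes h :: "real \<Rightarrow> real"
  assumes ab: "a \<le> b" and lip: "L-lipschitz_on {a..b} h" and E: "negligible E"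
    and der: "\<And>t. a < t \<Longrightarrow> t < b \<Longrightarrow> t \<notin> E \<Longrightarrow> \<exists>d<0. (h has_real_derivative d) (at t)"
  shows "h b \<le> h a"
proof (rule ccontr)
  assume "\<not> h b \<le> h a"
  then have less: "h a < h b" by simp
  have cont: "continuous_on {a..b} h" using lip by (rule lipschitz_on_continuous_on)
  have "negligible (h ` (E \<inter> {a..b}))"
  proof (rule negligible_locally_Lipschitz_image)
    show "negligible (E \<inter> {a..b})" using E by (rule negligible_Int[OF disjI1])
    show "\<exists>T B. open T \<and> x \<in> T \<and> (\<forall>y\<in>E \<inter> {a..b} \<inter> T. norm (h y - h x) \<le> B * norm (y - x))"
      if "x \<in> E \<inter> {a..b}" for x
      using that lipschitz_onD[OF lip] by (intro exI[of _ UNIV] exI[of _ L]) (auto simp: dist_norm)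
  qed simp
  then have "\<not> {h a<..<h b} \<subseteq> h ` (E \<inter> {a..b})"
    using less negligible_subset open_not_negligible[of "{h a<..<h b}"] by auto
  then obtain c where "c \<in> {h a<..<h b}" and cE: "c \<notin> h ` (E \<inter> {a..b})" by blast
  then have c: "h a < c" "c < h b" by auto
  define S where "S = {t \<in> {a..b}. h t \<le> c}"
  have "closed S" unfolding S_def
    by (intro continuous_on_closed_Collect_le cont continuous_intros closed_real_atLeastAtMost)
  moreover have "S = {a..b} \<inter> S" by (auto simp: S_def)
  ultimately have "compact S" by (metis compact_Icc compact_Int_closed)
  moreover have "S \<noteq> {}" using ab c by (auto simp: S_def)
  ultimately obtain s where s: "s \<in> S" "\<And>t. t \<in> S \<Longrightarrow> t \<le> s"
    using compact_attains_sup by metis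
  have sb: "s < b" using s(1) c by (auto simp: S_def order.order_iff_strict)
  have hs: "h s = c"
  proof (rule ccontr)
    assume "h s \<noteq> c"
    then have "h s < c" using s(1) by (simp add: S_def)
    moreover have "continuous_on {s..b} h" 
      by (rule continuous_on_subset[OF cont]) (use s(1) in \<open>auto simp: S_def\<close>)
    ultimately obtain t where t: "s \<le> t" "t \<le> b" "h t = c"
      using IVT'[of h s c b] sb c by auto
    then have "t \<in> S" using s(1) by (auto simp: S_def)
    then have "t = s" using s(2) t(1) by force
    with t \<open>h s \<noteq> c\<close> show False by simp
  qed
  have "a < s" using hs c s(1) by (auto simp: S_def order.order_iff_strict)
  moreover have "s \<notin> E" using hs cE s(1) by (auto simp: S_def)
  ultimately obtain d where d: "d < 0" "(h has_real_derivative d) (at s)"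
    using der sb by blast
  obtain e where e: "e > 0" "\<And>k. 0 < k \<Longrightarrow> k < e \<Longrightarrow> h (s + k) < h s"
    using DERIV_neg_dec_right[OF d(2,1)] by blast
  \<comment> \<open>a later point of \<open>{a..b}\<close> at which \<open>h\<close> is still below \<open>c\<close>\<close>
  define k where "k = min (e / 2) (b - s)"
  have k: "0 < k" "k < e" "s + k \<le> b" using e(1) sb by (auto simp: k_def)
  then have "s + k \<in> S" using e(2)[of k] hs s(1) by (auto simp: S_def)
  with s(2) k(1) show False by force
qed

text \<open>
  Subtracting \<open>\<delta> * t\<close> makes the derivative strictly negative.
\<close>

lemma lipschitz_nonincreasing:
  fixes g :: "real \<Rightarrow> real"
  assumes ab: "a \<le> b" and lip: "L-lipschitz_on {a..b} g" and E: "negligible E"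
    and der: "\<And>t. a < t \<Longrightarrow> t < b \<Longrightarrow> t \<notin> E \<Longrightarrow> \<exists>d\<le>0. (g has_real_derivative d) (at t)"
  shows "g b \<le> g a"
proof (rule field_le_epsilon)
  fix e :: real assume e: "e > 0"
  \<comment> \<open>the \<open>+ 1\<close> covers the case \<open>a = b\<close>\<close>
  define \<delta> where "\<delta> = e / (b - a + 1)"
  have \<delta>: "\<delta> > 0" "\<delta> * (b - a) \<le> e" using e ab by (auto simp: \<delta>_def field_simps)
  have "g b - \<delta> * b \<le> g a - \<delta> * a"
  proof (rule lipschitz_decreasing[OF ab _ E, of "L + \<delta>" "\<lambda>t. g t - \<delta> * t"])
    have "\<delta>-lipschitz_on {a..b} (\<lambda>t. \<delta> * t)"
      using \<delta>(1) by (intro lipschitz_onI) (auto simp: dist_real_def abs_mult simp flip: right_diff_distrib)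
    then show "(L + \<delta>)-lipschitz_on {a..b} (\<lambda>t. g t - \<delta> * t)"
      by (intro lipschitz_on_diff lip)
    fix t assume "a < t" "t < b" "t \<notin> E"
    then obtain d where d: "d \<le> 0" "(g has_real_derivative d) (at t)" using der by blast
    have "((\<lambda>t. g t - \<delta> * t) has_real_derivative (d - \<delta>)) (at t)"
      by (auto intro!: derivative_eq_intros d)
    then show "\<exists>d<0. ((\<lambda>t. g t - \<delta> * t) has_real_derivative d) (at t)"
      using d(1) \<delta>(1) by (intro exI[of _ "d - \<delta>"]) auto
  qed
  then show "g b \<le> g a + e" using \<delta>(2) by (simp add: algebra_simps)
qed

lemma AE_lebesgue_on_positive:
  fixes P :: "real \<Rightarrow> bool"
  shows "(AE t in lebesgue_on {0<..}. P t) \<longleftrightarrow> (AE t in lebesgue. 0 < t \<longrightarrow> P t)"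
proof (subst AE_restrict_space_iff)
  have "{0<..} \<in> sets (borel :: real measure)" by simp
  then show "{0<..} \<inter> space lebesgue \<in> sets (lebesgue :: real measure)" by simp
qed simp

section \<open>Resolvents and Yosida approximations of maximal monotone operators\<close>

text \<open>
  Maximality is stated as the range condition, which is the form in which convex minimisation
  provides it and in which the implicit Euler scheme uses it.
\<close>

locale maximal_monotone =
  fixes H :: "'a::real_inner set" and A :: "'a \<Rightarrow> 'a set"
  assumes subspace: "subspace H"
    and complete: "complete H"
    and graph: "w \<in> A u \<Longrightarrow> u \<in> H \<and> w \<in> H"
    and monotone: "w \<in> A u \<Longrightarrow> z \<in> A v \<Longrightarrow> 0 \<le> inner (w - z) (u - v)"
    and range: "x \<in> H \<Longrightarrow> \<tau> > 0 \<Longrightarrow> \<exists>y. (1 / \<tau>) *\<^sub>R (x - y) \<in> A y"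
begin

definition resolvent :: "real \<Rightarrow> 'a \<Rightarrow> 'a" where
  "resolvent \<tau> x = (SOME y. (1 / \<tau>) *\<^sub>R (x - y) \<in> A y)"

definition yosida :: "real \<Rightarrow> 'a \<Rightarrow> 'a" where
  "yosida \<tau> x = (1 / \<tau>) *\<^sub>R (x - resolvent \<tau> x)"

lemma yosida_in: "x \<in> H \<Longrightarrow> \<tau> > 0 \<Longrightarrow> yosida \<tau> x \<in> A (resolvent \<tau> x)"
  unfolding yosida_def resolvent_def using range by (metis (mono_tags, lifting) someI_ex)

lemma yosida_in_H: "x \<in> H \<Longrightarrow> \<tau> > 0 \<Longrightarrow> yosida \<tau> x \<in> H"
  using graph yosida_in by blast

lemma resolvent_yosida: "\<tau> > 0 \<Longrightarrow> resolvent \<tau> x = x - \<tau> *\<^sub>R yosida \<tau> x"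
  by (simp add: yosida_def)

lemma resolvent_yosida_diff_inner:
  assumes "x \<in> H" "y \<in> H" "\<tau> > 0"
  shows "0 \<le> inner (yosida \<tau> x - yosida \<tau> y) (resolvent \<tau> x - resolvent \<tau> y)"
  using assms by (intro monotone yosida_in)

text \<open>
  In \<open>x - y\<close>, split into resolvent and Yosida parts, the cross term is nonnegative by monotonicity.
  Both Lipschitz estimates below are read off from this.
\<close>

lemma norm_decomposition:
  assumes "x \<in> H" "y \<in> H" "\<tau> > 0"
  shows "(norm (resolvent \<tau> x - resolvent \<tau> y))\<^sup>2 + (\<tau> * norm (yosida \<tau> x - yosida \<tau> y))\<^sup>2
    \<le> (norm (x - y))\<^sup>2"
proof -
  have "x - y = (resolvent \<tau> x - resolvent \<tau> y) + \<tau> *\<^sub>R (yosida \<tau> x - yosida \<tau> y)"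
    using assms(3) by (simp add: resolvent_yosida scaleR_diff_right)
  then have "(norm (x - y))\<^sup>2 = (norm (resolvent \<tau> x - resolvent \<tau> y))\<^sup>2
      + (\<tau> * norm (yosida \<tau> x - yosida \<tau> y))\<^sup>2
      + 2 * (\<tau> * inner (yosida \<tau> x - yosida \<tau> y) (resolvent \<tau> x - resolvent \<tau> y))"
    by (simp only: power2_norm_eq_inner power_mult_distrib inner_add_left inner_add_right
        inner_scaleR_left inner_scaleR_right)
       (simp add: inner_commute power2_eq_square algebra_simps)
  with resolvent_yosida_diff_inner[OF assms] assms(3) show ?thesis
    by (smt (verit) mult_nonneg_nonneg)
qed

lemma resolvent_nonexpansive:
  assumes "x \<in> H" "y \<in> H" "\<tau> > 0"
  shows "norm (resolvent \<tau> x - resolvent \<tau> y) \<le> norm (x - y)"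
  using norm_decomposition[OF assms]
  by (smt (verit) norm_ge_zero power2_le_imp_le zero_le_power2)

lemma yosida_lipschitz:
  assumes "x \<in> H" "y \<in> H" "\<tau> > 0"
  shows "norm (yosida \<tau> x - yosida \<tau> y) \<le> norm (x - y) / \<tau>"
proof -
  have "\<tau> * norm (yosida \<tau> x - yosida \<tau> y) \<le> norm (x - y)"
    using norm_decomposition[OF assms]
    by (smt (verit) norm_ge_zero power2_le_imp_le zero_le_power2)
  then show ?thesis using assms(3) by (simp add: field_simps)
qed

text \<open>
  The points \<open>(resolvent \<tau> x, yosida \<tau> x)\<close> and \<open>(x, w)\<close> of the graph have base points that differ by
  a multiple of the Yosida approximation itself, so monotonicity compares it with \<open>w\<close>.
\<close>

lemma yosida_norm_le:
  assumes "w \<in> A x" "\<tau> > 0"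
  shows "norm (yosida \<tau> x) \<le> norm w"
proof -
  let ?y = "yosida \<tau> x"
  have x: "x \<in> H" using graph assms(1) by blast
  have "0 \<le> inner (?y - w) (resolvent \<tau> x - x)"
    using assms x by (intro monotone yosida_in)
  also have "\<dots> = \<tau> * (inner w ?y - inner ?y ?y)"
    by (simp add: resolvent_yosida[OF assms(2)] inner_diff_left algebra_simps)
  finally have "inner ?y ?y \<le> inner w ?y"
    using assms(2) by (simp add: zero_le_mult_iff)
  also have "\<dots> \<le> norm w * norm ?y" by (rule norm_cauchy_schwarz)
  finally show ?thesis
    by (metis mult_right_le_imp_le norm_ge_zero order_less_le power2_eq_square power2_norm_eq_inner)
qed

text \<open>
  Solving \<open>y + A y \<ni> x + w\<close> by the range condition and testing the hypothesis at \<open>y\<close> forces \<open>y = x\<close>.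
\<close>

lemma maximal:
  assumes "x \<in> H" "w \<in> H" and test: "\<And>y z. z \<in> A y \<Longrightarrow> 0 \<le> inner (w - z) (x - y)"
  shows "w \<in> A x"
proof -
  have xw: "x + w \<in> H" using assms subspace by (simp add: subspace_add)
  let ?y = "resolvent 1 (x + w)" and ?z = "yosida 1 (x + w)"
  have z: "?z \<in> A ?y" using xw by (simp add: yosida_in)
  have e: "w - ?z = - (x - ?y)" by (simp add: resolvent_yosida)
  have "0 \<le> - inner (x - ?y) (x - ?y)"
    using test[OF z] unfolding e by (simp only: inner_minus_left)
  then have "inner (x - ?y) (x - ?y) = 0"
    using inner_ge_zero[of "x - ?y"] by linarith
  then have "?y = x" by simp
  moreover from this e have "?z = w" by simp
  ultimately show ?thesis using z by simp
qed

lemma graph_closed: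
  assumes "\<And>n. w n \<in> A (x n)" "x \<longlonglongrightarrow> l" "w \<longlonglongrightarrow> m"
  shows "m \<in> A l"
proof (rule maximal)
  have cl: "closed H" by (rule complete_imp_closed[OF complete])
  show "l \<in> H" using closed_sequentially[OF cl _ assms(2)] graph assms(1) by blast
  show "m \<in> H" using closed_sequentially[OF cl _ assms(3)] graph assms(1) by blast
  fix y z assume z: "z \<in> A y"
  have "(\<lambda>n. inner (w n - z) (x n - y)) \<longlonglongrightarrow> inner (m - z) (l - y)"
    by (intro tendsto_intros assms)
  then show "0 \<le> inner (m - z) (l - y)"
    by (rule LIMSEQ_le_const) (use monotone[OF assms(1) z] in auto)
qed

text \<open>
  This turns a bound on the Yosida approximations into strong convergence: their norms grow as the
  parameter decreases, and the increments of the squared norms control the distances.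
\<close>

lemma yosida_diff_le:
  assumes x: "x \<in> H" and "0 < \<tau>" "\<tau> \<le> \<mu>"
  shows "(norm (yosida \<tau> x - yosida \<mu> x))\<^sup>2 \<le> (norm (yosida \<tau> x))\<^sup>2 - (norm (yosida \<mu> x))\<^sup>2"
proof (cases "\<tau> = \<mu>")
  case True
  then show ?thesis by simp
next
  case False
  let ?a = "yosida \<tau> x" and ?b = "yosida \<mu> x"
  have mu: "\<mu> > 0" using assms by linarith
  have "0 \<le> inner (?a - ?b) (resolvent \<tau> x - resolvent \<mu> x)"
    using x assms mu by (intro monotone yosida_in)
  also have "resolvent \<tau> x - resolvent \<mu> x = (\<mu> - \<tau>) *\<^sub>R ?b - \<tau> *\<^sub>R (?a - ?b)"
    using assms mu by (simp add: resolvent_yosida algebra_simps)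
  finally have "\<tau> * (norm (?a - ?b))\<^sup>2 \<le> (\<mu> - \<tau>) * inner (?a - ?b) ?b"
    by (simp add: inner_diff_right power2_norm_eq_inner)
  moreover have "0 \<le> \<tau> * (norm (?a - ?b))\<^sup>2" using assms by simp
  ultimately have "0 \<le> (\<mu> - \<tau>) * inner (?a - ?b) ?b" by linarith
  then have "0 \<le> inner (?a - ?b) ?b" using assms False by (simp add: zero_le_mult_iff)
  then show ?thesis
    by (simp add: power2_norm_eq_inner inner_diff_left inner_diff_right inner_commute)
qed

text \<open>
  The resolvents of \<open>x\<close> tend to \<open>x\<close> and the Yosida approximations are Cauchy by \<open>yosida_diff_le\<close>,
  so closedness of the graph puts their limit into \<open>A x\<close>. This is how points are shown to lie in the
  domain of \<open>A\<close>.
\<close>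

lemma yosida_limit:
  assumes x: "x \<in> H" and bd: "\<And>\<tau>. \<tau> > 0 \<Longrightarrow> norm (yosida \<tau> x) \<le> M"
  obtains w where "w \<in> A x" "norm w \<le> M" "(\<lambda>n. yosida (1 / real (Suc n)) x) \<longlonglongrightarrow> w"
proof -
  define y where "y n = yosida (1 / real (Suc n)) x" for n
  have le: "(norm (y n - y m))\<^sup>2 \<le> (norm (y n))\<^sup>2 - (norm (y m))\<^sup>2" if "m \<le> n" for m n
    unfolding y_def using that by (intro yosida_diff_le x) (auto simp: frac_le)
  have "incseq (\<lambda>n. (norm (y n))\<^sup>2)"
    unfolding incseq_def using le by (smt (verit) zero_le_power2)
  moreover have "(norm (y n))\<^sup>2 \<le> M\<^sup>2" for n
    unfolding y_def by (intro power_mono bd) auto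
  ultimately have "convergent (\<lambda>n. (norm (y n))\<^sup>2)"
    by (meson incseq_convergent convergentI)
  then have cau: "Cauchy (\<lambda>n. (norm (y n))\<^sup>2)" by (rule convergent_Cauchy)
  have "Cauchy y"
  proof (rule CauchyI)
    fix e :: real assume e: "e > 0"
    then obtain K where K: "\<And>m n. m \<ge> K \<Longrightarrow> n \<ge> K \<Longrightarrow> norm ((norm (y m))\<^sup>2 - (norm (y n))\<^sup>2) < e\<^sup>2"
      using CauchyD[OF cau, of "e\<^sup>2"] by auto
    have "norm (y m - y n) < e" if "m \<ge> K" "n \<ge> K" for m n
    proof -
      have "(norm (y m - y n))\<^sup>2 < e\<^sup>2"
        using le[of m n] le[of n m] K[OF that] by (cases "m \<le> n") (auto simp: norm_minus_commute)
      then show ?thesis using e by (simp add: power2_less_imp_less)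
    qed
    then show "\<exists>K. \<forall>m\<ge>K. \<forall>n\<ge>K. norm (y m - y n) < e" by blast
  qed
  moreover have "y n \<in> H" for n unfolding y_def by (intro yosida_in_H x) simp
  ultimately obtain w where w: "w \<in> H" "y \<longlonglongrightarrow> w"
    using complete by (auto simp: complete_def)
  have "(\<lambda>n. x - (1 / real (Suc n)) *\<^sub>R y n) \<longlonglongrightarrow> x - 0 *\<^sub>R w"
    by (intro tendsto_diff tendsto_const tendsto_scaleR w LIMSEQ_Suc[OF lim_1_over_n])
  then have "(\<lambda>n. resolvent (1 / real (Suc n)) x) \<longlonglongrightarrow> x"
    by (simp add: resolvent_yosida y_def)
  then have "w \<in> A x"
    by (rule graph_closed[rotated, OF _ w(2)]) (auto simp: y_def intro!: yosida_in x)
  moreover have "norm w \<le> M"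
    by (rule LIMSEQ_le_const2[OF tendsto_norm[OF w(2)]]) (auto simp: y_def intro!: bd)
  ultimately show ?thesis using that w(2) unfolding y_def by blast
qed

text \<open>
  By maximality \<open>A x\<close> contains the midpoint of \<open>v\<close> and \<open>w\<close>, which by the parallelogram identity
  would be shorter if \<open>v\<close> and \<open>w\<close> differed.
\<close>

lemma least_norm_unique:
  assumes "w \<in> A x" "\<forall>w'\<in>A x. norm w \<le> norm w'" "v \<in> A x" "norm v \<le> norm w"
  shows "v = w"
proof -
  have "(1/2) *\<^sub>R (v + w) \<in> A x"
  proof (rule maximal)
    show "x \<in> H" using graph assms by blast
    show "(1/2) *\<^sub>R (v + w) \<in> H" using graph assms subspace by (meson subspace_add subspace_scale)
    fix y z assume z: "z \<in> A y"
    have "inner ((1/2) *\<^sub>R (v + w) - z) (x - y)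
        = (1/2) * inner (v - z) (x - y) + (1/2) * inner (w - z) (x - y)"
      by (simp add: inner_diff_left inner_add_left field_simps)
    then show "0 \<le> inner ((1/2) *\<^sub>R (v + w) - z) (x - y)"
      using monotone[OF assms(1) z] monotone[OF assms(3) z] by linarith
  qed
  then have "norm w \<le> norm ((1/2) *\<^sub>R (v + w))" using assms(2) by blast
  then have "2 * norm w \<le> norm (v + w)" by simp
  then have "(2 * norm w)\<^sup>2 \<le> (norm (v + w))\<^sup>2" by (intro power_mono) auto
  then have "4 * (norm w)\<^sup>2 \<le> (norm (v + w))\<^sup>2" by (simp add: power_mult_distrib)
  moreover have "(norm v)\<^sup>2 \<le> (norm w)\<^sup>2" using assms(4) by (intro power_mono) auto
  moreover have "(norm (v - w))\<^sup>2 + (norm (v + w))\<^sup>2 = 2 * (norm v)\<^sup>2 + 2 * (norm w)\<^sup>2"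
    by (simp add: power2_norm_eq_inner inner_diff_left inner_diff_right inner_add_left
        inner_add_right inner_commute)
  ultimately have "(norm (v - w))\<^sup>2 \<le> 0" by linarith
  then show ?thesis by simp
qed

abbreviation "Dom \<equiv> op_domain A"
abbreviation "least \<equiv> min_section A"

lemma dom_in_H: "x \<in> Dom \<Longrightarrow> x \<in> H"
  using graph by (auto simp: op_domain_def)

lemma min_section_properties:
  assumes "x \<in> Dom"
  shows "least x \<in> A x" "(\<lambda>n. yosida (1 / real (Suc n)) x) \<longlonglongrightarrow> least x"
    "\<And>w. w \<in> A x \<Longrightarrow> norm (least x) \<le> norm w"
proof -
  obtain v where v: "v \<in> A x" using assms by (auto simp: op_domain_def)
  obtain w where w: "w \<in> A x" "norm w \<le> norm v" "(\<lambda>n. yosida (1 / real (Suc n)) x) \<longlonglongrightarrow> w"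
    using yosida_limit[OF dom_in_H[OF assms] yosida_norm_le[OF v]] by metis
  have min: "norm w \<le> norm w'" if "w' \<in> A x" for w'
    by (rule LIMSEQ_le_const2[OF tendsto_norm[OF w(3)]]) (auto intro!: yosida_norm_le that)
  have e: "least x = w"
    unfolding min_section_def
  proof (rule the_equality)
    show "w \<in> A x \<and> (\<forall>w'\<in>A x. norm w \<le> norm w')" using w(1) min by simp
    show "v = w" if "v \<in> A x \<and> (\<forall>w'\<in>A x. norm v \<le> norm w')" for v
    proof (rule least_norm_unique[OF w(1)])
      show "\<forall>w'\<in>A x. norm w \<le> norm w'" using min by blast
      show "v \<in> A x" using that by blast
      show "norm v \<le> norm w" using that w(1) by blast
    qed
  qed
  show "least x \<in> A x" "(\<lambda>n. yosida (1 / real (Suc n)) x) \<longlonglongrightarrow> least x"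
    unfolding e by (fact w)+
  show "norm (least x) \<le> norm w'" if "w' \<in> A x" for w'
    unfolding e by (rule min[OF that])
qed

lemma yosida_norm_le_least: "x \<in> Dom \<Longrightarrow> \<tau> > 0 \<Longrightarrow> norm (yosida \<tau> x) \<le> norm (least x)"
  by (rule yosida_norm_le[OF min_section_properties(1)])

text \<open>
  For a fixed parameter the Yosida approximation is continuous, so the bound \<open>M\<close> survives the limit
  in \<open>x\<close> before the parameter tends to zero.
\<close>

lemma dom_closed_bounded:
  assumes "\<And>n. x n \<in> Dom" "\<And>n. norm (least (x n)) \<le> M" "x \<longlonglongrightarrow> l"
  shows "l \<in> Dom" "norm (least l) \<le> M"
proof -
  have l: "l \<in> H"
    using closed_sequentially[OF complete_imp_closed[OF complete] _ assms(3)] dom_in_H assms(1) by blast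
  have "norm (yosida \<tau> l) \<le> M" if "\<tau> > 0" for \<tau>
  proof (rule LIMSEQ_le_const2)
    have "(\<lambda>n. yosida \<tau> (x n) - yosida \<tau> l) \<longlonglongrightarrow> 0"
    proof (rule Lim_null_comparison)
      show "\<forall>\<^sub>F n in sequentially. norm (yosida \<tau> (x n) - yosida \<tau> l) \<le> norm (x n - l) / \<tau>"
        using yosida_lipschitz[OF dom_in_H[OF assms(1)] l that] by auto
      show "(\<lambda>n. norm (x n - l) / \<tau>) \<longlonglongrightarrow> 0"
        using assms(3) LIM_zero_iff tendsto_norm_zero tendsto_divide_zero by blast
    qed
    then show "(\<lambda>n. norm (yosida \<tau> (x n))) \<longlonglongrightarrow> norm (yosida \<tau> l)"
      by (intro tendsto_norm) (rule LIM_zero_cancel)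
    show "\<exists>N. \<forall>n\<ge>N. norm (yosida \<tau> (x n)) \<le> M"
      using yosida_norm_le_least[OF assms(1) that] assms(2) order_trans by blast
  qed
  then obtain w where w: "w \<in> A l" "norm w \<le> M" using yosida_limit[OF l] by blast
  then show d: "l \<in> Dom" by (auto simp: op_domain_def)
  show "norm (least l) \<le> M"
    using min_section_properties(3)[OF d w(1)] w(2) by linarith
qed

section \<open>The implicit Euler scheme\<close>

definition euler :: "real \<Rightarrow> nat \<Rightarrow> 'a \<Rightarrow> 'a" where
  "euler \<tau> n = (resolvent \<tau> ^^ n)"

lemma euler_0 [simp]: "euler \<tau> 0 x = x"
  by (simp add: euler_def)

lemma euler_Suc: "euler \<tau> (Suc n) x = resolvent \<tau> (euler \<tau> n x)"
  by (simp add: euler_def)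

lemma euler_add: "euler \<tau> (m + n) x = euler \<tau> m (euler \<tau> n x)"
  by (simp add: euler_def funpow_add)

lemma resolvent_Dom:
  assumes "x \<in> Dom" "\<tau> > 0"
  shows "resolvent \<tau> x \<in> Dom" "norm (least (resolvent \<tau> x)) \<le> norm (least x)"
proof -
  have y: "yosida \<tau> x \<in> A (resolvent \<tau> x)" by (intro yosida_in dom_in_H assms)
  then show d: "resolvent \<tau> x \<in> Dom" by (auto simp: op_domain_def)
  show "norm (least (resolvent \<tau> x)) \<le> norm (least x)"
    using min_section_properties(3)[OF d y] yosida_norm_le_least[OF assms] by linarith
qed

lemma euler_Dom:
  assumes "x \<in> Dom" "\<tau> > 0"
  shows "euler \<tau> n x \<in> Dom \<and> norm (least (euler \<tau> n x)) \<le> norm (least x)"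
proof (induction n)
  case (Suc n)
  then show ?case
    using resolvent_Dom[OF _ assms(2), of "euler \<tau> n x"] by (auto simp: euler_Suc)
qed (simp add: assms)

lemma yosida_euler_le:
  assumes "x \<in> Dom" "\<tau> > 0"
  shows "norm (yosida \<tau> (euler \<tau> n x)) \<le> norm (least x)"
  using euler_Dom[OF assms, of n] yosida_norm_le_least[OF _ assms(2)] order_trans by blast

lemma euler_in_H: "x \<in> Dom \<Longrightarrow> \<tau> > 0 \<Longrightarrow> euler \<tau> n x \<in> H"
  using euler_Dom dom_in_H by blast

lemma euler_step:
  "\<tau> > 0 \<Longrightarrow> euler \<tau> (Suc n) x = euler \<tau> n x - \<tau> *\<^sub>R yosida \<tau> (euler \<tau> n x)"
  by (simp add: euler_Suc resolvent_yosida)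

lemma euler_slope_in:
  "x \<in> Dom \<Longrightarrow> \<tau> > 0 \<Longrightarrow> yosida \<tau> (euler \<tau> n x) \<in> A (euler \<tau> (Suc n) x)"
  unfolding euler_Suc by (intro yosida_in euler_in_H)

lemma euler_nonexpansive:
  assumes "x \<in> Dom" "y \<in> Dom" "\<tau> > 0"
  shows "norm (euler \<tau> n x - euler \<tau> n y) \<le> norm (x - y)"
proof (induction n)
  case (Suc n)
  have "norm (euler \<tau> (Suc n) x - euler \<tau> (Suc n) y) \<le> norm (euler \<tau> n x - euler \<tau> n y)"
    unfolding euler_Suc by (intro resolvent_nonexpansive euler_in_H assms)
  with Suc show ?case by linarith
qed simp

lemma euler_displacement:
  assumes "x \<in> Dom" "\<tau> > 0"
  shows "norm (euler \<tau> n x - x) \<le> real n * \<tau> * norm (least x)"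
proof (induction n)
  case (Suc n)
  have "euler \<tau> (Suc n) x - x = (euler \<tau> n x - x) - \<tau> *\<^sub>R yosida \<tau> (euler \<tau> n x)"
    unfolding euler_step[OF assms(2)] by simp
  then have "norm (euler \<tau> (Suc n) x - x) \<le> norm (euler \<tau> n x - x) + norm (\<tau> *\<^sub>R yosida \<tau> (euler \<tau> n x))"
    by (simp only: norm_triangle_ineq4)
  also have "\<dots> \<le> real n * \<tau> * norm (least x) + \<tau> * norm (least x)"
    using Suc yosida_euler_le[OF assms, of n] assms(2) by (intro add_mono) auto
  finally show ?case by (simp add: algebra_simps)
qed simp

lemma euler_diff:
  assumes "x \<in> Dom" "\<tau> > 0"
  shows "norm (euler \<tau> m x - euler \<tau> n x) \<le> \<bar>real m - real n\<bar> * \<tau> * norm (least x)"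
proof -
  have *: "norm (euler \<tau> m x - euler \<tau> n x) \<le> \<bar>real m - real n\<bar> * \<tau> * norm (least x)" if "n \<le> m" for m n
  proof -
    have "norm (euler \<tau> ((m - n) + n) x - euler \<tau> n x) \<le> real (m - n) * \<tau> * norm (least (euler \<tau> n x))"
      unfolding euler_add using euler_Dom[OF assms] assms(2) by (intro euler_displacement) auto
    also have "\<dots> \<le> real (m - n) * \<tau> * norm (least x)"
      using euler_Dom[OF assms, of n] assms(2) by (intro mult_left_mono) auto
    finally show ?thesis using that by (simp add: of_nat_diff)
  qed
  show ?thesis
    using *[of n m] *[of m n] by (cases "n \<le> m") (auto simp: norm_minus_commute abs_minus_commute)
qed

text \<open>
  Let \<open>w\<close> be the slope of a long step and \<open>v1\<close>, \<open>v2\<close> those of the two half steps. In such a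
  long step the squared distance of the two schemes grows by at most \<open>- \<tau> * inner ((w - v1) + (w - v2)) (p' - q2)\<close>. Monotonicity disposes of
  the second summand, and of the first one up to the discrepancy between \<open>q1\<close> and \<open>q2\<close>, which is
  \<open>\<tau>/2 * v2\<close>. Each long step therefore costs at most \<open>\<tau>\<^sup>2 * N\<^sup>2\<close>.
\<close>

lemma euler_halving:
  assumes x: "x \<in> Dom" and \<tau>: "\<tau> > 0"
  shows "(norm (euler \<tau> n x - euler (\<tau> / 2) (2 * n) x))\<^sup>2 \<le> real n * \<tau>\<^sup>2 * (norm (least x))\<^sup>2"
proof (induction n)
  case (Suc n)
  define N where "N = norm (least x)"
  have h: "\<tau> / 2 > 0" using \<tau> by simp
  define p where "p = euler \<tau> n x"
  define p' where "p' = euler \<tau> (Suc n) x"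
  define q where "q = euler (\<tau>/2) (2 * n) x"
  define q1 where "q1 = euler (\<tau>/2) (Suc (2 * n)) x"
  define q2 where "q2 = euler (\<tau>/2) (Suc (Suc (2 * n))) x"
  define w where "w = yosida \<tau> p"
  define v1 where "v1 = yosida (\<tau>/2) q"
  define v2 where "v2 = yosida (\<tau>/2) q1"
  have in_A: "w \<in> A p'" "v1 \<in> A q1" "v2 \<in> A q2"
    unfolding w_def v1_def v2_def p_def p'_def q_def q1_def q2_def
    using x \<tau> h by (intro euler_slope_in; simp)+
  have steps: "p' = p - \<tau> *\<^sub>R w" "q1 = q - (\<tau>/2) *\<^sub>R v1" "q2 = q1 - (\<tau>/2) *\<^sub>R v2"
    unfolding w_def v1_def v2_def p_def p'_def q_def q1_def q2_def
    using \<tau> h by (simp_all only: euler_step)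
  have N: "norm w \<le> N" "norm v1 \<le> N" "norm v2 \<le> N"
    unfolding w_def v1_def v2_def p_def q_def q1_def N_def
    using x \<tau> h by (intro yosida_euler_le; simp)+
  have "norm (w - v1) \<le> N + N" by (rule order_trans[OF norm_triangle_ineq4]) (use N in linarith)
  then have "norm (w - v1) * norm v2 \<le> (N + N) * N"
    using N by (intro mult_mono) (auto intro: order_trans[OF norm_ge_zero])
  then have cross: "- inner (w - v1) v2 \<le> 2 * N\<^sup>2"
    using Cauchy_Schwarz_ineq2[of "w - v1" v2] by (simp add: power2_eq_square abs_le_iff)
  have ee: "p - q = (p' - q2) + (\<tau>/2) *\<^sub>R ((w - v1) + (w - v2))"
  proof -
    have "\<tau> *\<^sub>R w = (\<tau>/2) *\<^sub>R w + (\<tau>/2) *\<^sub>R w" by (simp flip: scaleR_add_left)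
    then show ?thesis unfolding steps by (simp add: scaleR_add_right scaleR_diff_right)
  qed
  have "(norm (p' - q2))\<^sup>2 \<le> (norm (p - q))\<^sup>2 - \<tau> * inner ((w - v1) + (w - v2)) (p' - q2)"
    unfolding ee norm_add_scaleR_power2 by simp
  also have "inner ((w - v1) + (w - v2)) (p' - q2)
      = inner (w - v1) (p' - q1) + inner (w - v2) (p' - q2) + (\<tau>/2) * inner (w - v1) v2"
    unfolding steps(3) by (simp add: inner_add_left inner_add_right inner_diff_left inner_diff_right algebra_simps)
  also have "(norm (p - q))\<^sup>2 - \<tau> * \<dots> \<le> (norm (p - q))\<^sup>2 - \<tau> * ((\<tau>/2) * inner (w - v1) v2)"
    using monotone[OF in_A(1,2)] monotone[OF in_A(1,3)] \<tau> by (intro diff_left_mono mult_left_mono) auto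
  also have "\<dots> = (norm (p - q))\<^sup>2 + (\<tau>\<^sup>2 / 2) * (- inner (w - v1) v2)"
    by (simp add: power2_eq_square)
  also have "\<dots> \<le> (norm (p - q))\<^sup>2 + (\<tau>\<^sup>2 / 2) * (2 * N\<^sup>2)"
    using cross by (intro add_left_mono mult_left_mono) auto
  also have "\<dots> \<le> real n * \<tau>\<^sup>2 * N\<^sup>2 + \<tau>\<^sup>2 * N\<^sup>2"
    using Suc unfolding p_def q_def N_def by simp
  finally show ?case
    unfolding p'_def q2_def N_def by (simp add: algebra_simps)
qed simp

text \<open>
  One step changes the squared distance to \<open>y\<close> by at most \<open>- 2 * \<tau> * inner z (p' - y)\<close>, and monotonicity
  replaces the slope \<open>z\<close> by \<open>w\<close>. The quadratic term pays for evaluating at \<open>x\<close> instead of \<open>p'\<close>.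
\<close>

lemma euler_energy:
  assumes x: "x \<in> Dom" and \<tau>: "\<tau> > 0" and w: "w \<in> A y"
  shows "(norm (euler \<tau> n x - y))\<^sup>2 - (norm (x - y))\<^sup>2
    \<le> 2 * (real n * \<tau>) * inner w (y - x) + 2 * (real n * \<tau>)\<^sup>2 * norm w * norm (least x)"
proof (induction n)
  case (Suc n)
  define p where "p = euler \<tau> n x"
  define p' where "p' = euler \<tau> (Suc n) x"
  define z where "z = yosida \<tau> p"
  define c where "c = norm w * norm (least x)"
  have c: "0 \<le> c" by (simp add: c_def)
  have step: "p = p' + \<tau> *\<^sub>R z" unfolding p_def p'_def z_def using \<tau> by (simp add: euler_step)
  have z: "z \<in> A p'" unfolding p_def p'_def z_def by (intro euler_slope_in x \<tau>)
  have "norm (p' - x) \<le> real (Suc n) * \<tau> * norm (least x)"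
    unfolding p'_def by (intro euler_displacement x \<tau>)
  then have "norm w * norm (x - p') \<le> norm w * (real (Suc n) * \<tau> * norm (least x))"
    by (intro mult_left_mono) (auto simp: norm_minus_commute)
  then have "inner w (x - p') \<le> real (Suc n) * \<tau> * c"
    using norm_cauchy_schwarz[of w "x - p'"] unfolding c_def by (simp add: algebra_simps)
  moreover have "0 \<le> inner (z - w) (p' - y)" by (intro monotone z w)
  ultimately have a: "- inner z (p' - y) \<le> inner w (y - x) + real (Suc n) * \<tau> * c"
    by (simp add: inner_diff_left inner_diff_right)
  have "p - y = (p' - y) + \<tau> *\<^sub>R z" unfolding step by simp
  then have "(norm (p - y))\<^sup>2 = (norm (p' - y))\<^sup>2 + 2 * \<tau> * inner z (p' - y) + (\<tau> * norm z)\<^sup>2"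
    by (simp only: norm_add_scaleR_power2)
  then have "(norm (p' - y))\<^sup>2 - (norm (p - y))\<^sup>2 \<le> 2 * \<tau> * (- inner z (p' - y))"
    by simp
  also have "\<dots> \<le> 2 * \<tau> * (inner w (y - x) + real (Suc n) * \<tau> * c)"
    using a \<tau> by (intro mult_left_mono) auto
  finally have "(norm (p' - y))\<^sup>2 - (norm (x - y))\<^sup>2
     \<le> 2 * (real n * \<tau>) * inner w (y - x) + 2 * (real n * \<tau>)\<^sup>2 * c
       + 2 * \<tau> * (inner w (y - x) + real (Suc n) * \<tau> * c)"
    using Suc unfolding p_def c_def by (simp add: mult.assoc)
  also have "\<dots> = 2 * (real (Suc n) * \<tau>) * inner w (y - x) + 2 * ((real n)\<^sup>2 + real n + 1) * (\<tau>\<^sup>2 * c)"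
    by (simp add: power2_eq_square algebra_simps)
  also have "\<dots> \<le> 2 * (real (Suc n) * \<tau>) * inner w (y - x) + 2 * (real (Suc n))\<^sup>2 * (\<tau>\<^sup>2 * c)"
  proof (intro add_left_mono mult_right_mono)
    show "2 * ((real n)\<^sup>2 + real n + 1) \<le> 2 * (real (Suc n))\<^sup>2"
      by (simp add: power2_eq_square algebra_simps)
    show "0 \<le> \<tau>\<^sup>2 * c" using c by simp
  qed
  finally show ?case
    unfolding p'_def c_def by (simp only: power_mult_distrib mult_ac)
qed simp

section \<open>The semigroup as the limit of dyadic Euler schemes\<close>

text \<open>
  Dyadic steps make consecutive approximations comparable by step halving.
\<close>

definition approx :: "nat \<Rightarrow> real \<Rightarrow> 'a \<Rightarrow> 'a" where
  "approx k t x = euler (1 / 2 ^ k) (nat \<lfloor>2 ^ k * t\<rfloor>) x"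

definition flow :: "real \<Rightarrow> 'a \<Rightarrow> 'a" where
  "flow t x = lim (\<lambda>k. approx k t x)"

lemma dyadic_floor: "0 \<le> t \<Longrightarrow> \<bar>real (nat \<lfloor>2 ^ k * t\<rfloor>) * (1 / 2 ^ k) - t\<bar> \<le> 1 / 2 ^ k"
proof -
  assume t: "0 \<le> t"
  have "real (nat \<lfloor>2 ^ k * t\<rfloor>) = of_int \<lfloor>2 ^ k * t\<rfloor>" using t by simp
  then have "\<bar>real (nat \<lfloor>2 ^ k * t\<rfloor>) - 2 ^ k * t\<bar> \<le> 1" by linarith
  then have "\<bar>real (nat \<lfloor>2 ^ k * t\<rfloor>) - 2 ^ k * t\<bar> * (1 / 2 ^ k) \<le> 1 * (1 / 2 ^ k)"
    by (intro mult_right_mono) auto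
  moreover have "\<bar>real (nat \<lfloor>2 ^ k * t\<rfloor>) - 2 ^ k * t\<bar> * (1 / 2 ^ k)
      = \<bar>(real (nat \<lfloor>2 ^ k * t\<rfloor>) - 2 ^ k * t) * (1 / 2 ^ k)\<bar>"
    by (simp add: abs_mult)
  moreover have "(real (nat \<lfloor>2 ^ k * t\<rfloor>) - 2 ^ k * t) * (1 / 2 ^ k)
      = real (nat \<lfloor>2 ^ k * t\<rfloor>) * (1 / 2 ^ k) - t"
    by (simp add: field_simps)
  ultimately show ?thesis by (metis mult_1)
qed

lemma approx_in_H: "x \<in> Dom \<Longrightarrow> approx k t x \<in> H"
  unfolding approx_def by (intro euler_in_H) auto

lemma approx_Dom: "x \<in> Dom \<Longrightarrow> approx k t x \<in> Dom \<and> norm (least (approx k t x)) \<le> norm (least x)"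
  unfolding approx_def by (intro euler_Dom) auto

text \<open>
  Halving the steps contributes \<open>sqrt (t * \<tau>)\<close>, and the two roundings of \<open>t\<close> to the grids differ by at
  most one half step. Both are at most geometric with ratio \<open>sqrt (1/2)\<close>.
\<close>

lemma approx_step:
  assumes x: "x \<in> Dom" and t: "0 \<le> t"
  shows "norm (approx (Suc k) t x - approx k t x) \<le> norm (least x) * (sqrt t + 1) * (sqrt (1/2)) ^ k"
proof -
  define N where "N = norm (least x)"
  define \<tau> where "\<tau> = (1::real) / 2 ^ k"
  have \<tau>: "\<tau> > 0" by (simp add: \<tau>_def)
  define m where "m = nat \<lfloor>2 ^ k * t\<rfloor>"
  define m' where "m' = nat \<lfloor>2 ^ Suc k * t\<rfloor>"
  define y where "y = 2 ^ k * t"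
  have y: "0 \<le> y" using t by (simp add: y_def)
  have m_y: "int m = \<lfloor>y\<rfloor>" "int m' = \<lfloor>2 * y\<rfloor>"
    using y by (simp_all add: m_def m'_def y_def mult.assoc)
  have "2 * \<lfloor>y\<rfloor> \<le> \<lfloor>2 * y\<rfloor>" "\<lfloor>2 * y\<rfloor> \<le> 2 * \<lfloor>y\<rfloor> + 1" by linarith+
  then have "m' = 2 * m \<or> m' = 2 * m + 1" unfolding m_y[symmetric] by presburger
  then have m2: "\<bar>real m' - real (2 * m)\<bar> \<le> 1" by auto
  have "real_of_int (int m) \<le> y" unfolding m_y by simp
  then have m1: "real m \<le> 2 ^ k * t" by (simp add: y_def)
  have mt: "real m * \<tau> \<le> t" using m1 by (simp add: \<tau>_def field_simps)
  have "(sqrt (1/2) ^ k)\<^sup>2 = ((sqrt (1/2))\<^sup>2) ^ k" by (simp only: mult.commute flip: power_mult)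
  then have r: "\<tau> = (sqrt (1/2) ^ k)\<^sup>2" by (simp add: \<tau>_def power_one_over)
  have "sqrt (1/2) ^ k \<le> 1" by (rule power_le_one) simp_all
  then have r': "\<tau> \<le> sqrt (1/2) ^ k"
    unfolding r power2_eq_square by (intro mult_left_le) simp_all
  have "norm (euler (\<tau>/2) m' x - euler (\<tau>/2) (2 * m) x) \<le> \<bar>real m' - real (2 * m)\<bar> * (\<tau>/2) * N"
    unfolding N_def using \<tau> by (intro euler_diff x) simp
  also have "\<dots> \<le> 1 * \<tau> * N"
    using m2 \<tau> by (intro mult_mono) (auto simp: N_def)
  also have "\<dots> \<le> N * (sqrt (1/2)) ^ k"
    using r' mult_left_mono[OF r', of N] by (simp add: N_def mult.commute)
  finally have a: "norm (euler (\<tau>/2) m' x - euler (\<tau>/2) (2 * m) x) \<le> N * (sqrt (1/2)) ^ k" .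
  have "(norm (euler \<tau> m x - euler (\<tau>/2) (2 * m) x))\<^sup>2 \<le> real m * \<tau>\<^sup>2 * N\<^sup>2"
    unfolding N_def by (intro euler_halving x \<tau>)
  also have "\<dots> = (real m * \<tau>) * (\<tau> * N\<^sup>2)" by (simp add: power2_eq_square)
  also have "\<dots> \<le> t * (\<tau> * N\<^sup>2)" using mt \<tau> by (intro mult_right_mono) auto
  also have "\<dots> = (N * sqrt t * sqrt (1/2) ^ k)\<^sup>2"
    using t by (simp add: r power_mult_distrib)
  finally have b: "norm (euler \<tau> m x - euler (\<tau>/2) (2 * m) x) \<le> N * sqrt t * sqrt (1/2) ^ k"
    by (rule power2_le_imp_le) (use t in \<open>simp add: N_def\<close>)
  have "approx (Suc k) t x = euler (\<tau>/2) m' x" "approx k t x = euler \<tau> m x"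
    by (simp_all add: approx_def m_def m'_def \<tau>_def mult.commute)
  then have "norm (approx (Suc k) t x - approx k t x)
      \<le> norm (euler (\<tau>/2) m' x - euler (\<tau>/2) (2 * m) x) + norm (euler \<tau> m x - euler (\<tau>/2) (2 * m) x)"
    using norm_triangle_ineq4[of "euler (\<tau>/2) m' x - euler (\<tau>/2) (2 * m) x"
        "euler \<tau> m x - euler (\<tau>/2) (2 * m) x"] by simp
  with a b show ?thesis by (simp add: N_def algebra_simps)
qed

lemma approx_tendsto_flow:
  assumes x: "x \<in> Dom" and t: "0 \<le> t"
  shows "(\<lambda>k. approx k t x) \<longlonglongrightarrow> flow t x"
proof -
  have "Cauchy (\<lambda>k. approx k t x)"
  proof (rule Cauchy_of_summable_steps)
    show "norm (approx (Suc k) t x - approx k t x) \<le> norm (least x) * (sqrt t + 1) * (sqrt (1/2)) ^ k" for k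
      by (rule approx_step[OF x t])
    have "sqrt (1/2) < sqrt 1" by (intro real_sqrt_less_mono) simp
    then show "summable (\<lambda>k. norm (least x) * (sqrt t + 1) * (sqrt (1/2)) ^ k)"
      by (intro summable_mult summable_geometric) simp
  qed
  then obtain l where "(\<lambda>k. approx k t x) \<longlonglongrightarrow> l"
    using complete approx_in_H[OF x] unfolding complete_def by metis
  then show ?thesis unfolding flow_def using limI by metis
qed

lemma flow_Dom:
  assumes "x \<in> Dom" "0 \<le> t"
  shows "flow t x \<in> Dom" "norm (least (flow t x)) \<le> norm (least x)"
  using dom_closed_bounded[OF _ _ approx_tendsto_flow[OF assms]] approx_Dom[OF assms(1)] by blast+

lemma flow_0 [simp]: "flow 0 x = x"
  by (simp add: flow_def approx_def limI)

lemma flow_lipschitz: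
  assumes x: "x \<in> Dom" and t: "0 \<le> t" "0 \<le> s"
  shows "norm (flow t x - flow s x) \<le> \<bar>t - s\<bar> * norm (least x)"
proof (rule LIMSEQ_le)
  show "(\<lambda>k. norm (approx k t x - approx k s x)) \<longlonglongrightarrow> norm (flow t x - flow s x)"
    by (intro tendsto_intros approx_tendsto_flow assms)
  have "(\<lambda>k. (\<bar>t - s\<bar> + 2 * (1 / 2) ^ k) * norm (least x)) \<longlonglongrightarrow> (\<bar>t - s\<bar> + 2 * 0) * norm (least x)"
    by (intro tendsto_intros LIMSEQ_realpow_zero) auto
  then show "(\<lambda>k. (\<bar>t - s\<bar> + 2 * (1 / 2) ^ k) * norm (least x)) \<longlonglongrightarrow> \<bar>t - s\<bar> * norm (least x)"
    by simp
  have "norm (approx k t x - approx k s x) \<le> (\<bar>t - s\<bar> + 2 * (1 / 2) ^ k) * norm (least x)" for k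
  proof -
    let ?m = "real (nat \<lfloor>2 ^ k * t\<rfloor>)" and ?n = "real (nat \<lfloor>2 ^ k * s\<rfloor>)" and ?h = "(1::real) / 2 ^ k"
    have "norm (approx k t x - approx k s x) \<le> \<bar>?m - ?n\<bar> * ?h * norm (least x)"
      unfolding approx_def by (intro euler_diff x) simp
    also have "\<bar>?m - ?n\<bar> * ?h = \<bar>?m * ?h - ?n * ?h\<bar>"
      by (simp add: abs_mult left_diff_distrib flip: diff_divide_distrib)
    also have "\<dots> \<le> \<bar>t - s\<bar> + 2 * (1/2) ^ k"
      using dyadic_floor[OF t(1), of k] dyadic_floor[OF t(2), of k] by (simp add: power_one_over)
    finally show ?thesis by (simp add: mult_right_mono)
  qed
  then show "\<exists>N. \<forall>k\<ge>N. norm (approx k t x - approx k s x) \<le> (\<bar>t - s\<bar> + 2 * (1 / 2) ^ k) * norm (least x)"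
    by blast
qed

text \<open>
  Rounding \<open>s\<close>, \<open>t\<close> and \<open>t + s\<close> to the grid separately misplaces a bounded number of steps, whose effect
  vanishes with the step size.
\<close>

lemma flow_add:
  assumes x: "x \<in> Dom" and t: "0 \<le> t" "0 \<le> s"
  shows "flow (t + s) x = flow t (flow s x)"
proof -
  have lim0: "(\<lambda>k. norm (flow s x - approx k s x) + (3 * (1/2) ^ k) * norm (least x)) \<longlonglongrightarrow> 0"
  proof -
    have "(\<lambda>k. norm (flow s x - approx k s x) + (3 * (1/2) ^ k) * norm (least x))
      \<longlonglongrightarrow> norm (flow s x - flow s x) + (3 * 0) * norm (least x)"
      by (intro tendsto_intros approx_tendsto_flow assms LIMSEQ_realpow_zero) auto
    then show ?thesis by simp
  qed
  have "(\<lambda>k. approx k t (flow s x) - approx k (t + s) x) \<longlonglongrightarrow> 0"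
  proof (rule Lim_null_comparison[OF _ lim0], rule always_eventually, rule allI)
    fix k
    let ?m = "nat \<lfloor>2 ^ k * t\<rfloor>" and ?n = "nat \<lfloor>2 ^ k * s\<rfloor>" and ?l = "nat \<lfloor>2 ^ k * (t + s)\<rfloor>" and ?h = "(1::real) / 2 ^ k"
    have ts: "0 \<le> t + s" using t by simp
    have a: "norm (approx k t (flow s x) - euler ?h ?m (euler ?h ?n x)) \<le> norm (flow s x - approx k s x)"
      unfolding approx_def by (intro euler_nonexpansive flow_Dom assms conjunct1[OF euler_Dom]) simp_all
    have "norm (euler ?h (?m + ?n) x - approx k (t + s) x) \<le> \<bar>real (?m + ?n) - real ?l\<bar> * ?h * norm (least x)"
      unfolding approx_def by (intro euler_diff x) simp
    also have "\<bar>real (?m + ?n) - real ?l\<bar> * ?h = \<bar>real ?m * ?h + real ?n * ?h - real ?l * ?h\<bar>"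
      by (simp add: abs_mult left_diff_distrib flip: diff_divide_distrib add_divide_distrib)
    \<comment> \<open>each of the three roundings is off by at most one step\<close>
    also have "\<dots> \<le> 3 * (1/2) ^ k"
      using dyadic_floor[OF t(1), of k] dyadic_floor[OF t(2), of k] dyadic_floor[OF ts, of k]
      unfolding power_one_over by linarith
    finally have b: "norm (euler ?h (?m + ?n) x - approx k (t + s) x) \<le> (3 * (1/2) ^ k) * norm (least x)"
      by (simp add: mult_right_mono)
    show "norm (approx k t (flow s x) - approx k (t + s) x)
      \<le> norm (flow s x - approx k s x) + (3 * (1/2) ^ k) * norm (least x)"
      by (rule norm_diff_triangle_le[OF a b[unfolded euler_add]])
  qed
  moreover have "(\<lambda>k. approx k t (flow s x) - approx k (t + s) x) \<longlonglongrightarrow> flow t (flow s x) - flow (t + s) x"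
    by (intro tendsto_diff approx_tendsto_flow flow_Dom assms add_nonneg_nonneg)
  ultimately show ?thesis using LIMSEQ_unique by fastforce
qed

lemma flow_energy:
  assumes x: "x \<in> Dom" and h: "0 \<le> h" and w: "w \<in> A y"
  shows "(norm (flow h x - y))\<^sup>2 - (norm (x - y))\<^sup>2
    \<le> 2 * h * inner w (y - x) + 2 * h\<^sup>2 * norm w * norm (least x)"
proof (rule LIMSEQ_le)
  define c where "c k = real (nat \<lfloor>2 ^ k * h\<rfloor>) * (1 / 2 ^ k)" for k
  have "(\<lambda>k. c k - h) \<longlonglongrightarrow> 0"
  proof (rule Lim_null_comparison)
    show "\<forall>\<^sub>F k in sequentially. norm (c k - h) \<le> (1/2) ^ k"
      using dyadic_floor[OF h] by (simp add: c_def power_one_over)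
    show "(\<lambda>k. (1/2::real) ^ k) \<longlonglongrightarrow> 0" by (intro LIMSEQ_realpow_zero) auto
  qed
  then have c: "c \<longlonglongrightarrow> h" by (rule LIM_zero_cancel)
  show "(\<lambda>k. (norm (approx k h x - y))\<^sup>2 - (norm (x - y))\<^sup>2) \<longlonglongrightarrow> (norm (flow h x - y))\<^sup>2 - (norm (x - y))\<^sup>2"
    by (intro tendsto_intros approx_tendsto_flow x h)
  show "(\<lambda>k. 2 * c k * inner w (y - x) + 2 * (c k)\<^sup>2 * norm w * norm (least x))
    \<longlonglongrightarrow> 2 * h * inner w (y - x) + 2 * h\<^sup>2 * norm w * norm (least x)"
    by (intro tendsto_intros c)
  show "\<exists>N. \<forall>k\<ge>N. (norm (approx k h x - y))\<^sup>2 - (norm (x - y))\<^sup>2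
    \<le> 2 * c k * inner w (y - x) + 2 * (c k)\<^sup>2 * norm w * norm (least x)"
    unfolding c_def approx_def by (intro exI allI impI euler_energy x w) simp
qed

section \<open>Differentiability, and uniqueness of solutions\<close>

text \<open>
  Insert \<open>y = resolvent \<tau> z\<close> and \<open>a = yosida \<tau> z\<close> into \<open>flow_energy\<close>. Since \<open>x - y\<close> is \<open>\<tau> *\<^sub>R a\<close> up to
  \<open>x - z\<close>, this bounds \<open>inner (a - q) a\<close> by a multiple of \<open>h / \<tau>\<close>, and the squared distance is then
  at most the difference of the squared norms plus that error. The point \<open>z\<close> is \<open>x\<close> for right
  derivatives and \<open>flow h x\<close> for left derivatives.
\<close>

lemma difference_quotient_near_yosida:
  assumes x: "x \<in> Dom" and h: "h > 0" and \<tau>: "\<tau> > 0" and z: "z \<in> Dom"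
    and zx: "norm (least z) \<le> norm (least x)" "norm (z - x) \<le> h * norm (least x)"
  shows "(norm ((1 / h) *\<^sub>R (x - flow h x) - yosida \<tau> z))\<^sup>2
    \<le> (norm (least x))\<^sup>2 - (norm (yosida \<tau> z))\<^sup>2 + 6 * h * (norm (least x))\<^sup>2 / \<tau>"
proof -
  define N where "N = norm (least x)"
  define q where "q = (1 / h) *\<^sub>R (x - flow h x)"
  define a where "a = yosida \<tau> z"
  define y where "y = resolvent \<tau> z"
  have N0: "0 \<le> N" by (simp add: N_def)
  have a: "a \<in> A y" "norm a \<le> N" "z - y = \<tau> *\<^sub>R a"
    using yosida_in[OF dom_in_H[OF z] \<tau>] yosida_norm_le_least[OF z \<tau>] zx(1) \<tau>
    by (auto simp: a_def y_def N_def resolvent_yosida)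
  have q: "x - flow h x = h *\<^sub>R q" using h by (simp add: q_def)
  have "norm (x - flow h x) \<le> h * N"
    using flow_lipschitz[OF x _ order_refl, of h] h by (simp add: N_def norm_minus_commute)
  then have qN: "norm q \<le> N" unfolding q using h by simp
  have "flow h x - y = (x - y) + (- h) *\<^sub>R q" using q by (simp add: algebra_simps)
  then have "(norm (flow h x - y))\<^sup>2 = (norm (x - y))\<^sup>2 + 2 * (- h) * inner q (x - y) + (- h * norm q)\<^sup>2"
    by (simp only: norm_add_scaleR_power2)
  then have "- (2 * h * inner q (x - y)) \<le> (norm (flow h x - y))\<^sup>2 - (norm (x - y))\<^sup>2"
    by simp
  also have "\<dots> \<le> 2 * h * inner a (y - x) + 2 * h\<^sup>2 * norm a * N"
    unfolding N_def using flow_energy[OF x _ a(1), of h] h by simp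
  also have "\<dots> \<le> - (2 * h * inner a (x - y)) + 2 * h * (h * N\<^sup>2)"
  proof -
    have "2 * h\<^sup>2 * (norm a * N) \<le> 2 * h\<^sup>2 * (N * N)"
      using mult_right_mono[OF a(2) N0] by (intro mult_left_mono) simp_all
    then show ?thesis by (simp add: inner_diff_right algebra_simps power2_eq_square)
  qed
  finally have "2 * h * (inner a (x - y) - inner q (x - y)) \<le> 2 * h * (h * N\<^sup>2)"
    by (simp add: algebra_simps)
  then have A: "inner (a - q) (x - y) \<le> h * N\<^sup>2"
    using h by (simp add: inner_diff_left)
  have "inner (a - q) (z - x) \<le> norm (a - q) * norm (z - x)" by (rule norm_cauchy_schwarz)
  also have "\<dots> \<le> (N + N) * (h * N)"
    using order_trans[OF norm_triangle_ineq4[of a q] add_mono[OF a(2) qN]] zx(2) N0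
    by (intro mult_mono) (auto simp: N_def)
  finally have B: "inner (a - q) (z - x) \<le> 2 * (h * N\<^sup>2)" by (simp add: power2_eq_square algebra_simps)
  have "\<tau> * inner (a - q) a = inner (a - q) (z - x) + inner (a - q) (x - y)"
    unfolding inner_add_right[symmetric] using a(3) by simp
  with A B have "\<tau> * inner (a - q) a \<le> 3 * (h * N\<^sup>2)" by linarith
  then have C: "inner (a - q) a \<le> 3 * h * N\<^sup>2 / \<tau>" using \<tau> by (simp add: field_simps)
  have "(norm (q - a))\<^sup>2 = (norm q)\<^sup>2 - (norm a)\<^sup>2 + 2 * inner (a - q) a"
    by (simp add: power2_norm_eq_inner inner_diff_left inner_diff_right inner_commute)
  also have "\<dots> \<le> N\<^sup>2 - (norm a)\<^sup>2 + 2 * (3 * h * N\<^sup>2 / \<tau>)"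
    using C power_mono[OF qN norm_ge_zero, of 2] by linarith
  finally show ?thesis unfolding q_def a_def N_def by simp
qed

text \<open>
  The parameter of the Yosida approximation is fixed first, close enough to the minimal section;
  then the error term disappears along \<open>F\<close>.
\<close>

lemma difference_quotient_tendsto_least:
  assumes z: "z \<in> Dom"
    and ev: "\<forall>\<^sub>F i in F. x i \<in> Dom \<and> h i > 0 \<and> norm (least z) \<le> norm (least (x i))
        \<and> norm (z - x i) \<le> h i * norm (least (x i))"
    and h: "(h \<longlongrightarrow> 0) F" and N: "((\<lambda>i. norm (least (x i))) \<longlongrightarrow> norm (least z)) F"
  shows "((\<lambda>i. (1 / h i) *\<^sub>R (x i - flow (h i) (x i))) \<longlongrightarrow> least z) F"
proof (rule tendstoI)
  fix e :: real assume e: "e > 0"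
  define Y where "Y n = yosida (1 / real (Suc n)) z" for n
  have Y: "Y \<longlonglongrightarrow> least z" unfolding Y_def by (rule min_section_properties[OF z])
  have "(\<lambda>n. (norm (least z))\<^sup>2 - (norm (Y n))\<^sup>2) \<longlonglongrightarrow> (norm (least z))\<^sup>2 - (norm (least z))\<^sup>2"
    by (intro tendsto_intros Y)
  then have "\<forall>\<^sub>F n in sequentially. (norm (least z))\<^sup>2 - (norm (Y n))\<^sup>2 < (e/2)\<^sup>2"
    using e by (intro order_tendstoD(2)) auto
  moreover have "\<forall>\<^sub>F n in sequentially. dist (Y n) (least z) < e/2"
    using e by (intro tendstoD[OF Y]) simp
  ultimately have "\<forall>\<^sub>F n in sequentially. (norm (least z))\<^sup>2 - (norm (Y n))\<^sup>2 < (e/2)\<^sup>2 \<and> dist (Y n) (least z) < e/2"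
    by (rule eventually_conj)
  then obtain n where n: "(norm (least z))\<^sup>2 - (norm (Y n))\<^sup>2 < (e/2)\<^sup>2" "dist (Y n) (least z) < e/2"
    using eventually_happens'[OF sequentially_bot] by blast
  define \<tau> where "\<tau> = 1 / real (Suc n)"
  have \<tau>: "\<tau> > 0" by (simp add: \<tau>_def)
  have "((\<lambda>i. (norm (least (x i)))\<^sup>2 - (norm (Y n))\<^sup>2 + 6 * h i * (norm (least (x i)))\<^sup>2 / \<tau>)
     \<longlongrightarrow> (norm (least z))\<^sup>2 - (norm (Y n))\<^sup>2 + 6 * 0 * (norm (least z))\<^sup>2 / \<tau>) F"
    using \<tau> by (intro tendsto_intros h N) auto
  then have "\<forall>\<^sub>F i in F. (norm (least (x i)))\<^sup>2 - (norm (Y n))\<^sup>2 + 6 * h i * (norm (least (x i)))\<^sup>2 / \<tau> < (e/2)\<^sup>2"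
    using n(1) by (intro order_tendstoD(2)) auto
  with ev show "\<forall>\<^sub>F i in F. dist ((1 / h i) *\<^sub>R (x i - flow (h i) (x i))) (least z) < e"
  proof eventually_elim
    case (elim i)
    have "(norm ((1 / h i) *\<^sub>R (x i - flow (h i) (x i)) - Y n))\<^sup>2 < (e/2)\<^sup>2"
    proof (rule le_less_trans)
      show "(norm ((1 / h i) *\<^sub>R (x i - flow (h i) (x i)) - Y n))\<^sup>2
        \<le> (norm (least (x i)))\<^sup>2 - (norm (Y n))\<^sup>2 + 6 * h i * (norm (least (x i)))\<^sup>2 / \<tau>"
        unfolding Y_def \<tau>_def[symmetric]
        by (rule difference_quotient_near_yosida[OF _ _ \<tau> z]) (use elim in simp_all)
    qed (use elim in simp)
    then have "norm ((1 / h i) *\<^sub>R (x i - flow (h i) (x i)) - Y n) < e/2"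
      by (rule power2_less_imp_less) (use e in simp)
    then have "dist ((1 / h i) *\<^sub>R (x i - flow (h i) (x i))) (Y n) < e/2"
      by (simp only: dist_norm)
    then show ?case
      using n(2) dist_triangle[of "(1 / h i) *\<^sub>R (x i - flow (h i) (x i))" "least z" "Y n"] by linarith
  qed
qed

lemma flow_shift:
  assumes "x \<in> Dom" "0 \<le> s" "s \<le> t"
  shows "flow t x = flow (t - s) (flow s x)"
  using flow_add[of x "t - s" s] assms by simp

lemma least_flow_antimono:
  assumes "x \<in> Dom" "0 \<le> s" "s \<le> t"
  shows "norm (least (flow t x)) \<le> norm (least (flow s x))"
  using flow_Dom(2)[OF flow_Dom(1)[OF assms(1,2)], of "t - s"] flow_shift[OF assms] assms by simp

lemma flow_quotient_right:
  assumes x: "x \<in> Dom" and t: "0 \<le> t"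
  shows "((\<lambda>s. (1 / (s - t)) *\<^sub>R (flow s x - flow t x)) \<longlongrightarrow> - least (flow t x)) (at_right t)"
proof -
  have d: "flow t x \<in> Dom" using flow_Dom assms by blast
  have "((\<lambda>s. s - t) \<longlongrightarrow> t - t) (at_right t)" by (intro tendsto_intros)
  then have "((\<lambda>s. (1 / (s - t)) *\<^sub>R (flow t x - flow (s - t) (flow t x))) \<longlongrightarrow> least (flow t x)) (at_right t)"
    by (intro difference_quotient_tendsto_least)
       (simp_all add: d eventually_at_filter mult_nonneg_nonneg)
  then have "((\<lambda>s. - ((1 / (s - t)) *\<^sub>R (flow t x - flow (s - t) (flow t x)))) \<longlongrightarrow> - least (flow t x)) (at_right t)"
    by (rule tendsto_minus)
  then show ?thesis
  proof (rule Lim_transform_eventually)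
    show "\<forall>\<^sub>F s in at_right t. - ((1 / (s - t)) *\<^sub>R (flow t x - flow (s - t) (flow t x)))
        = (1 / (s - t)) *\<^sub>R (flow s x - flow t x)"
      unfolding eventually_at_filter
    proof (intro always_eventually allI impI)
      fix s assume "s \<in> {t<..}"
      then have "flow (s - t) (flow t x) = flow s x" using flow_shift[OF x t, of s] by simp
      then show "- ((1 / (s - t)) *\<^sub>R (flow t x - flow (s - t) (flow t x)))
        = (1 / (s - t)) *\<^sub>R (flow s x - flow t x)"
        by (metis minus_diff_eq scaleR_minus_right)
    qed
  qed
qed

text \<open>
  Continuity at \<open>t\<close> is what lets the norms of the minimal sections at the earlier initial points
  \<open>flow s x\<close> converge to the one at \<open>flow t x\<close>.
\<close>

lemma flow_quotient_left:
  assumes x: "x \<in> Dom" and t: "0 < t" and cont: "isCont (\<lambda>s. norm (least (flow s x))) t"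
  shows "((\<lambda>s. (1 / (s - t)) *\<^sub>R (flow s x - flow t x)) \<longlongrightarrow> - least (flow t x)) (at_left t)"
proof -
  have t0: "\<forall>\<^sub>F s in at_left t. 0 < s \<and> s < t"
    using t by (auto simp: eventually_at_left intro!: exI[of _ 0])
  have sh: "flow t x = flow (t - s) (flow s x)" if "0 < s" "s < t" for s
    using flow_shift[OF x, of s t] that by simp
  have "((\<lambda>s. t - s) \<longlongrightarrow> t - t) (at_left t)" by (intro tendsto_intros)
  moreover have "((\<lambda>s. norm (least (flow s x))) \<longlongrightarrow> norm (least (flow t x))) (at_left t)"
    using cont unfolding isCont_def by (rule tendsto_mono[rotated]) (simp add: at_le)
  moreover have "\<forall>\<^sub>F s in at_left t. flow s x \<in> Dom \<and> t - s > 0 \<and> norm (least (flow t x)) \<le> norm (least (flow s x))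
      \<and> norm (flow t x - flow s x) \<le> (t - s) * norm (least (flow s x))"
    using t0
  proof eventually_elim
    case (elim s)
    have d: "flow s x \<in> Dom" using flow_Dom x elim by force
    show ?case
      using d elim least_flow_antimono[OF x, of s t] flow_lipschitz[OF d _ order_refl, of "t - s"]
        sh[of s] by simp
  qed
  ultimately have "((\<lambda>s. (1 / (t - s)) *\<^sub>R (flow s x - flow (t - s) (flow s x))) \<longlongrightarrow> least (flow t x)) (at_left t)"
    using flow_Dom(1)[OF x, of t] t by (intro difference_quotient_tendsto_least) auto
  then have "((\<lambda>s. - ((1 / (t - s)) *\<^sub>R (flow s x - flow (t - s) (flow s x)))) \<longlongrightarrow> - least (flow t x)) (at_left t)"
    by (rule tendsto_minus)
  then show ?thesis
  proof (rule Lim_transform_eventually)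
    show "\<forall>\<^sub>F s in at_left t. - ((1 / (t - s)) *\<^sub>R (flow s x - flow (t - s) (flow s x)))
        = (1 / (s - t)) *\<^sub>R (flow s x - flow t x)"
      using t0
    proof eventually_elim
      case (elim s)
      have "- (1 / (t - s)) = 1 / (s - t)" by (simp add: minus_divide_right)
      then show ?case using sh[of s] elim by (metis scaleR_minus_left)
    qed
  qed
qed

text \<open>
  At all other positive times the left derivative exists as well as the right one. There are only
  countably many exceptions because a monotone function has countably many discontinuities.
\<close>

definition irregular_times :: "'a \<Rightarrow> real set" where
  "irregular_times x = {t \<in> {0<..}. \<not> isCont (\<lambda>s. norm (least (flow s x))) t}"

lemma countable_irregular_times:
  assumes "x \<in> Dom" shows "countable (irregular_times x)"
proof -
  have "mono_on {0<..} (\<lambda>s. - norm (least (flow s x)))"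
    using least_flow_antimono[OF assms] by (auto intro!: mono_onI)
  then have "countable {t \<in> {0<..}. \<not> isCont (\<lambda>s. - norm (least (flow s x))) t}"
    by (intro mono_on_ctble_discont_open) auto
  moreover have "irregular_times x \<subseteq> {t \<in> {0<..}. \<not> isCont (\<lambda>s. - norm (least (flow s x))) t}"
    using continuous_minus[of _ "\<lambda>s. - norm (least (flow s x))"] by (auto simp: irregular_times_def)
  ultimately show ?thesis by (rule countable_subset[rotated])
qed

lemma flow_derivative:
  assumes "x \<in> Dom" "0 < t" "t \<notin> irregular_times x"
  shows "((\<lambda>s. flow s x) has_vector_derivative - least (flow t x)) (at t)"
  using assms
  by (intro has_vector_derivative_quotient filterlim_split_at flow_quotient_left flow_quotient_right)
     (auto simp: irregular_times_def)

text \<open>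
  The derivative is measurable because, outside countably many times, it agrees with the pointwise
  limit of the continuous forward difference quotients of lengths \<open>1 / Suc n\<close>.
\<close>

lemma flow_Linf_derivative:
  assumes x: "x \<in> Dom"
  shows "Linf_derivative_le (\<lambda>t. flow t x) (norm (least x))"
proof -
  let ?u = "\<lambda>t. flow t x"
  have lip: "(norm (least x))-lipschitz_on {0..} ?u"
    using flow_lipschitz[OF x] by (intro lipschitz_onI) (auto simp: dist_norm mult.commute)
  have "AE t in lebesgue. t \<notin> irregular_times x"
    by (intro AE_completion AE_not_in countable_imp_null_set_lborel countable_irregular_times x)
  then have ae: "AE t in lebesgue. 0 < t \<longrightarrow> (?u has_vector_derivative - least (flow t x)) (at t)"
    by (rule AE_mp) (auto intro!: AE_I2 flow_derivative x)
  have "(\<lambda>t. - least (flow t x)) \<in> borel_measurable (lebesgue_on {0<..})"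
  proof (rule borel_measurable_LIMSEQ_metric)
    \<comment> \<open>\<open>max 0 t\<close> extends the quotients continuously to the whole line\<close>
    define g where "g n t = (1 / (1 / real (Suc n))) *\<^sub>R (flow (max 0 t + 1 / real (Suc n)) x - flow (max 0 t) x)" for n t
    have cu: "continuous_on {0..} ?u" using lip by (rule lipschitz_on_continuous_on)
    have "continuous_on UNIV (g n)" for n
      unfolding g_def by (intro continuous_intros continuous_on_compose2[OF cu]) auto
    then have "g n \<in> borel_measurable lebesgue" for n
      by (intro borel_measurable_continuous_onI measurable_completion) (auto intro: borel_measurable_continuous_onI)
    then show "g n \<in> borel_measurable (lebesgue_on {0<..})" for n
      by (rule measurable_restrict_space1)
    fix t :: real assume "t \<in> space (lebesgue_on {0<..})"
    then have t: "0 < t" by (simp add: space_restrict_space)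
    have "filterlim (\<lambda>n. t + 1 / real (Suc n)) (at_right t) sequentially"
    proof (rule tendsto_imp_filterlim_at_right)
      have "(\<lambda>n. t + 1 / real (Suc n)) \<longlonglongrightarrow> t + 0"
        by (intro tendsto_add tendsto_const LIMSEQ_Suc[OF lim_1_over_n])
      then show "(\<lambda>n. t + 1 / real (Suc n)) \<longlonglongrightarrow> t" by simp
    qed simp
    from filterlim_compose[OF flow_quotient_right[OF x less_imp_le[OF t]] this]
    show "(\<lambda>n. g n t) \<longlonglongrightarrow> - least (flow t x)"
      using t by (simp add: g_def max_def)
  qed
  then have "(\<lambda>t. vector_derivative ?u (at t)) \<in> borel_measurable (lebesgue_on {0<..})"
  proof (rule measurable_discrete_difference[OF _ countable_irregular_times[OF x]])
    show "{t} \<in> sets (lebesgue_on {0<..})" if "t \<in> irregular_times x" for t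
      using that by (auto simp: sets_restrict_space_iff irregular_times_def)
    show "- least (flow t x) = vector_derivative ?u (at t)"
      if "t \<in> space (lebesgue_on {0<..})" "t \<notin> irregular_times x" for t
      using that flow_derivative[OF x, of t] vector_derivative_at by (fastforce simp: space_restrict_space)
  qed simp
  moreover have "AE t in lebesgue. 0 < t \<longrightarrow> ?u differentiable (at t)"
    using ae by (rule AE_mp) (auto intro!: AE_I2 differentiableI_vector)
  moreover have "AE t in lebesgue. 0 < t \<longrightarrow> norm (vector_derivative ?u (at t)) \<le> norm (least x)"
    using ae by (rule AE_mp) (auto intro!: AE_I2 flow_Dom(2)[OF x] simp: vector_derivative_at)
  ultimately show ?thesis
    unfolding Linf_derivative_le_def AE_lebesgue_on_positive using lip by blast
qed

lemma flow_strong_solution: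
  assumes x: "x \<in> Dom"
  shows "strong_solution A x (\<lambda>t. flow t x)"
proof -
  have "AE t in lebesgue. t \<notin> irregular_times x"
    by (intro AE_completion AE_not_in countable_imp_null_set_lborel countable_irregular_times x)
  then have "AE t in lebesgue. 0 < t \<longrightarrow> - vector_derivative (\<lambda>t. flow t x) (at t) \<in> A (flow t x)"
  proof (rule AE_mp, intro AE_I2 impI)
    fix t :: real assume t: "t \<notin> irregular_times x" "0 < t"
    have "vector_derivative (\<lambda>t. flow t x) (at t) = - least (flow t x)"
      by (intro vector_derivative_at flow_derivative x t)
    then show "- vector_derivative (\<lambda>t. flow t x) (at t) \<in> A (flow t x)"
      using min_section_properties(1)[OF flow_Dom(1)[OF x, of t]] t by simp
  qed
  then show ?thesis
    unfolding strong_solution_def AE_lebesgue_on_positive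
    using flow_Dom(1)[OF x] flow_Linf_derivative[OF x] by simp
qed

text \<open>
  Where both solutions are differentiable and solve the inclusion, monotonicity of \<open>A\<close> says that the
  derivative of their squared distance is nonpositive.
\<close>

lemma strong_solution_unique:
  assumes u: "strong_solution A x u" and v: "strong_solution A x v" and T: "0 \<le> T"
  shows "u T = v T"
proof -
  obtain L L' where lip: "L-lipschitz_on {0..} u" "L'-lipschitz_on {0..} v"
    using u v unfolding strong_solution_def Linf_derivative_le_def by blast
  define p where "p t = u t - v t" for t
  define K where "K = L + L'"
  have "K-lipschitz_on {0..} p" unfolding p_def K_def by (intro lipschitz_on_diff lip)
  then have lp: "K-lipschitz_on {0..T} p" by (rule lipschitz_on_subset) auto
  have K: "0 \<le> K" using lp by (rule lipschitz_on_nonneg)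
  have p0: "p 0 = 0" using u v by (simp add: p_def strong_solution_def)
  have bd: "norm (p t) \<le> K * T" if "t \<in> {0..T}" for t
  proof -
    have "norm (p t) \<le> K * t" using lipschitz_onD[OF lp that, of 0] T p0 that by (simp add: dist_norm)
    also have "\<dots> \<le> K * T" using K that by (intro mult_left_mono) auto
    finally show ?thesis .
  qed
  have lip2: "(2 * K * T * K)-lipschitz_on {0..T} (\<lambda>t. (norm (p t))\<^sup>2)"
  proof (rule lipschitz_onI)
    fix s t assume st: "s \<in> {0..T}" "t \<in> {0..T}"
    have "\<bar>(norm (p s))\<^sup>2 - (norm (p t))\<^sup>2\<bar> = \<bar>norm (p s) - norm (p t)\<bar> * \<bar>norm (p s) + norm (p t)\<bar>"
      unfolding abs_mult[symmetric] by (simp add: power2_eq_square square_diff_square_factored mult.commute)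
    also have "\<dots> \<le> norm (p s - p t) * (K * T + K * T)"
      using bd[OF st(1)] bd[OF st(2)] norm_triangle_ineq3[of "p s" "p t"] by (intro mult_mono) auto
    also have "\<dots> \<le> (K * dist s t) * (K * T + K * T)"
      using lipschitz_onD[OF lp st] K T by (intro mult_right_mono) (auto simp: dist_norm)
    finally show "dist ((norm (p s))\<^sup>2) ((norm (p t))\<^sup>2) \<le> 2 * K * T * K * dist s t"
      by (simp add: dist_real_def algebra_simps)
  qed (use K T in simp)
  have "AE t in lebesgue. 0 < t \<longrightarrow> (\<exists>d\<le>0. ((\<lambda>t. (norm (p t))\<^sup>2) has_real_derivative d) (at t))"
  proof -
    have "AE t in lebesgue. 0 < t \<longrightarrow> u differentiable (at t) \<and> - vector_derivative u (at t) \<in> A (u t)"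
      "AE t in lebesgue. 0 < t \<longrightarrow> v differentiable (at t) \<and> - vector_derivative v (at t) \<in> A (v t)"
      using u v unfolding strong_solution_def Linf_derivative_le_def AE_lebesgue_on_positive
      by (auto elim: AE_mp)
    then show ?thesis
    proof eventually_elim
      case (elim t)
      show ?case
      proof
        assume t: "0 < t"
        let ?u' = "vector_derivative u (at t)" and ?v' = "vector_derivative v (at t)"
        have "(u has_vector_derivative ?u') (at t)" "(v has_vector_derivative ?v') (at t)"
          using elim t vector_derivative_works by blast+
        then have "(p has_vector_derivative (?u' - ?v')) (at t)"
          unfolding p_def by (rule has_vector_derivative_diff)
        from bounded_bilinear.has_vector_derivative[OF bounded_bilinear_inner this this]
        have "((\<lambda>t. (norm (p t))\<^sup>2) has_real_derivative 2 * inner (?u' - ?v') (p t)) (at t)"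
          by (simp add: power2_norm_eq_inner has_real_derivative_iff_has_vector_derivative inner_commute)
        moreover have "0 \<le> inner (- ?u' - - ?v') (u t - v t)"
          using elim t by (intro monotone) auto
        then have "2 * inner (?u' - ?v') (p t) \<le> 0"
          by (simp add: p_def inner_diff_left)
        ultimately show "\<exists>d\<le>0. ((\<lambda>t. (norm (p t))\<^sup>2) has_real_derivative d) (at t)" by blast
      qed
    qed
  qed
  then obtain E where E: "E \<in> null_sets lebesgue"
    and sub: "{t \<in> space lebesgue. \<not> (0 < t \<longrightarrow> (\<exists>d\<le>0. ((\<lambda>t. (norm (p t))\<^sup>2) has_real_derivative d) (at t)))} \<subseteq> E"
    unfolding eventually_ae_filter by blast
  have der: "\<exists>d\<le>0. ((\<lambda>t. (norm (p t))\<^sup>2) has_real_derivative d) (at t)" if "0 < t" "t \<notin> E" for t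
    using sub that by (simp add: subset_iff) metis
  have "(norm (p T))\<^sup>2 \<le> (norm (p 0))\<^sup>2"
    by (rule lipschitz_nonincreasing[OF T lip2 _ der]) (simp_all add: E negligible_iff_null_sets)
  then show ?thesis using p0 by (simp add: p_def)
qed

theorem evolution_equation:
  assumes "x \<in> Dom"
  shows "\<exists>u. strong_solution A x u \<and>
           (\<forall>v. strong_solution A x v \<longrightarrow> (\<forall>t\<ge>0. v t = u t)) \<and>
           (\<forall>t\<ge>0. \<exists>d. (u has_vector_derivative d) (at_right t) \<and> d + least (u t) = 0)"
proof (intro exI[of _ "\<lambda>t. flow t x"] conjI allI impI)
  show sol: "strong_solution A x (\<lambda>t. flow t x)" by (rule flow_strong_solution[OF assms])
  show "v t = flow t x" if "strong_solution A x v" "0 \<le> t" for v t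
    by (rule strong_solution_unique[OF that(1) sol that(2)])
  show "\<exists>d. ((\<lambda>t. flow t x) has_vector_derivative d) (at_right t) \<and> d + least (flow t x) = 0" if "0 \<le> t" for t
    using has_vector_derivative_quotient[OF flow_quotient_right[OF assms that]]
    by (intro exI[of _ "- least (flow t x)"]) simp
qed

end

section \<open>Subdifferentials of convex functionals with proximal points\<close>

text \<open>
  The midpoint inequality makes every minimising sequence Cauchy. The last hypothesis combines
  completeness of \<open>C\<close> and lower semicontinuity of \<open>G\<close>, for Cauchy sequences only.
\<close>

lemma minimizer_exists:
  fixes C :: "'b::real_normed_vector set" and G :: "'b \<Rightarrow> real"
  assumes ne: "C \<noteq> {}" and nonneg: "\<And>x. x \<in> C \<Longrightarrow> 0 \<le> G x" and c: "c > 0"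
    and mid: "\<And>x y. x \<in> C \<Longrightarrow> y \<in> C \<Longrightarrow>
        (1/2) *\<^sub>R (x + y) \<in> C \<and> G ((1/2) *\<^sub>R (x + y)) + c * (norm (x - y))\<^sup>2 \<le> (G x + G y) / 2"
    and lsc: "\<And>X m. (\<And>n. X n \<in> C) \<Longrightarrow> Cauchy X \<Longrightarrow> (\<lambda>n. G (X n)) \<longlonglongrightarrow> m \<Longrightarrow> \<exists>l\<in>C. G l \<le> m"
  shows "\<exists>l\<in>C. \<forall>x\<in>C. G l \<le> G x"
proof -
  define m where "m = (INF x\<in>C. G x)"
  have bdd: "bdd_below (G ` C)" using nonneg by (intro bdd_belowI[of _ 0]) auto
  have m: "m \<le> G x" if "x \<in> C" for x
    unfolding m_def by (rule cINF_lower[OF bdd that])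
  have "\<exists>x\<in>C. G x < m + 1 / real (Suc n)" for n
    using cINF_less_iff[OF ne bdd, of "m + 1 / real (Suc n)"] by (simp add: m_def)
  then obtain X where X: "\<And>n. X n \<in> C" "\<And>n. G (X n) < m + 1 / real (Suc n)" by metis
  define \<epsilon> where "\<epsilon> n = 1 / real (Suc n)" for n
  have X\<epsilon>: "G (X n) < m + \<epsilon> n" for n using X(2) by (simp add: \<epsilon>_def)
  have close: "c * (norm (X i - X j))\<^sup>2 \<le> \<epsilon> n" if "n \<le> i" "n \<le> j" for i j n
  proof -
    have "m + c * (norm (X i - X j))\<^sup>2 \<le> (G (X i) + G (X j)) / 2"
      using mid[OF X(1)[of i] X(1)[of j]] m[of "(1/2) *\<^sub>R (X i + X j)"] by linarith
    moreover have "\<epsilon> i \<le> \<epsilon> n" "\<epsilon> j \<le> \<epsilon> n"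
      using that by (simp_all add: frac_le \<epsilon>_def)
    ultimately show ?thesis using X\<epsilon>[of i] X\<epsilon>[of j] by argo
  qed
  have "Cauchy X"
  proof (rule CauchyI)
    fix e :: real assume e: "e > 0"
    then obtain n where n: "1 / real (Suc n) < c * e\<^sup>2"
      using c nat_approx_posE[of "c * e\<^sup>2"] by auto
    have "norm (X i - X j) < e" if "n \<le> i" "n \<le> j" for i j
    proof (rule power2_less_imp_less)
      have "c * (norm (X i - X j))\<^sup>2 < c * e\<^sup>2" using close[OF that] n by (simp add: \<epsilon>_def)
      then show "(norm (X i - X j))\<^sup>2 < e\<^sup>2" using c by simp
    qed (use e in simp)
    then show "\<exists>M. \<forall>i\<ge>M. \<forall>j\<ge>M. norm (X i - X j) < e" by blast
  qed
  moreover have "(\<lambda>n. G (X n)) \<longlonglongrightarrow> m"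
  proof (rule tendsto_sandwich[where f = "\<lambda>_. m" and h = "\<lambda>n. m + 1 / real (Suc n)"])
    show "(\<lambda>n. m + 1 / real (Suc n)) \<longlonglongrightarrow> m"
      using tendsto_add[OF tendsto_const LIMSEQ_Suc[OF lim_1_over_n], of m] by simp
    show "\<forall>\<^sub>F n in sequentially. G (X n) \<le> m + 1 / real (Suc n)"
      by (rule always_eventually) (use X(2) less_imp_le in blast)
    show "\<forall>\<^sub>F n in sequentially. m \<le> G (X n)" using m X(1) by simp
  qed simp
  ultimately obtain l where "l \<in> C" "G l \<le> m" using lsc[of X m] X(1) by blast
  then show ?thesis using m order_trans by blast
qed

text \<open>
  The minimiser \<open>u\<close> is compared with the points \<open>(1 - t) *\<^sub>R u + t *\<^sub>R v\<close> of a segment. By convexity of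
  \<open>f\<close> everything is linear in \<open>t\<close> up to \<open>t\<^sup>2\<close>, and dividing by a small \<open>t\<close> leaves the subgradient
  inequality.
\<close>

lemma proximal_point_subgradient:
  fixes H D :: "'a::real_inner set" and f :: "'a \<Rightarrow> real" and F :: "'a \<Rightarrow> ereal"
  assumes H: "subspace H" and DH: "D \<subseteq> H"
    and fin: "\<And>v. v \<in> D \<Longrightarrow> F v = ereal (f v)" and inf: "\<And>v. v \<in> H - D \<Longrightarrow> F v = \<infinity>"
    and conv: "convex_on D f" and x: "x \<in> H" and \<tau>: "\<tau> > 0" and u: "u \<in> D"
    and min: "\<And>v. v \<in> D \<Longrightarrow> f u + (norm (u - x))\<^sup>2 / (2 * \<tau>) \<le> f v + (norm (v - x))\<^sup>2 / (2 * \<tau>)"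
  shows "(1 / \<tau>) *\<^sub>R (x - u) \<in> subdifferential H F u"
proof -
  define w where "w = (1 / \<tau>) *\<^sub>R (x - u)"
  have ineq: "f u + inner w (v - u) \<le> f v" if v: "v \<in> D" for v
  proof (rule field_le_epsilon)
    fix e :: real assume e: "e > 0"
    define r where "r = (norm (v - u))\<^sup>2 / (2 * \<tau>)"
    have r: "0 \<le> r" using \<tau> by (simp add: r_def)
    \<comment> \<open>a point of the segment so close to \<open>u\<close> that the quadratic error \<open>t * r\<close> is at most \<open>e\<close>\<close>
    define t where "t = min (1/2) (e / (r + 1))"
    have t: "0 < t" "t < 1" using e r by (auto simp: t_def)
    have "t * r \<le> e / (r + 1) * (r + 1)" using t e r by (intro mult_mono) (auto simp: t_def)
    then have tr: "t * r \<le> e" using r by simp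
    define y where "y = (1 - t) *\<^sub>R u + t *\<^sub>R v"
    have yD: "y \<in> D" unfolding y_def using conv t u v by (intro convexD[OF convex_on_imp_convex]) auto
    have fy: "f y \<le> (1 - t) * f u + t * f v"
      unfolding y_def using convex_onD[OF conv, of t u v] t u v by simp
    have "y - x = (u - x) + t *\<^sub>R (v - u)" by (simp add: y_def algebra_simps)
    then have "(norm (y - x))\<^sup>2 = (norm (u - x))\<^sup>2 + 2 * t * inner (v - u) (u - x) + (t * norm (v - u))\<^sup>2"
      by (simp only: norm_add_scaleR_power2)
    moreover have "inner (v - u) (u - x) = - \<tau> * inner w (v - u)"
      using \<tau> by (simp add: w_def inner_diff_left inner_diff_right inner_commute algebra_simps)
    ultimately have "(norm (y - x))\<^sup>2 / (2 * \<tau>)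
        = (norm (u - x))\<^sup>2 / (2 * \<tau>) - t * inner w (v - u) + t * (t * r)"
      using \<tau> by (simp add: r_def field_simps power2_eq_square)
    then have "t * (f u + inner w (v - u)) \<le> t * (f v + t * r)"
      using min[OF yD] fy by (simp add: algebra_simps)
    then have "f u + inner w (v - u) \<le> f v + t * r" using t by simp
    then show "f u + inner w (v - u) \<le> f v + e" using tr by linarith
  qed
  have "w \<in> H" unfolding w_def using x u DH H by (auto intro!: subspace_scale subspace_diff)
  moreover have "F u + ereal (inner w (v - u)) \<le> F v" if "v \<in> H" for v
    using ineq[of v] fin[of v] inf[of v] fin[OF u] that by (cases "v \<in> D") auto
  ultimately show ?thesis
    using u DH fin[OF u] unfolding subdifferential_def w_def[symmetric] by auto
qed

text \<open>
  Adding two subgradient inequalities gives monotonicity; the proximal points provide the range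
  condition. The pair \<open>D\<close>, \<open>f\<close> is the effective domain of \<open>F\<close> with its real values.
\<close>

lemma subdifferential_maximal_monotone:
  fixes H D :: "'a::real_inner set" and f :: "'a \<Rightarrow> real" and F :: "'a \<Rightarrow> ereal"
  assumes H: "subspace H" "complete H" and DH: "D \<subseteq> H"
    and fin: "\<And>v. v \<in> D \<Longrightarrow> F v = ereal (f v)" and inf: "\<And>v. v \<in> H - D \<Longrightarrow> F v = \<infinity>"
    and conv: "convex_on D f"
    and prox: "\<And>x \<tau>. x \<in> H \<Longrightarrow> \<tau> > 0 \<Longrightarrow>
      \<exists>u\<in>D. \<forall>v\<in>D. f u + (norm (u - x))\<^sup>2 / (2 * \<tau>) \<le> f v + (norm (v - x))\<^sup>2 / (2 * \<tau>)"
  shows "maximal_monotone H (subdifferential H F)"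
proof
  fix u v w z
  assume w: "w \<in> subdifferential H F u"
  then show "u \<in> H \<and> w \<in> H" by (simp add: subdifferential_def)
  have D: "a \<in> D" "F a = ereal (f a)" if "b \<in> subdifferential H F a" for a b
    using that inf[of a] fin[of a] by (auto simp: subdifferential_def)
  assume z: "z \<in> subdifferential H F v"
  have "F u + ereal (inner w (v - u)) \<le> F v" "F v + ereal (inner z (u - v)) \<le> F u"
    using w z by (auto simp: subdifferential_def)
  then have "f u + inner w (v - u) \<le> f v" "f v + inner z (u - v) \<le> f u"
    using D[OF w] D[OF z] by simp_all
  then show "0 \<le> inner (w - z) (u - v)"
    by (simp add: inner_diff_left inner_diff_right)
next
  fix x and \<tau> :: real assume x: "x \<in> H" "\<tau> > 0"
  then show "\<exists>y. (1 / \<tau>) *\<^sub>R (x - y) \<in> subdifferential H F y"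
    using prox[OF x] proximal_point_subgradient[OF H(1) DH fin inf conv x] by blast
qed (use H in auto)

text \<open>
  A bound \<open>F u \<le> c\<close> means \<open>inner u z \<le> c\<close> for all \<open>z \<in> Z\<close>, which is stable under convex combinations
  and under limits of \<open>u\<close> and \<open>c\<close>. The element \<open>0\<close> of \<open>Z\<close> makes \<open>F\<close> nonnegative.
\<close>

lemma support_functional_maximal_monotone:
  fixes H Z :: "'a::real_inner set"
  assumes H: "subspace H" "complete H" and Z: "0 \<in> Z"
  shows "maximal_monotone H (subdifferential H (\<lambda>u. SUP z\<in>Z. ereal (inner u z)))"
proof -
  define F where "F u = (SUP z\<in>Z. ereal (inner u z))" for u
  define D where "D = {u \<in> H. F u < \<infinity>}"
  define f where "f u = real_of_ereal (F u)" for u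
  have nonneg: "0 \<le> F u" for u
    using SUP_upper[OF Z, of "\<lambda>z. ereal (inner u z)"]
    by (simp add: F_def flip: zero_ereal_def)
  have fin: "F u = ereal (f u)" if "u \<in> D" for u
    using that nonneg[of u] by (cases "F u") (auto simp: D_def f_def)
  have f_ge: "inner u z \<le> f u" if "u \<in> D" "z \<in> Z" for u z
    using SUP_upper[OF that(2), of "\<lambda>z. ereal (inner u z)"] fin[OF that(1)] by (simp add: F_def)
  have D_I: "u \<in> D \<and> f u \<le> c" if "u \<in> H" "\<And>z. z \<in> Z \<Longrightarrow> inner u z \<le> c" for u c
  proof -
    have "F u \<le> ereal c" unfolding F_def using that(2) by (intro SUP_least) simp
    then have "u \<in> D" using that(1) by (auto simp: D_def intro: le_less_trans)
    with \<open>F u \<le> ereal c\<close> fin show ?thesis by simp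
  qed
  have comb: "(1 - t) *\<^sub>R u + t *\<^sub>R v \<in> D \<and> f ((1 - t) *\<^sub>R u + t *\<^sub>R v) \<le> (1 - t) * f u + t * f v"
    if "u \<in> D" "v \<in> D" "0 \<le> t" "t \<le> 1" for u v t
  proof (rule D_I)
    show "(1 - t) *\<^sub>R u + t *\<^sub>R v \<in> H"
      using that H(1) by (auto simp: D_def intro!: subspace_add subspace_scale)
    show "inner ((1 - t) *\<^sub>R u + t *\<^sub>R v) z \<le> (1 - t) * f u + t * f v" if "z \<in> Z" for z
      unfolding inner_add_left inner_scaleR_left
      using \<open>0 \<le> t\<close> \<open>t \<le> 1\<close> f_ge[OF \<open>u \<in> D\<close> that] f_ge[OF \<open>v \<in> D\<close> that]
      by (intro add_mono mult_left_mono) auto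
  qed
  have "convex D" unfolding convex_alt using comb by blast
  then have conv: "convex_on D f" using comb by (intro convex_onI) auto
  have "maximal_monotone H (subdifferential H F)"
  proof (rule subdifferential_maximal_monotone[OF H _ fin _ conv])
    show "D \<subseteq> H" by (auto simp: D_def)
    show "F v = \<infinity>" if "v \<in> H - D" for v using that by (simp add: D_def)
    fix x and \<tau> :: real assume x: "x \<in> H" and \<tau>: "\<tau> > 0"
    define G where "G u = f u + (norm (u - x))\<^sup>2 / (2 * \<tau>)" for u
    have "\<exists>l\<in>D. \<forall>v\<in>D. G l \<le> G v"
    proof (rule minimizer_exists[where c = "1 / (8 * \<tau>)"])
      have "0 \<in> D" using D_I[of 0 0] H(1) by (simp add: subspace_0)
      then show "D \<noteq> {}" by blast
      show "0 \<le> G u" if "u \<in> D" for u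
        using f_ge[OF that Z] \<tau> by (simp add: G_def)
      show "1 / (8 * \<tau>) > 0" using \<tau> by simp
    next
      fix u v assume uv: "u \<in> D" "v \<in> D"
      have "(1/2) *\<^sub>R (u + v) = (1 - 1/2) *\<^sub>R u + (1/2) *\<^sub>R v" by (simp add: scaleR_add_right)
      with comb[OF uv, of "1/2"] have "(1/2) *\<^sub>R (u + v) \<in> D" "f ((1/2) *\<^sub>R (u + v)) \<le> (f u + f v) / 2"
        by simp_all
      then show "(1/2) *\<^sub>R (u + v) \<in> D \<and>
          G ((1/2) *\<^sub>R (u + v)) + 1 / (8 * \<tau>) * (norm (u - v))\<^sup>2 \<le> (G u + G v) / 2"
        unfolding G_def using proximal_term_midpoint[OF \<tau>, of u v x] by argo
    next
      fix X m assume X: "\<And>n. X n \<in> D" "Cauchy X" "(\<lambda>n. G (X n)) \<longlonglongrightarrow> m"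
      obtain l where l: "l \<in> H" "X \<longlonglongrightarrow> l"
        using H(2) X(1,2) unfolding complete_def D_def by blast
      have "l \<in> D \<and> f l \<le> m - (norm (l - x))\<^sup>2 / (2 * \<tau>)"
      proof (rule D_I[OF l(1)])
        fix z assume z: "z \<in> Z"
        have "(\<lambda>n. G (X n) - (norm (X n - x))\<^sup>2 / (2 * \<tau>)) \<longlonglongrightarrow> m - (norm (l - x))\<^sup>2 / (2 * \<tau>)"
          using \<tau> by (intro tendsto_intros X l) simp
        moreover have "(\<lambda>n. inner (X n) z) \<longlonglongrightarrow> inner l z" by (intro tendsto_intros l)
        moreover have "inner (X n) z \<le> G (X n) - (norm (X n - x))\<^sup>2 / (2 * \<tau>)" for n
          using f_ge[OF X(1) z, of n] by (simp add: G_def)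
        ultimately show "inner l z \<le> m - (norm (l - x))\<^sup>2 / (2 * \<tau>)"
          by (intro LIMSEQ_le) auto
      qed
      then show "\<exists>l\<in>D. G l \<le> m" by (intro bexI[of _ l]) (auto simp: G_def)
    qed
    then show "\<exists>u\<in>D. \<forall>v\<in>D. f u + (norm (u - x))\<^sup>2 / (2 * \<tau>) \<le> f v + (norm (v - x))\<^sup>2 / (2 * \<tau>)"
      by (simp add: G_def)
  qed
  then show ?thesis by (simp add: F_def[abs_def])
qed

section \<open>Completeness of the space of square-integrable functions\<close>

lemma square_integrable_rep: "square_integrable (rep_l2 u)"
  using Quotient_rep_reflp[OF Quotient_l2, of u] by (simp add: l2_rel_def)

lemma rep_abs_l2: "square_integrable f \<Longrightarrow> AE x in lebesgue. rep_l2 (abs_l2 f) x = f x"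
  using Quotient_rep_abs[OF Quotient_l2, of f] by (simp add: l2_rel_def)

lemma l2_eq_iff: "u = v \<longleftrightarrow> (AE x in lebesgue. rep_l2 u x = rep_l2 v x)"
  using Quotient_rel_rep[OF Quotient_l2, of u v] square_integrable_rep by (simp add: l2_rel_def)

lemma rep_measurable [measurable]: "rep_l2 u \<in> borel_measurable lebesgue"
  using square_integrable_rep[of u] by (simp add: square_integrable_def)

lemma rep_add: "AE x in lebesgue. rep_l2 (u + v) x = rep_l2 u x + rep_l2 v x"
  unfolding plus_l2_def map_fun_def comp_def id_def
  by (intro rep_abs_l2 square_integrable_add square_integrable_rep)

lemma rep_diff: "AE x in lebesgue. rep_l2 (u - v) x = rep_l2 u x - rep_l2 v x"
  unfolding minus_l2_def map_fun_def comp_def id_def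
  by (intro rep_abs_l2 square_integrable_diff square_integrable_rep)

lemma rep_scaleR: "AE x in lebesgue. rep_l2 (c *\<^sub>R u) x = c * rep_l2 u x"
  unfolding scaleR_l2_def map_fun_def comp_def id_def
  by (intro rep_abs_l2 square_integrable_scale square_integrable_rep)

lemma rep_zero: "AE x in lebesgue. rep_l2 0 x = 0"
  unfolding zero_l2_def by (intro rep_abs_l2 square_integrable_zero)

lemma inner_rep: "inner u v = (LINT x|lebesgue. rep_l2 u x * rep_l2 v x)"
  by (simp add: inner_l2_def)

lemma norm_rep: "(norm u)\<^sup>2 = (LINT x|lebesgue. (rep_l2 u x)\<^sup>2)"
  unfolding power2_norm_eq_inner inner_rep by (simp add: power2_eq_square)

lemma inner_abs:
  assumes "square_integrable f"
  shows "inner u (abs_l2 f) = (LINT x|lebesgue. rep_l2 u x * f x)"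
  unfolding inner_rep
  by (rule integral_cong_AE)
     (use rep_abs_l2[OF assms] assms in \<open>auto simp: square_integrable_def\<close>)

lemma norm_abs:
  assumes "square_integrable f"
  shows "(norm (abs_l2 f))\<^sup>2 = (LINT x|lebesgue. (f x)\<^sup>2)"
  unfolding norm_rep
  by (rule integral_cong_AE)
     (use rep_abs_l2[OF assms] assms in \<open>auto simp: square_integrable_def\<close>)

lemma norm_diff_rep: "(norm (u - v))\<^sup>2 = (LINT x|lebesgue. (rep_l2 u x - rep_l2 v x)\<^sup>2)"
  unfolding norm_rep by (rule integral_cong_AE) (use rep_diff[of u v] in auto)

lemma integrable_diff_power2: "integrable lebesgue (\<lambda>x. (rep_l2 u x - rep_l2 v x)\<^sup>2)"
  using square_integrable_diff[OF square_integrable_rep square_integrable_rep, of u v]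
  by (simp add: square_integrable_def)

lemma positive_square_integrable_weight:
  obtains \<rho> :: "real^2 \<Rightarrow> real" where "square_integrable \<rho>" "\<And>x. 0 < \<rho> x"
proof -
  obtain p :: "real^2 \<Rightarrow> real" where p: "p \<in> borel_measurable lborel" "\<And>x. 0 < p x" "integrable lborel p"
    using sigma_finite_measure.obtain_positive_integrable_function[OF sigma_finite_lborel] by metis
  have "integrable lebesgue p" using p by (simp add: integrable_completion)
  moreover have "(sqrt (p x))\<^sup>2 = p x" for x using p(2)[of x] by simp
  ultimately have "square_integrable (\<lambda>x. sqrt (p x))"
    using measurable_completion[OF p(1)] by (simp add: square_integrable_def)
  with p(2) show ?thesis by (intro that[of "\<lambda>x. sqrt (p x)"]) auto
qed

text \<open>
  On a space of infinite measure, convergence in mean square does not imply convergence in mean.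
  After multiplication by a strictly positive square-integrable weight it does, by the Cauchy-Schwarz
  inequality, and the weight does not affect pointwise convergence.
\<close>

lemma l2_Cauchy_subseq_AE:
  assumes X: "Cauchy X"
  obtains r where "strict_mono r" "AE x in lebesgue. Cauchy (\<lambda>k. rep_l2 (X (r k)) x)"
proof -
  obtain \<rho> where \<rho>: "square_integrable \<rho>" "\<And>x. 0 < \<rho> x" using positive_square_integrable_weight by blast
  define s where "s n x = rep_l2 (X n) x * \<rho> x" for n x
  have int: "integrable lebesgue (s n)" for n
    unfolding s_def by (intro square_integrable_mult square_integrable_rep \<rho>)
  have bound: "(LINT x|lebesgue. norm (s i x - s j x)) \<le> norm (X i - X j) * norm (abs_l2 \<rho>)" for i j
  proof -
    let ?d = "\<lambda>x. rep_l2 (X i) x - rep_l2 (X j) x"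
    have "square_integrable ?d" by (intro square_integrable_diff square_integrable_rep)
    then have d: "square_integrable (\<lambda>x. \<bar>?d x\<bar>)"
      unfolding square_integrable_def by (auto intro: borel_measurable_abs)
    have "norm (s i x - s j x) = \<bar>?d x\<bar> * \<rho> x" for x
      using \<rho>(2)[of x] by (simp add: s_def abs_mult flip: left_diff_distrib)
    then have "(LINT x|lebesgue. norm (s i x - s j x)) = (LINT x|lebesgue. \<rho> x * \<bar>?d x\<bar>)"
      by (simp add: mult.commute)
    also have "\<dots> = (LINT x|lebesgue. rep_l2 (abs_l2 \<rho>) x * \<bar>?d x\<bar>)"
      by (rule integral_cong_AE)
         (use rep_abs_l2[OF \<rho>(1)] \<rho>(1) d in \<open>auto simp: square_integrable_def\<close>)
    also have "\<dots> = inner (abs_l2 \<rho>) (abs_l2 (\<lambda>x. \<bar>?d x\<bar>))"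
      by (simp add: inner_abs[OF d])
    also have "\<dots> \<le> norm (abs_l2 \<rho>) * norm (abs_l2 (\<lambda>x. \<bar>?d x\<bar>))"
      by (rule norm_cauchy_schwarz)
    also have "norm (abs_l2 (\<lambda>x. \<bar>?d x\<bar>)) = norm (X i - X j)"
    proof (rule power2_eq_imp_eq)
      show "(norm (abs_l2 (\<lambda>x. \<bar>?d x\<bar>)))\<^sup>2 = (norm (X i - X j))\<^sup>2"
        by (simp add: norm_abs[OF d] norm_diff_rep)
    qed simp_all
    finally show ?thesis by (simp add: mult.commute)
  qed
  have "\<exists>N. \<forall>i\<ge>N. \<forall>j\<ge>N. LINT x|lebesgue. norm (s i x - s j x) < e" if e: "e > 0" for e
  proof -
    \<comment> \<open>the \<open>+ 1\<close> only makes the bound positive\<close>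
    define K where "K = norm (abs_l2 \<rho>) + 1"
    have K: "K > 0" "norm (abs_l2 \<rho>) \<le> K" by (auto simp: K_def add_nonneg_pos)
    obtain N where N: "\<And>i j. i \<ge> N \<Longrightarrow> j \<ge> N \<Longrightarrow> norm (X i - X j) < e / K"
      using CauchyD[OF X, of "e / K"] e K by auto
    have "(LINT x|lebesgue. norm (s i x - s j x)) < e" if "i \<ge> N" "j \<ge> N" for i j
    proof -
      have "norm (X i - X j) * norm (abs_l2 \<rho>) \<le> norm (X i - X j) * K"
        using K by (intro mult_left_mono) auto
      also have "\<dots> < e" using N[OF that] K by (simp add: pos_less_divide_eq)
      finally show ?thesis using bound[of i j] by linarith
    qed
    then show ?thesis by blast
  qed
  from cauchy_L1_AE_cauchy_subseq[of lebesgue s, OF int this]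
  obtain r where r: "strict_mono r" "AE x in lebesgue. Cauchy (\<lambda>i. s (r i) x)" by blast
  have "AE x in lebesgue. Cauchy (\<lambda>k. rep_l2 (X (r k)) x)"
    using r(2)
  proof eventually_elim
    case (elim x)
    then have "convergent (\<lambda>k. s (r k) x * inverse (\<rho> x))"
      by (intro convergent_mult convergent_const Cauchy_convergent)
    moreover have "s (r k) x * inverse (\<rho> x) = rep_l2 (X (r k)) x" for k
      using less_imp_neq[OF \<rho>(2)[of x]] by (simp add: s_def)
    ultimately show ?case by (simp add: convergent_Cauchy)
  qed
  with r(1) show ?thesis by (rule that)
qed

text \<open>
  The Riesz-Fischer theorem. The candidate for the limit is the pointwise limit of a subsequence, and
  Fatou's lemma bounds its distance to the members of the sequence.
\<close>

lemma l2_Cauchy_convergent: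
  assumes X: "Cauchy X"
  obtains l r where "X \<longlonglongrightarrow> l" "strict_mono r" "AE x in lebesgue. (\<lambda>k. rep_l2 (X (r k)) x) \<longlonglongrightarrow> rep_l2 l x"
proof -
  obtain r where r: "strict_mono r" "AE x in lebesgue. Cauchy (\<lambda>k. rep_l2 (X (r k)) x)"
    using l2_Cauchy_subseq_AE[OF X] .
  define F where "F x = lim (\<lambda>k. rep_l2 (X (r k)) x)" for x
  have Fm: "F \<in> borel_measurable lebesgue"
    unfolding F_def by (intro borel_measurable_lim_metric rep_measurable)
  have lim: "AE x in lebesgue. (\<lambda>k. rep_l2 (X (r k)) x) \<longlonglongrightarrow> F x"
    using r(2) by eventually_elim (simp add: F_def convergent_LIMSEQ_iff[symmetric] real_Cauchy_convergent)
  have near: "integrable lebesgue (\<lambda>x. (F x - rep_l2 (X m) x)\<^sup>2) \<and> (LINT x|lebesgue. (F x - rep_l2 (X m) x)\<^sup>2) \<le> e\<^sup>2"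
    if N: "\<And>i j. i \<ge> N \<Longrightarrow> j \<ge> N \<Longrightarrow> norm (X i - X j) < e" and m: "m \<ge> N" for N m e
  proof -
    have e: "e \<ge> 0" using N[OF m m] by simp
    have meas: "(\<lambda>x. ennreal ((rep_l2 (X (r k)) x - rep_l2 (X m) x)\<^sup>2)) \<in> borel_measurable lebesgue" for k
      by measurable
    have bound: "(\<integral>\<^sup>+x. ennreal ((rep_l2 (X (r k)) x - rep_l2 (X m) x)\<^sup>2) \<partial>lebesgue) \<le> ennreal (e\<^sup>2)"
      if "k \<ge> N" for k
    proof -
      have "r k \<ge> N" using that seq_suble[OF r(1), of k] by linarith
      then have "(norm (X (r k) - X m))\<^sup>2 \<le> e\<^sup>2"
        using N[OF _ m] by (intro power_mono) (auto intro: less_imp_le)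
      then show ?thesis
        by (subst nn_integral_eq_integral) (auto simp: integrable_diff_power2 norm_diff_rep intro!: ennreal_leI)
    qed
    have "(\<integral>\<^sup>+x. ennreal ((F x - rep_l2 (X m) x)\<^sup>2) \<partial>lebesgue)
        = (\<integral>\<^sup>+x. liminf (\<lambda>k. ennreal ((rep_l2 (X (r k)) x - rep_l2 (X m) x)\<^sup>2)) \<partial>lebesgue)"
    proof (rule nn_integral_cong_AE, use lim in eventually_elim)
      case (elim x)
      then have "(\<lambda>k. ennreal ((rep_l2 (X (r k)) x - rep_l2 (X m) x)\<^sup>2)) \<longlonglongrightarrow> ennreal ((F x - rep_l2 (X m) x)\<^sup>2)"
        by (intro tendsto_ennrealI tendsto_intros)
      from lim_imp_Liminf[OF sequentially_bot this] show ?case by (rule sym)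
    qed
    also have "\<dots> \<le> liminf (\<lambda>k. \<integral>\<^sup>+x. ennreal ((rep_l2 (X (r k)) x - rep_l2 (X m) x)\<^sup>2) \<partial>lebesgue)"
      by (rule nn_integral_liminf[OF meas])
    also have "\<dots> \<le> ennreal (e\<^sup>2)"
      by (rule order_trans[OF Liminf_le_Limsup Limsup_bounded])
         (use bound in \<open>auto simp: eventually_sequentially\<close>)
    finally have le: "(\<integral>\<^sup>+x. ennreal ((F x - rep_l2 (X m) x)\<^sup>2) \<partial>lebesgue) \<le> ennreal (e\<^sup>2)" .
    have int: "integrable lebesgue (\<lambda>x. (F x - rep_l2 (X m) x)\<^sup>2)"
      by (rule integrableI_nonneg) (use Fm le in \<open>auto simp: ennreal_less_top le_less_trans\<close>)
    moreover have "ennreal (LINT x|lebesgue. (F x - rep_l2 (X m) x)\<^sup>2) \<le> ennreal (e\<^sup>2)"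
      using le by (subst (asm) nn_integral_eq_integral[OF int]) auto
    ultimately show ?thesis by simp
  qed
  obtain N0 where N0: "\<And>i j. i \<ge> N0 \<Longrightarrow> j \<ge> N0 \<Longrightarrow> norm (X i - X j) < 1"
    using CauchyD[OF X, of 1] by auto
  have "square_integrable (\<lambda>x. (F x - rep_l2 (X N0) x) + rep_l2 (X N0) x)"
    using near[OF N0 order_refl] Fm
    by (intro square_integrable_add square_integrable_rep) (auto simp: square_integrable_def)
  then have F: "square_integrable F" by simp
  define l where "l = abs_l2 F"
  have lF: "AE x in lebesgue. rep_l2 l x = F x" unfolding l_def by (rule rep_abs_l2[OF F])
  have dist: "(norm (l - X m))\<^sup>2 = (LINT x|lebesgue. (F x - rep_l2 (X m) x)\<^sup>2)" for m
    unfolding norm_diff_rep by (rule integral_cong_AE) (use lF Fm in auto)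
  have "X \<longlonglongrightarrow> l"
  proof (rule LIMSEQ_I)
    fix e :: real assume e: "e > 0"
    then obtain N where N: "\<And>i j. i \<ge> N \<Longrightarrow> j \<ge> N \<Longrightarrow> norm (X i - X j) < e / 2"
      using CauchyD[OF X, of "e / 2"] by auto
    have "norm (X m - l) < e" if "m \<ge> N" for m
    proof -
      have "(norm (l - X m))\<^sup>2 \<le> (e / 2)\<^sup>2" unfolding dist using near[OF N that] by blast
      then have "norm (l - X m) \<le> e / 2" by (rule power2_le_imp_le) (use e in simp)
      then show ?thesis using e by (simp add: norm_minus_commute)
    qed
    then show "\<exists>no. \<forall>n\<ge>no. norm (X n - l) < e" by blast
  qed
  moreover have "AE x in lebesgue. (\<lambda>k. rep_l2 (X (r k)) x) \<longlonglongrightarrow> rep_l2 l x"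
    using lim lF by eventually_elim simp
  ultimately show ?thesis using r(1) that by blast
qed

lemma L2_iff: "u \<in> L2 \<Omega> \<longleftrightarrow> (AE x in lebesgue. x \<notin> \<Omega> \<longrightarrow> rep_l2 u x = 0)"
  by (simp add: L2_def)

lemma subspace_L2: "subspace (L2 \<Omega>)"
proof (rule subspaceI)
  show "0 \<in> L2 \<Omega>" unfolding L2_iff using rep_zero by eventually_elim simp
  show "u + v \<in> L2 \<Omega>" if "u \<in> L2 \<Omega>" "v \<in> L2 \<Omega>" for u v
    using that rep_add[of u v] unfolding L2_iff by eventually_elim simp
  show "c *\<^sub>R u \<in> L2 \<Omega>" if "u \<in> L2 \<Omega>" for c u
    using that rep_scaleR[of c u] unfolding L2_iff by eventually_elim simp
qed

lemma complete_L2: "complete (L2 \<Omega>)"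
  unfolding complete_def
proof (intro allI impI)
  fix X assume X: "(\<forall>n. X n \<in> L2 \<Omega>) \<and> Cauchy X"
  then obtain l r where l: "X \<longlonglongrightarrow> l" "AE x in lebesgue. (\<lambda>k. rep_l2 (X (r k)) x) \<longlonglongrightarrow> rep_l2 l x"
    using l2_Cauchy_convergent by blast
  have "AE x in lebesgue. \<forall>k. x \<notin> \<Omega> \<longrightarrow> rep_l2 (X (r k)) x = 0"
    using X by (subst AE_all_countable) (auto simp: L2_iff)
  with l(2) have "l \<in> L2 \<Omega>"
    unfolding L2_iff by eventually_elim (auto simp: LIMSEQ_const_iff)
  with l(1) show "\<exists>l\<in>L2 \<Omega>. X \<longlonglongrightarrow> l" by blast
qed

section \<open>Test functions and uniqueness of weak derivatives\<close>

lemma square_integrable_compact_support: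
  fixes f :: "real^2 \<Rightarrow> real"
  assumes f: "continuous_on UNIV f" and K: "compact K" and z: "\<And>x. x \<notin> K \<Longrightarrow> f x = 0"
  shows "square_integrable f"
proof -
  have i: "integrable lborel (\<lambda>x. indicator K x *\<^sub>R (f x)\<^sup>2)"
    using K by (rule borel_integrable_compact) (intro continuous_intros continuous_on_subset[OF f], simp)
  have e: "indicator K x *\<^sub>R (f x)\<^sup>2 = (f x)\<^sup>2" for x
    using z[of x] by (cases "x \<in> K") simp_all
  have "f \<in> borel_measurable borel" using f by (rule borel_measurable_continuous_onI)
  with i[unfolded e] show ?thesis
    by (simp add: square_integrable_def integrable_completion measurable_completion)
qed

lemma zero_outside_support:
  fixes z :: "'a::topological_space \<Rightarrow> 'b::zero"
  assumes "x \<notin> closure {x. z x \<noteq> 0}" shows "z x = 0"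
proof -
  have "x \<notin> {x. z x \<noteq> 0}" using assms subsetD[OF closure_subset] by metis
  then show ?thesis by simp
qed

lemma C1_compact_derivative_zero:
  assumes z: "z \<in> C1_compact \<Omega>" and x: "x \<notin> closure {x. z x \<noteq> 0}"
  shows "frechet_derivative z (at x) v = 0"
proof -
  have "((\<lambda>_. 0) has_derivative (\<lambda>_. 0)) (at x)" by simp
  then have "(z has_derivative (\<lambda>_. 0)) (at x)"
  proof (rule has_derivative_transform_within_open[where s = "- closure {x. z x \<noteq> 0}"])
    show "open (- closure {x. z x \<noteq> 0})" by (intro open_Compl closed_closure)
    show "0 = z y" if "y \<in> - closure {x. z x \<noteq> 0}" for y
      using zero_outside_support[of y z] that by simp
  qed (use x in simp)
  from frechet_derivative_at[OF this, symmetric] show ?thesis by simp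
qed

lemma C1_compact_square_integrable:
  fixes \<phi> :: "real^2 \<Rightarrow> real"
  assumes "\<phi> \<in> C1_compact \<Omega>"
  shows "square_integrable \<phi>" "\<And>x. x \<notin> \<Omega> \<Longrightarrow> \<phi> x = 0"
proof -
  let ?K = "closure {x. \<phi> x \<noteq> 0}"
  have K: "compact ?K" "?K \<subseteq> \<Omega>" and d: "\<And>x. \<phi> differentiable (at x)"
    using assms by (auto simp: C1_compact_def)
  have zero: "\<phi> x = 0" if "x \<notin> ?K" for x using that by (rule zero_outside_support)
  show "\<phi> x = 0" if "x \<notin> \<Omega>" for x using that K(2) zero by blast
  have "continuous_on UNIV \<phi>"
    by (intro continuous_at_imp_continuous_on ballI differentiable_imp_continuous_within d)
  then show "square_integrable \<phi>" by (rule square_integrable_compact_support[OF _ K(1) zero])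
qed

lemma partial_deriv_square_integrable:
  fixes \<phi> :: "real^2 \<Rightarrow> real"
  assumes \<phi>: "\<phi> \<in> C1_compact \<Omega>"
  shows "square_integrable (partial_deriv k \<phi>)" "\<And>x. x \<notin> \<Omega> \<Longrightarrow> partial_deriv k \<phi> x = 0"
proof -
  let ?K = "closure {x. \<phi> x \<noteq> 0}"
  have K: "compact ?K" "?K \<subseteq> \<Omega>" and c: "continuous_on UNIV (partial_deriv k \<phi>)"
    using \<phi> by (auto simp: C1_compact_def partial_deriv_def[abs_def])
  have zero: "partial_deriv k \<phi> x = 0" if "x \<notin> ?K" for x
    unfolding partial_deriv_def by (rule C1_compact_derivative_zero[OF \<phi> that])
  show "partial_deriv k \<phi> x = 0" if "x \<notin> \<Omega>" for x using that K(2) zero by blast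
  show "square_integrable (partial_deriv k \<phi>)"
    by (rule square_integrable_compact_support[OF c K(1) zero])
qed

lemma divergence_square_integrable:
  assumes z: "z \<in> C1_compact \<Omega>"
  shows "square_integrable (divergence z)" "\<And>x. x \<notin> \<Omega> \<Longrightarrow> divergence z x = 0"
proof -
  let ?K = "closure {x. z x \<noteq> 0}"
  have K: "compact ?K" "?K \<subseteq> \<Omega>" and c: "\<And>v. continuous_on UNIV (\<lambda>x. frechet_derivative z (at x) v)"
    using z by (auto simp: C1_compact_def)
  have zero: "divergence z x = 0" if "x \<notin> ?K" for x
    unfolding divergence_def partial_deriv_def by (simp add: C1_compact_derivative_zero[OF z that])
  show "divergence z x = 0" if "x \<notin> \<Omega>" for x using that K(2) zero by blast
  have "continuous_on UNIV (divergence z)"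
    unfolding divergence_def[abs_def] partial_deriv_def by (intro continuous_intros c)
  then show "square_integrable (divergence z)"
    by (rule square_integrable_compact_support[OF _ K(1) zero])
qed

lemma set_integral_rep_eq_inner:
  assumes "square_integrable f" "\<And>x. x \<notin> \<Omega> \<Longrightarrow> f x = 0"
  shows "(LINT x:\<Omega>|lebesgue. rep_l2 u x * f x) = inner u (abs_l2 f)"
proof -
  have e: "indicator \<Omega> x *\<^sub>R (rep_l2 u x * f x) = rep_l2 u x * f x" for x
    using assms(2)[of x] by (cases "x \<in> \<Omega>") simp_all
  show ?thesis unfolding set_lebesgue_integral_def e inner_abs[OF assms(1)] ..
qed

text \<open>
  The regularity part of \<open>C1_compact\<close>, separated from the support condition because it is preserved by
  products and by composition with continuously differentiable functions of one variable.
\<close>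

definition C1_map :: "(real^2 \<Rightarrow> real) \<Rightarrow> bool" where
  "C1_map f \<longleftrightarrow> (\<forall>x. f differentiable (at x)) \<and> (\<forall>v. continuous_on UNIV (\<lambda>x. frechet_derivative f (at x) v))"

lemma C1_mapI:
  assumes "\<And>x. (f has_derivative f' x) (at x)" "\<And>v. continuous_on UNIV (\<lambda>x. f' x v)"
  shows "C1_map f"
proof -
  have "frechet_derivative f (at x) = f' x" for x
    using frechet_derivative_at[OF assms(1)] by (rule sym)
  moreover have "f differentiable (at x)" for x
    using assms(1) by (rule differentiableI)
  ultimately show ?thesis using assms(2) by (simp add: C1_map_def)
qed

lemma C1_mapD:
  assumes "C1_map f"
  shows "(f has_derivative frechet_derivative f (at x)) (at x)"
    "continuous_on UNIV f" "continuous_on UNIV (\<lambda>x. frechet_derivative f (at x) v)"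
proof -
  have d: "f differentiable (at x)" for x using assms by (simp add: C1_map_def)
  then show "(f has_derivative frechet_derivative f (at x)) (at x)"
    by (simp add: frechet_derivative_works)
  show "continuous_on UNIV f"
    by (intro continuous_at_imp_continuous_on ballI differentiable_imp_continuous_within d)
  show "continuous_on UNIV (\<lambda>x. frechet_derivative f (at x) v)"
    using assms by (simp add: C1_map_def)
qed

lemma C1_map_mult:
  assumes "C1_map f" "C1_map g" shows "C1_map (\<lambda>x. f x * g x)"
proof (rule C1_mapI)
  show "((\<lambda>x. f x * g x) has_derivative
      (\<lambda>v. f x * frechet_derivative g (at x) v + frechet_derivative f (at x) v * g x)) (at x)" for x
    by (intro has_derivative_mult C1_mapD assms)
qed (intro continuous_intros C1_mapD assms)

lemma C1_map_compose:
  assumes f: "C1_map f" and \<psi>: "\<And>r. (\<psi> has_real_derivative \<psi>' r) (at r)" "continuous_on UNIV \<psi>'"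
  shows "C1_map (\<lambda>x. \<psi> (f x))"
proof (rule C1_mapI)
  show "((\<lambda>x. \<psi> (f x)) has_derivative (\<lambda>v. frechet_derivative f (at x) v * \<psi>' (f x))) (at x)" for x
    by (intro DERIV_compose_FDERIV \<psi> C1_mapD f)
qed (intro continuous_intros C1_mapD f continuous_on_compose2[OF \<psi>(2)], auto)

lemma C1_map_coordinate: "C1_map (\<lambda>x. x $ k - c)" "C1_map (\<lambda>x. c - x $ k)"
proof -
  have bl: "((\<lambda>x::real^2. x $ k) has_derivative (\<lambda>v. v $ k)) (at x)" for x
    by (rule bounded_linear_imp_has_derivative[OF bounded_linear_vec_nth])
  have "((\<lambda>x::real^2. x $ k - c) has_derivative (\<lambda>v. v $ k - 0)) (at x)" for x
    by (intro has_derivative_diff bl has_derivative_const)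
  then show "C1_map (\<lambda>x. x $ k - c)" by (rule C1_mapI) (rule continuous_on_const)
  have "((\<lambda>x::real^2. c - x $ k) has_derivative (\<lambda>v. 0 - v $ k)) (at x)" for x
    by (intro has_derivative_diff bl has_derivative_const)
  then show "C1_map (\<lambda>x. c - x $ k)" by (rule C1_mapI) (rule continuous_on_const)
qed

lemma DERIV_positive_part_square:
  "((\<lambda>t. (max 0 t)\<^sup>2) has_real_derivative 2 * max 0 t) (at (t::real))"
proof -
  consider "t > 0" | "t < 0" | "t = 0" by linarith
  then show ?thesis
  proof cases
    case 1
    have "((\<lambda>t. t\<^sup>2) has_real_derivative 2 * t) (at t)" by (auto intro!: derivative_eq_intros)
    then have "((\<lambda>t. (max 0 t)\<^sup>2) has_real_derivative 2 * t) (at t)"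
      by (rule DERIV_cong_ev[THEN iffD1, OF refl _ refl, rotated])
         (use 1 in \<open>auto simp: eventually_nhds intro!: exI[of _ "{0<..}"]\<close>)
    then show ?thesis using 1 by simp
  next
    case 2
    have "((\<lambda>t. 0) has_real_derivative 0) (at t)" by simp
    then have "((\<lambda>t. (max 0 t)\<^sup>2) has_real_derivative 0) (at t)"
      by (rule DERIV_cong_ev[THEN iffD1, OF refl _ refl, rotated])
         (use 2 in \<open>auto simp: eventually_nhds intro!: exI[of _ "{..<0}"]\<close>)
    then show ?thesis using 2 by simp
  next
    case 3
    have "((\<lambda>h::real. ((max 0 h)\<^sup>2) / h) \<longlongrightarrow> 0) (at 0)"
    proof (rule Lim_null_comparison)
      have "norm ((max 0 h)\<^sup>2 / h) \<le> \<bar>h\<bar>" for h :: real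
        by (cases "h \<le> 0") (auto simp: power2_eq_square max_def)
      then show "\<forall>\<^sub>F h in at 0. norm ((max 0 h)\<^sup>2 / h) \<le> \<bar>h::real\<bar>" by simp
      show "((\<lambda>h::real. \<bar>h\<bar>) \<longlongrightarrow> 0) (at 0)" by (rule tendsto_rabs_zero) (rule tendsto_ident_at)
    qed
    then show ?thesis by (simp add: 3 DERIV_def)
  qed
qed

definition bump :: "real^2 \<Rightarrow> real^2 \<Rightarrow> real^2 \<Rightarrow> real" where
  "bump a b x = (max 0 (x $ 1 - a $ 1))\<^sup>2 * (max 0 (b $ 1 - x $ 1))\<^sup>2
    * ((max 0 (x $ 2 - a $ 2))\<^sup>2 * (max 0 (b $ 2 - x $ 2))\<^sup>2)"

lemma C1_map_bump: "C1_map (bump a b)"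
proof -
  have c: "continuous_on UNIV (\<lambda>t::real. 2 * max 0 t)" by (intro continuous_intros)
  show ?thesis unfolding bump_def[abs_def]
    by (intro C1_map_mult C1_map_compose[OF _ DERIV_positive_part_square c] C1_map_coordinate)
qed

lemma bump_nonneg: "0 \<le> bump a b x"
  by (simp add: bump_def)

lemma bump_pos_iff: "bump a b x \<noteq> 0 \<longleftrightarrow> x \<in> box a b"
  by (auto simp: bump_def mem_box_cart forall_2 max_def)

text \<open>
  As \<open>c\<close> tends to infinity these functions increase to the indicator of the open box.
\<close>

lemma cutoff_test_function:
  assumes "cbox a b \<subseteq> \<Omega>"
  shows "(\<lambda>x. 1 - exp (- (c * bump a b x))) \<in> C1_compact \<Omega>"
proof (cases "c = 0")
  case True
  then show ?thesis by (simp add: C1_compact_def)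
next
  case False
  have "((\<lambda>r. 1 - exp (- (c * r))) has_real_derivative c * exp (- (c * r))) (at r)" for r
    by (auto intro!: derivative_eq_intros)
  then have "C1_map (\<lambda>x. 1 - exp (- (c * bump a b x)))"
    by (rule C1_map_compose[OF C1_map_bump]) (intro continuous_intros)
  moreover have "{x. 1 - exp (- (c * bump a b x)) \<noteq> 0} = box a b"
    using False bump_pos_iff[of a b] by auto
  moreover have "closure (box a b) \<subseteq> cbox a b"
    by (intro closure_minimal box_subset_cbox closed_cbox)
  moreover have "compact (closure (box a b))" by (simp add: compact_closure bounded_box)
  ultimately show ?thesis using assms unfolding C1_compact_def C1_map_def by auto
qed

lemma indicator_box_square_integrable: "square_integrable (indicator (box a b))"
proof -
  have "(indicator (box a b) x :: real)\<^sup>2 = indicator (box a b) x" for x :: "real^2"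
    by (simp add: indicator_def)
  moreover have "box a b \<in> lmeasurable" by (rule lmeasurable_box)
  then have "integrable lebesgue (indicator (box a b) :: real^2 \<Rightarrow> real)"
    by (intro integrable_real_indicator) (auto simp: fmeasurable_def)
  ultimately show ?thesis
    using borel_measurable_integrable by (simp add: square_integrable_def)
qed

text \<open>
  The cutoff test functions converge to the indicator of the box and are dominated by it.
\<close>

lemma box_integral_zero:
  assumes ab: "cbox a b \<subseteq> \<Omega>" and g: "\<And>\<phi>. \<phi> \<in> C1_compact \<Omega> \<Longrightarrow> inner g (abs_l2 \<phi>) = 0"
  shows "(LINT x|lebesgue. indicator (box a b) x * rep_l2 g x) = 0"
proof -
  define \<phi> where "\<phi> n x = 1 - exp (- (real n * bump a b x))" for n x
  have \<phi>: "\<phi> n \<in> C1_compact \<Omega>" for n unfolding \<phi>_def by (rule cutoff_test_function[OF ab])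
  have z: "(LINT x|lebesgue. rep_l2 g x * \<phi> n x) = 0" for n
    using g[OF \<phi>] inner_abs[OF C1_compact_square_integrable(1)[OF \<phi>], of g n] by simp
  have "(\<lambda>n. LINT x|lebesgue. rep_l2 g x * \<phi> n x) \<longlonglongrightarrow> (LINT x|lebesgue. indicator (box a b) x * rep_l2 g x)"
  proof (rule integral_dominated_convergence[where w = "\<lambda>x. \<bar>indicator (box a b) x * rep_l2 g x\<bar>"])
    have int: "integrable lebesgue (\<lambda>x. indicator (box a b) x * rep_l2 g x)"
      by (intro square_integrable_mult indicator_box_square_integrable square_integrable_rep)
    then show "(\<lambda>x. indicator (box a b) x * rep_l2 g x) \<in> borel_measurable lebesgue"
      by (rule borel_measurable_integrable)
    show "integrable lebesgue (\<lambda>x. \<bar>indicator (box a b) x * rep_l2 g x\<bar>)"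
      using int by (rule integrable_abs)
    show "(\<lambda>x. rep_l2 g x * \<phi> n x) \<in> borel_measurable lebesgue" for n
      by (intro borel_measurable_integrable square_integrable_mult square_integrable_rep
          C1_compact_square_integrable(1)[OF \<phi>])
    show "AE x in lebesgue. (\<lambda>n. rep_l2 g x * \<phi> n x) \<longlonglongrightarrow> indicator (box a b) x * rep_l2 g x"
    proof (rule AE_I2)
      fix x
      have "(\<lambda>n. \<phi> n x) \<longlonglongrightarrow> indicator (box a b) x"
      proof (cases "x \<in> box a b")
        case True
        then have pos: "bump a b x > 0" using bump_nonneg[of a b x] bump_pos_iff[of a b x] by linarith
        have "exp (- (real n * bump a b x)) = exp (- bump a b x) ^ n" for n
          by (simp flip: exp_of_nat_mult)
        moreover have "(\<lambda>n. exp (- bump a b x) ^ n) \<longlonglongrightarrow> 0"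
          using pos by (intro LIMSEQ_realpow_zero) auto
        ultimately have "(\<lambda>n. 1 - exp (- (real n * bump a b x))) \<longlonglongrightarrow> 1 - 0"
          by (intro tendsto_intros) simp
        then show ?thesis using True by (simp add: \<phi>_def)
      next
        case False
        then have "bump a b x = 0" using bump_pos_iff by blast
        with False show ?thesis by (simp add: \<phi>_def)
      qed
      then show "(\<lambda>n. rep_l2 g x * \<phi> n x) \<longlonglongrightarrow> indicator (box a b) x * rep_l2 g x"
        by (subst mult.commute) (intro tendsto_intros)
    qed
    show "AE x in lebesgue. norm (rep_l2 g x * \<phi> n x) \<le> \<bar>indicator (box a b) x * rep_l2 g x\<bar>" for n
    proof (rule AE_I2)
      fix x
      have "\<bar>\<phi> n x\<bar> \<le> indicator (box a b) x"
        using bump_pos_iff[of a b x] bump_nonneg[of a b x] by (auto simp: \<phi>_def indicator_def)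
      then have "\<bar>\<phi> n x\<bar> * \<bar>rep_l2 g x\<bar> \<le> indicator (box a b) x * \<bar>rep_l2 g x\<bar>"
        by (intro mult_right_mono) auto
      then show "norm (rep_l2 g x * \<phi> n x) \<le> \<bar>indicator (box a b) x * rep_l2 g x\<bar>"
        by (simp add: abs_mult mult.commute)
    qed
  qed
  then show ?thesis unfolding z using LIMSEQ_const_iff by metis
qed

text \<open>
  Integrals of \<open>g\<close> over boxes inside \<open>box a b\<close> vanish, boxes are stable under intersection and generate
  the Borel sets, so the integrals over all Borel subsets of the box vanish. The argument is carried
  out for a Borel version \<open>g1\<close> of \<open>g\<close> cut off to the box.
\<close>

lemma AE_zero_on_box:
  assumes ab: "cbox a b \<subseteq> \<Omega>" and g: "\<And>\<phi>. \<phi> \<in> C1_compact \<Omega> \<Longrightarrow> inner g (abs_l2 \<phi>) = 0"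
  shows "AE x in lebesgue. x \<in> box a b \<longrightarrow> rep_l2 g x = 0"
proof -
  define g0 where "g0 x = indicator (box a b) x * rep_l2 g x" for x
  have int0: "integrable lebesgue g0"
    unfolding g0_def by (intro square_integrable_mult indicator_box_square_integrable square_integrable_rep)
  obtain g1 where g1: "g1 \<in> borel_measurable lborel" "AE x in lborel. g0 x = g1 x"
    using completion_ex_borel_measurable_real[OF borel_measurable_integrable[OF int0]] by blast
  have ae: "AE x in lebesgue. g0 x = g1 x" using g1(2) by (rule AE_completion)
  have "integrable lebesgue g1"
    using int0 ae g1(1) by (subst integrable_cong_AE[symmetric]) (auto intro: measurable_completion)
  then have int1: "integrable lborel g1" using g1(1) by (simp add: integrable_completion)
  have "(LINT x:A|lborel. g1 x) = 0" if A: "A \<in> sets borel" for A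
  proof -
    have stable: "Int_stable (range (\<lambda>(a, b). box a b :: (real^2) set))"
      by (auto simp: Int_stable_def box_Int_box)
    have box0: "(LINT x:box c d|lborel. g1 x) = 0" for c d
    proof -
      obtain p q where pq: "box a b \<inter> box c d = box p q" "cbox a b \<inter> cbox c d = cbox p q"
        by (simp add: box_Int_box Int_interval)
      have "(LINT x:box c d|lborel. g1 x) = (LINT x|lebesgue. indicator (box c d) x *\<^sub>R g1 x)"
        unfolding set_lebesgue_integral_def using g1(1) by (subst integral_completion) auto
      also have "\<dots> = (LINT x|lebesgue. indicator (box p q) x * rep_l2 g x)"
      proof (rule integral_cong_AE)
        show "(\<lambda>x. indicator (box c d) x *\<^sub>R g1 x) \<in> borel_measurable lebesgue"
          using g1(1) by (intro measurable_completion) auto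
        show "(\<lambda>x. indicator (box p q) x * rep_l2 g x) \<in> borel_measurable lebesgue"
          by (intro borel_measurable_integrable square_integrable_mult indicator_box_square_integrable
              square_integrable_rep)
        show "AE x in lebesgue. indicator (box c d) x *\<^sub>R g1 x = indicator (box p q) x * rep_l2 g x"
          using ae by eventually_elim (auto simp: g0_def indicator_def simp flip: pq(1))
      qed
      also have "\<dots> = 0"
      proof (rule box_integral_zero)
        show "cbox p q \<subseteq> \<Omega>" using ab pq(2) by blast
      qed (rule g)
      finally show ?thesis .
    qed
    have UNIV0: "(LINT x|lborel. g1 x) = 0"
    proof -
      have "(LINT x|lborel. g1 x) = (LINT x|lebesgue. g1 x)" using g1(1) by (simp add: integral_completion)
      also have "\<dots> = (LINT x|lebesgue. g0 x)"
        using ae g1(1) int0 by (intro integral_cong_AE) (auto intro: measurable_completion)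
      also have "\<dots> = 0" unfolding g0_def by (rule box_integral_zero[OF ab g])
      finally show ?thesis .
    qed
    have sub: "range (\<lambda>(a, b). box a b :: (real^2) set) \<subseteq> Pow UNIV" by simp
    have "A \<in> sigma_sets UNIV (range (\<lambda>(a, b). box a b))" using A by (simp add: borel_eq_box)
    with stable sub show ?thesis
    proof (induction rule: sigma_sets_induct_disjoint)
      case (basic A)
      then show ?case using box0 by auto
    next
      case (compl A)
      then have "A \<in> sets borel" by (simp add: borel_eq_box)
      then have "set_integrable lborel A g1"
        unfolding set_integrable_def using int1 by (intro integrable_mult_indicator) auto
      moreover have "indicator (UNIV - A) x *\<^sub>R g1 x = g1 x - indicator A x *\<^sub>R g1 x" for x
        by (simp add: indicator_def)
      ultimately show ?case
        using int1 UNIV0 compl unfolding set_lebesgue_integral_def set_integrable_def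
        by (simp add: Bochner_Integration.integral_diff)
    next
      case (union A)
      then have A: "A i \<in> sets lborel" for i by (auto simp: borel_eq_box)
      have "set_integrable lborel (\<Union>i. A i) g1"
        unfolding set_integrable_def using int1 A by (intro integrable_mult_indicator) auto
      then have "(LINT x:(\<Union>i. A i)|lborel. g1 x) = (\<Sum>i. LINT x:A i|lborel. g1 x)"
        using union(1) A by (intro lebesgue_integral_countable_add) (auto simp: disjoint_family_on_def)
      then show ?case using union by simp
    qed (simp_all add: set_lebesgue_integral_def)
  qed
  then have "AE x in lborel. g1 x = 0"
    by (intro sigma_finite_measure.density_zero[OF sigma_finite_lborel int1]) simp
  then have "AE x in lebesgue. g1 x = 0" by (rule AE_completion)
  with ae show ?thesis by eventually_elim (auto simp: g0_def)
qed

text \<open>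
  An open set is a countable union of closed boxes, each of which differs from its interior by a
  null set.
\<close>

lemma fundamental_lemma:
  assumes \<Omega>: "open \<Omega>" and gL: "g \<in> L2 \<Omega>" and g: "\<And>\<phi>. \<phi> \<in> C1_compact \<Omega> \<Longrightarrow> inner g (abs_l2 \<phi>) = 0"
  shows "g = 0"
proof -
  obtain \<D> where \<D>: "countable \<D>" "\<D> \<subseteq> Pow \<Omega>" "\<And>X. X \<in> \<D> \<Longrightarrow> \<exists>a b. X = cbox a b" "\<Union>\<D> = \<Omega>"
    using open_countable_Union_open_cbox[OF \<Omega>] by metis
  have "AE x in lebesgue. x \<in> X \<longrightarrow> rep_l2 g x = 0" if X: "X \<in> \<D>" for X
  proof -
    obtain a b where ab: "X = cbox a b" using \<D>(3)[OF X] by blast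
    have "cbox a b \<subseteq> \<Omega>" using \<D>(2) X ab by blast
    from AE_zero_on_box[OF this g] have "AE x in lebesgue. x \<in> box a b \<longrightarrow> rep_l2 g x = 0" .
    moreover have "cbox a b - box a b \<in> null_sets lebesgue"
      using negligible_frontier_interval negligible_iff_null_sets by blast
    then have "AE x in lebesgue. x \<notin> cbox a b - box a b" by (rule AE_not_in)
    ultimately show ?thesis unfolding ab by eventually_elim auto
  qed
  then have "AE x in lebesgue. \<forall>X\<in>\<D>. x \<in> X \<longrightarrow> rep_l2 g x = 0"
    by (subst AE_ball_countable[OF \<D>(1)]) blast
  moreover have "AE x in lebesgue. x \<notin> \<Omega> \<longrightarrow> rep_l2 g x = 0" using gL by (simp add: L2_iff)
  ultimately have "AE x in lebesgue. rep_l2 g x = rep_l2 0 x"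
    using rep_zero by eventually_elim (use \<D>(4) in auto)
  then show ?thesis by (simp add: l2_eq_iff)
qed

lemma has_weak_partial_iff:
  "has_weak_partial \<Omega> k u g \<longleftrightarrow> g \<in> L2 \<Omega> \<and>
    (\<forall>\<phi>\<in>C1_compact \<Omega>. inner u (abs_l2 (partial_deriv k \<phi>)) = - inner g (abs_l2 \<phi>))"
  unfolding has_weak_partial_def
  by (simp add: set_integral_rep_eq_inner partial_deriv_square_integrable C1_compact_square_integrable)

lemma weak_partial_unique:
  assumes "open \<Omega>" "has_weak_partial \<Omega> k u g"
  shows "weak_partial \<Omega> k u = g"
  unfolding weak_partial_def
proof (rule the_equality)
  show "has_weak_partial \<Omega> k u g" by fact
  fix h assume h: "has_weak_partial \<Omega> k u h"
  have "h - g = 0"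
  proof (rule fundamental_lemma[OF assms(1)])
    show "h - g \<in> L2 \<Omega>"
      using h assms(2) subspace_diff[OF subspace_L2] by (simp add: has_weak_partial_iff)
    show "inner (h - g) (abs_l2 \<phi>) = 0" if "\<phi> \<in> C1_compact \<Omega>" for \<phi>
      using h assms(2) that by (simp add: has_weak_partial_iff inner_diff_left)
  qed
  then show "h = g" by simp
qed

section \<open>The two functionals and the theorem\<close>

text \<open>
  The divergence of a test field is square-integrable and vanishes outside \<open>\<Omega>\<close>, so the integrals in the
  definition of the total variation are inner products.
\<close>

lemma Phi0_support_functional:
  "Phi0 \<Omega> = (\<lambda>u. SUP z \<in> (\<lambda>z. abs_l2 (divergence z)) `
      {z \<in> C1_compact \<Omega>. \<forall>x\<in>\<Omega>. max \<bar>z x $ 1\<bar> \<bar>z x $ 2\<bar> \<le> 1}. ereal (inner u z))"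
proof
  fix u
  have "Phi0 \<Omega> u = aniso_TV \<Omega> u" by (auto simp: Phi0_def not_less)
  also have "\<dots> = (SUP z \<in> {z \<in> C1_compact \<Omega>. \<forall>x\<in>\<Omega>. max \<bar>z x $ 1\<bar> \<bar>z x $ 2\<bar> \<le> 1}.
      ereal (inner u (abs_l2 (divergence z))))"
    unfolding aniso_TV_def
    using set_integral_rep_eq_inner[OF divergence_square_integrable, of _ \<Omega>]
    by (intro SUP_cong refl) auto
  finally show "Phi0 \<Omega> u = (SUP z \<in> (\<lambda>z. abs_l2 (divergence z)) `
      {z \<in> C1_compact \<Omega>. \<forall>x\<in>\<Omega>. max \<bar>z x $ 1\<bar> \<bar>z x $ 2\<bar> \<le> 1}. ereal (inner u z))"
    by (simp only: image_image)
qed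

lemma Phi0_maximal_monotone: "maximal_monotone (L2 \<Omega>) (subdifferential (L2 \<Omega>) (Phi0 \<Omega>))"
  unfolding Phi0_support_functional
proof (rule support_functional_maximal_monotone[OF subspace_L2 complete_L2], rule image_eqI)
  show "0 = abs_l2 (divergence (\<lambda>_. 0))"
    by (simp add: divergence_def[abs_def] partial_deriv_def zero_l2_def)
  show "(\<lambda>_. 0 :: real^2) \<in> {z \<in> C1_compact \<Omega>. \<forall>x\<in>\<Omega>. max \<bar>z x $ 1\<bar> \<bar>z x $ 2\<bar> \<le> 1}"
    by (auto simp: C1_compact_def)
qed

text \<open>
  The Bochner integral is \<open>0\<close> for functions that are not integrable, so this is the \<open>L\<^sup>1\<close> norm only
  under the integrability conditions of \<open>gradient_graph\<close> below.
\<close>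

definition l1_norm :: "l2 \<Rightarrow> real" where
  "l1_norm g = (LINT x|lebesgue. \<bar>rep_l2 g x\<bar>)"

definition gradient_energy :: "real \<Rightarrow> l2 \<Rightarrow> l2 \<Rightarrow> real" where
  "gradient_energy \<gamma> g h = \<gamma> / 2 * ((norm g)\<^sup>2 + (norm h)\<^sup>2) + l1_norm g + l1_norm h"

text \<open>
  A function is kept together with its weak derivatives, since the proximal problem is uniformly
  convex in the three together.
\<close>

definition gradient_graph :: "(real^2) set \<Rightarrow> (l2 \<times> l2 \<times> l2) set" where
  "gradient_graph \<Omega> = {(u, g, h). u \<in> L2 \<Omega> \<and> has_weak_partial \<Omega> 1 u g \<and> has_weak_partial \<Omega> 2 u h \<and>
     integrable lebesgue (rep_l2 g) \<and> integrable lebesgue (rep_l2 h)}"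

lemma l1_norm_combination:
  assumes g: "integrable lebesgue (rep_l2 g)" and h: "integrable lebesgue (rep_l2 h)"
    and t: "0 \<le> t" "t \<le> 1"
  shows "integrable lebesgue (rep_l2 ((1 - t) *\<^sub>R g + t *\<^sub>R h))"
    "l1_norm ((1 - t) *\<^sub>R g + t *\<^sub>R h) \<le> (1 - t) * l1_norm g + t * l1_norm h"
proof -
  have ae: "AE x in lebesgue. rep_l2 ((1 - t) *\<^sub>R g + t *\<^sub>R h) x = (1 - t) * rep_l2 g x + t * rep_l2 h x"
    using rep_add[of "(1 - t) *\<^sub>R g" "t *\<^sub>R h"] rep_scaleR[of "1 - t" g] rep_scaleR[of t h]
    by eventually_elim simp
  have "integrable lebesgue (\<lambda>x. (1 - t) * rep_l2 g x + t * rep_l2 h x)"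
    by (intro Bochner_Integration.integrable_add integrable_mult_right g h)
  then show int: "integrable lebesgue (rep_l2 ((1 - t) *\<^sub>R g + t *\<^sub>R h))"
    using ae by (subst integrable_cong_AE) auto
  have "l1_norm ((1 - t) *\<^sub>R g + t *\<^sub>R h)
      \<le> (LINT x|lebesgue. (1 - t) * \<bar>rep_l2 g x\<bar> + t * \<bar>rep_l2 h x\<bar>)"
    unfolding l1_norm_def
  proof (rule integral_mono_AE)
    show "integrable lebesgue (\<lambda>x. (1 - t) * \<bar>rep_l2 g x\<bar> + t * \<bar>rep_l2 h x\<bar>)"
      by (intro Bochner_Integration.integrable_add integrable_mult_right integrable_abs g h)
    show "AE x in lebesgue. \<bar>rep_l2 ((1 - t) *\<^sub>R g + t *\<^sub>R h) x\<bar> \<le> (1 - t) * \<bar>rep_l2 g x\<bar> + t * \<bar>rep_l2 h x\<bar>"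
      using ae
    proof eventually_elim
      case (elim x)
      then show ?case
        using abs_triangle_ineq[of "(1 - t) * rep_l2 g x" "t * rep_l2 h x"] t by (simp add: abs_mult)
    qed
  qed (rule integrable_abs[OF int])
  also have "\<dots> = (1 - t) * l1_norm g + t * l1_norm h"
    unfolding l1_norm_def using g h by (simp add: integrable_abs)
  finally show "l1_norm ((1 - t) *\<^sub>R g + t *\<^sub>R h) \<le> (1 - t) * l1_norm g + t * l1_norm h" .
qed

lemma has_weak_partial_combination:
  assumes "has_weak_partial \<Omega> k u g" "has_weak_partial \<Omega> k v h"
  shows "has_weak_partial \<Omega> k (a *\<^sub>R u + b *\<^sub>R v) (a *\<^sub>R g + b *\<^sub>R h)"
  using assms subspace_L2[of \<Omega>] unfolding has_weak_partial_iff
  by (auto simp: inner_add_left subspace_add subspace_scale)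

lemma gradient_graph_combination:
  assumes "(u, g, h) \<in> gradient_graph \<Omega>" "(u', g', h') \<in> gradient_graph \<Omega>" "0 \<le> t" "t \<le> 1"
  shows "((1 - t) *\<^sub>R u + t *\<^sub>R u', (1 - t) *\<^sub>R g + t *\<^sub>R g', (1 - t) *\<^sub>R h + t *\<^sub>R h') \<in> gradient_graph \<Omega>"
  using assms unfolding gradient_graph_def
  by (auto intro!: has_weak_partial_combination l1_norm_combination subspace_add subspace_scale subspace_L2)

lemma gradient_energy_combination:
  assumes "(u, g, h) \<in> gradient_graph \<Omega>" "(u', g', h') \<in> gradient_graph \<Omega>" "0 \<le> t" "t \<le> 1"
  shows "gradient_energy \<gamma> ((1 - t) *\<^sub>R g + t *\<^sub>R g') ((1 - t) *\<^sub>R h + t *\<^sub>R h')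
      + \<gamma> / 2 * (t * (1 - t)) * ((norm (g - g'))\<^sup>2 + (norm (h - h'))\<^sup>2)
    \<le> (1 - t) * gradient_energy \<gamma> g h + t * gradient_energy \<gamma> g' h'"
proof -
  have "l1_norm ((1 - t) *\<^sub>R g + t *\<^sub>R g') \<le> (1 - t) * l1_norm g + t * l1_norm g'"
    "l1_norm ((1 - t) *\<^sub>R h + t *\<^sub>R h') \<le> (1 - t) * l1_norm h + t * l1_norm h'"
    using assms by (auto simp: gradient_graph_def intro!: l1_norm_combination)
  then have sum: "P + l1_norm ((1 - t) *\<^sub>R g + t *\<^sub>R g') + l1_norm ((1 - t) *\<^sub>R h + t *\<^sub>R h') + Q
      \<le> (1 - t) * (R + l1_norm g + l1_norm h) + t * (S + l1_norm g' + l1_norm h')"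
    if "P + Q = (1 - t) * R + t * S" for P Q R S
    using that by (simp add: distrib_left)
  show ?thesis
    unfolding gradient_energy_def norm_convex_combination_power2
    by (rule sum) (simp add: field_simps)
qed

lemma gradient_energy_nonneg: "\<gamma> > 0 \<Longrightarrow> 0 \<le> gradient_energy \<gamma> g h"
  unfolding gradient_energy_def l1_norm_def by (intro add_nonneg_nonneg mult_nonneg_nonneg) auto

text \<open>
  Along a common subsequence both factors converge almost everywhere, and Fatou's lemma applies to the
  sum. The sum is treated as one function because only the sum of the norms is known to converge.
\<close>

lemma l1_norm_lower_semicontinuous:
  assumes g: "g \<longlonglongrightarrow> g0" "\<And>n. integrable lebesgue (rep_l2 (g n))"
    and h: "h \<longlonglongrightarrow> h0" "\<And>n. integrable lebesgue (rep_l2 (h n))"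
    and c: "(\<lambda>n. l1_norm (g n) + l1_norm (h n)) \<longlonglongrightarrow> c"
  shows "integrable lebesgue (rep_l2 g0)" "integrable lebesgue (rep_l2 h0)" "l1_norm g0 + l1_norm h0 \<le> c"
proof -
  obtain l r1 where r1: "strict_mono r1" "g \<longlonglongrightarrow> l" "AE x in lebesgue. (\<lambda>k. rep_l2 (g (r1 k)) x) \<longlonglongrightarrow> rep_l2 l x"
    using l2_Cauchy_convergent[OF LIMSEQ_imp_Cauchy[OF g(1)]] by blast
  have "l = g0" using r1(2) g(1) by (rule LIMSEQ_unique)
  with r1(3) have ae1: "AE x in lebesgue. (\<lambda>k. rep_l2 (g (r1 k)) x) \<longlonglongrightarrow> rep_l2 g0 x" by simp
  have hr: "(h \<circ> r1) \<longlonglongrightarrow> h0" using LIMSEQ_subseq_LIMSEQ[OF h(1) r1(1)] .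
  obtain l' r2 where r2: "strict_mono r2" "(h \<circ> r1) \<longlonglongrightarrow> l'"
    "AE x in lebesgue. (\<lambda>k. rep_l2 ((h \<circ> r1) (r2 k)) x) \<longlonglongrightarrow> rep_l2 l' x"
    using l2_Cauchy_convergent[OF LIMSEQ_imp_Cauchy[OF hr]] by blast
  have "l' = h0" using r2(2) hr by (rule LIMSEQ_unique)
  define r where "r = r1 \<circ> r2"
  have r: "strict_mono r" unfolding r_def using r1(1) r2(1) by (rule strict_mono_o)
  have ae2: "AE x in lebesgue. (\<lambda>k. rep_l2 (h (r k)) x) \<longlonglongrightarrow> rep_l2 h0 x"
    using r2(3) \<open>l' = h0\<close> by (simp add: r_def)
  have ae1': "AE x in lebesgue. (\<lambda>k. rep_l2 (g (r k)) x) \<longlonglongrightarrow> rep_l2 g0 x"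
    using ae1
  proof eventually_elim
    case (elim x)
    from LIMSEQ_subseq_LIMSEQ[OF elim r2(1)] show ?case by (simp add: r_def comp_def)
  qed
  have meas: "(\<lambda>x. ennreal (\<bar>rep_l2 (g (r k)) x\<bar> + \<bar>rep_l2 (h (r k)) x\<bar>)) \<in> borel_measurable lebesgue" for k
    by measurable
  have "(\<integral>\<^sup>+x. ennreal (\<bar>rep_l2 g0 x\<bar> + \<bar>rep_l2 h0 x\<bar>) \<partial>lebesgue)
      = (\<integral>\<^sup>+x. liminf (\<lambda>k. ennreal (\<bar>rep_l2 (g (r k)) x\<bar> + \<bar>rep_l2 (h (r k)) x\<bar>)) \<partial>lebesgue)"
  proof (rule nn_integral_cong_AE, use ae1' ae2 in eventually_elim)
    case (elim x)
    then have "(\<lambda>k. ennreal (\<bar>rep_l2 (g (r k)) x\<bar> + \<bar>rep_l2 (h (r k)) x\<bar>))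
        \<longlonglongrightarrow> ennreal (\<bar>rep_l2 g0 x\<bar> + \<bar>rep_l2 h0 x\<bar>)"
      by (intro tendsto_ennrealI tendsto_intros)
    from lim_imp_Liminf[OF sequentially_bot this] show ?case by (rule sym)
  qed
  also have "\<dots> \<le> liminf (\<lambda>k. \<integral>\<^sup>+x. ennreal (\<bar>rep_l2 (g (r k)) x\<bar> + \<bar>rep_l2 (h (r k)) x\<bar>) \<partial>lebesgue)"
    by (rule nn_integral_liminf[OF meas])
  also have "(\<lambda>k. \<integral>\<^sup>+x. ennreal (\<bar>rep_l2 (g (r k)) x\<bar> + \<bar>rep_l2 (h (r k)) x\<bar>) \<partial>lebesgue)
      = (\<lambda>k. ennreal (l1_norm (g (r k)) + l1_norm (h (r k))))"
    using g(2) h(2) by (intro ext, subst nn_integral_eq_integral) (auto simp: l1_norm_def)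
  also have "liminf \<dots> = ennreal c"
  proof (rule lim_imp_Liminf[OF sequentially_bot], rule tendsto_ennrealI)
    show "(\<lambda>k. l1_norm (g (r k)) + l1_norm (h (r k))) \<longlonglongrightarrow> c"
      using LIMSEQ_subseq_LIMSEQ[OF c r] by (simp add: comp_def)
  qed
  finally have le: "(\<integral>\<^sup>+x. ennreal (\<bar>rep_l2 g0 x\<bar> + \<bar>rep_l2 h0 x\<bar>) \<partial>lebesgue) \<le> ennreal c" .
  have int: "integrable lebesgue (\<lambda>x. \<bar>rep_l2 g0 x\<bar> + \<bar>rep_l2 h0 x\<bar>)"
    by (rule integrableI_nonneg) (use le in \<open>auto simp: ennreal_less_top le_less_trans\<close>)
  show i: "integrable lebesgue (rep_l2 g0)" "integrable lebesgue (rep_l2 h0)"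
    by (rule Bochner_Integration.integrable_bound[OF int]; simp)+
  have "0 \<le> c"
    by (rule LIMSEQ_le_const[OF c]) (auto simp: l1_norm_def)
  moreover have "ennreal (LINT x|lebesgue. \<bar>rep_l2 g0 x\<bar> + \<bar>rep_l2 h0 x\<bar>) \<le> ennreal c"
    using le by (subst (asm) nn_integral_eq_integral[OF int]) auto
  ultimately have "(LINT x|lebesgue. \<bar>rep_l2 g0 x\<bar> + \<bar>rep_l2 h0 x\<bar>) \<le> c"
    by (simp only: ennreal_le_iff)
  then show "l1_norm g0 + l1_norm h0 \<le> c"
    using i by (simp add: l1_norm_def integrable_abs)
qed

lemma Phi1_eq_nn_integral:
  assumes \<Omega>: "open \<Omega>" and u: "u \<in> L2 \<Omega>" and g: "has_weak_partial \<Omega> 1 u g" and h: "has_weak_partial \<Omega> 2 u h"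
  shows "Phi1 \<Omega> \<gamma> u = enn2ereal (\<integral>\<^sup>+x. ennreal (\<gamma> / 2 * ((rep_l2 g x)\<^sup>2 + (rep_l2 h x)\<^sup>2)
    + \<bar>rep_l2 g x\<bar> + \<bar>rep_l2 h x\<bar>) \<partial>lebesgue)"
proof -
  have "u \<in> H1 \<Omega>" using u g h by (auto simp: H1_def forall_2)
  moreover have "AE x in lebesgue. x \<notin> \<Omega> \<longrightarrow> rep_l2 g x = 0" "AE x in lebesgue. x \<notin> \<Omega> \<longrightarrow> rep_l2 h x = 0"
    using g h by (auto simp: has_weak_partial_iff L2_iff)
  then have "(\<integral>\<^sup>+x\<in>\<Omega>. ennreal (\<gamma> / 2 * ((rep_l2 g x)\<^sup>2 + (rep_l2 h x)\<^sup>2)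
      + \<bar>rep_l2 g x\<bar> + \<bar>rep_l2 h x\<bar>) \<partial>lebesgue)
    = (\<integral>\<^sup>+x. ennreal (\<gamma> / 2 * ((rep_l2 g x)\<^sup>2 + (rep_l2 h x)\<^sup>2)
      + \<bar>rep_l2 g x\<bar> + \<bar>rep_l2 h x\<bar>) \<partial>lebesgue)"
  proof (intro nn_integral_cong_AE, eventually_elim)
    case (elim x)
    then show ?case by (cases "x \<in> \<Omega>") simp_all
  qed
  ultimately show ?thesis
    by (simp add: Phi1_def Let_def weak_partial_unique[OF \<Omega> g] weak_partial_unique[OF \<Omega> h])
qed

lemma Phi1_eq_gradient_energy:
  assumes \<Omega>: "open \<Omega>" and \<gamma>: "\<gamma> > 0" and u: "(u, g, h) \<in> gradient_graph \<Omega>"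
  shows "Phi1 \<Omega> \<gamma> u = ereal (gradient_energy \<gamma> g h)"
proof -
  have sq: "integrable lebesgue (\<lambda>x. (rep_l2 g x)\<^sup>2)" "integrable lebesgue (\<lambda>x. (rep_l2 h x)\<^sup>2)"
    using square_integrable_rep by (auto simp: square_integrable_def)
  have l1: "integrable lebesgue (rep_l2 g)" "integrable lebesgue (rep_l2 h)"
    using u by (auto simp: gradient_graph_def)
  have "(\<integral>\<^sup>+x. ennreal (\<gamma> / 2 * ((rep_l2 g x)\<^sup>2 + (rep_l2 h x)\<^sup>2) + \<bar>rep_l2 g x\<bar> + \<bar>rep_l2 h x\<bar>) \<partial>lebesgue)
     = ennreal (LINT x|lebesgue. \<gamma> / 2 * ((rep_l2 g x)\<^sup>2 + (rep_l2 h x)\<^sup>2) + \<bar>rep_l2 g x\<bar> + \<bar>rep_l2 h x\<bar>)"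
    using \<gamma> sq l1 by (intro nn_integral_eq_integral) auto
  also have "(LINT x|lebesgue. \<gamma> / 2 * ((rep_l2 g x)\<^sup>2 + (rep_l2 h x)\<^sup>2) + \<bar>rep_l2 g x\<bar> + \<bar>rep_l2 h x\<bar>)
     = gradient_energy \<gamma> g h"
    unfolding gradient_energy_def l1_norm_def norm_rep using sq l1 by (simp add: integrable_abs)
  finally show ?thesis
    using u gradient_energy_nonneg[OF \<gamma>, of g h] unfolding gradient_graph_def
    by (subst Phi1_eq_nn_integral[OF \<Omega>]) (auto simp: enn2ereal_ennreal)
qed

text \<open>
  If \<open>u\<close> has weak derivatives but belongs to no triple of \<open>gradient_graph\<close>, one derivative is not
  integrable, and the absolute values in the density make the integral infinite.
\<close>

lemma Phi1_infinite:
  assumes \<Omega>: "open \<Omega>" and \<gamma>: "\<gamma> > 0" and u: "u \<in> L2 \<Omega>" "\<And>g h. (u, g, h) \<notin> gradient_graph \<Omega>"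
  shows "Phi1 \<Omega> \<gamma> u = \<infinity>"
proof (cases "u \<in> H1 \<Omega>")
  case True
  then obtain g h where gh: "has_weak_partial \<Omega> 1 u g" "has_weak_partial \<Omega> 2 u h"
    unfolding H1_def by blast
  let ?f = "\<lambda>x. \<gamma> / 2 * ((rep_l2 g x)\<^sup>2 + (rep_l2 h x)\<^sup>2) + \<bar>rep_l2 g x\<bar> + \<bar>rep_l2 h x\<bar>"
  have "(\<integral>\<^sup>+x. ennreal (?f x) \<partial>lebesgue) = \<infinity>"
  proof (rule ccontr)
    assume "(\<integral>\<^sup>+x. ennreal (?f x) \<partial>lebesgue) \<noteq> \<infinity>"
    then have int: "integrable lebesgue ?f"
      using \<gamma> by (intro integrableI_nonneg) (auto simp: less_top)
    have "0 \<le> \<gamma> / 2 * ((rep_l2 g x)\<^sup>2 + (rep_l2 h x)\<^sup>2)" for x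
      using \<gamma> by (intro mult_nonneg_nonneg add_nonneg_nonneg) simp_all
    then have "\<bar>rep_l2 g x\<bar> \<le> \<bar>?f x\<bar>" "\<bar>rep_l2 h x\<bar> \<le> \<bar>?f x\<bar>" for x
      by (smt (verit))+
    then have "integrable lebesgue (rep_l2 g)" "integrable lebesgue (rep_l2 h)"
      by (intro Bochner_Integration.integrable_bound[OF int] rep_measurable AE_I2;
          simp only: real_norm_def)+
    then show False using u gh by (auto simp: gradient_graph_def)
  qed
  then show ?thesis using Phi1_eq_nn_integral[OF \<Omega> u(1) gh] by simp
qed (simp add: Phi1_def)

text \<open>
  At midpoints the energy gains \<open>\<gamma> / 8\<close> times the squared distance of the derivatives and the penalty
  \<open>1 / (8 * \<tau>)\<close> times that of the functions, whence the constant. Limits of Cauchy sequences stay in the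
  graph because the defining identities of weak derivatives are continuous.
\<close>

lemma gradient_graph_proximal_point:
  assumes \<gamma>: "\<gamma> > 0" and \<tau>: "\<tau> > 0"
  shows "\<exists>p\<in>gradient_graph \<Omega>. \<forall>q\<in>gradient_graph \<Omega>.
    (case p of (u, g, h) \<Rightarrow> gradient_energy \<gamma> g h + (norm (u - x))\<^sup>2 / (2 * \<tau>))
    \<le> (case q of (u, g, h) \<Rightarrow> gradient_energy \<gamma> g h + (norm (u - x))\<^sup>2 / (2 * \<tau>))"
proof (rule minimizer_exists[where c = "min (\<gamma> / 8) (1 / (8 * \<tau>))"])
  let ?G = "\<lambda>p. case p of (u, g, h) \<Rightarrow> gradient_energy \<gamma> g h + (norm (u - x))\<^sup>2 / (2 * \<tau>)"
  have "AE x in lebesgue. rep_l2 0 x = 0" by (rule rep_zero)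
  then have "integrable lebesgue (rep_l2 0)"
    by (subst integrable_cong_AE[where g = "\<lambda>_. 0"]) auto
  then have "(0, 0, 0) \<in> gradient_graph \<Omega>"
    by (simp add: gradient_graph_def has_weak_partial_iff subspace_0[OF subspace_L2])
  then show "gradient_graph \<Omega> \<noteq> {}" by blast
  show "0 \<le> ?G p" if "p \<in> gradient_graph \<Omega>" for p
    using gradient_energy_nonneg[OF \<gamma>] \<tau> by (cases p) simp
  show "min (\<gamma> / 8) (1 / (8 * \<tau>)) > 0" using \<gamma> \<tau> by simp
next
  let ?G = "\<lambda>p. case p of (u, g, h) \<Rightarrow> gradient_energy \<gamma> g h + (norm (u - x))\<^sup>2 / (2 * \<tau>)"
  fix p q assume pq: "p \<in> gradient_graph \<Omega>" "q \<in> gradient_graph \<Omega>"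
  obtain u g h where p: "p = (u, g, h)" by (cases p)
  obtain u' g' h' where q: "q = (u', g', h')" by (cases q)
  define c where "c = min (\<gamma> / 8) (1 / (8 * \<tau>))"
  have half: "(1/2) *\<^sub>R (a + b) = (1 - 1/2) *\<^sub>R a + (1/2) *\<^sub>R b" for a b :: l2
    by (simp add: scaleR_add_right)
  have mid: "(1/2) *\<^sub>R (p + q) = ((1/2) *\<^sub>R (u + u'), (1/2) *\<^sub>R (g + g'), (1/2) *\<^sub>R (h + h'))"
    by (simp add: p q)
  have "(1/2) *\<^sub>R (p + q) \<in> gradient_graph \<Omega>"
    unfolding mid half using pq unfolding p q by (intro gradient_graph_combination) auto
  moreover have "?G ((1/2) *\<^sub>R (p + q)) + c * (norm (p - q))\<^sup>2 \<le> (?G p + ?G q) / 2"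
  proof -
    have E: "gradient_energy \<gamma> ((1/2) *\<^sub>R (g + g')) ((1/2) *\<^sub>R (h + h'))
        + \<gamma> / 8 * ((norm (g - g'))\<^sup>2 + (norm (h - h'))\<^sup>2)
      \<le> (gradient_energy \<gamma> g h + gradient_energy \<gamma> g' h') / 2"
      unfolding half using gradient_energy_combination[OF pq[unfolded p q], of "1/2" \<gamma>] by simp
    have G: "?G ((1/2) *\<^sub>R (p + q)) = gradient_energy \<gamma> ((1/2) *\<^sub>R (g + g')) ((1/2) *\<^sub>R (h + h'))
          + (norm ((1/2) *\<^sub>R (u + u') - x))\<^sup>2 / (2 * \<tau>)"
        "?G p = gradient_energy \<gamma> g h + (norm (u - x))\<^sup>2 / (2 * \<tau>)"
        "?G q = gradient_energy \<gamma> g' h' + (norm (u' - x))\<^sup>2 / (2 * \<tau>)"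
      by (simp only: mid prod.case, simp_all only: p q prod.case)
    have "c * (norm (p - q))\<^sup>2 = c * (norm (u - u'))\<^sup>2 + c * ((norm (g - g'))\<^sup>2 + (norm (h - h'))\<^sup>2)"
      by (simp add: p q norm_Pair algebra_simps)
    also have "\<dots> \<le> 1 / (8 * \<tau>) * (norm (u - u'))\<^sup>2 + \<gamma> / 8 * ((norm (g - g'))\<^sup>2 + (norm (h - h'))\<^sup>2)"
      by (intro add_mono mult_right_mono) (auto simp: c_def)
    finally show ?thesis
      using E proximal_term_midpoint[OF \<tau>, of u u' x] G by argo
  qed
  ultimately show "(1/2) *\<^sub>R (p + q) \<in> gradient_graph \<Omega> \<and>
      ?G ((1/2) *\<^sub>R (p + q)) + min (\<gamma> / 8) (1 / (8 * \<tau>)) * (norm (p - q))\<^sup>2 \<le> (?G p + ?G q) / 2"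
    by (simp add: c_def)
next
  let ?G = "\<lambda>p. case p of (u, g, h) \<Rightarrow> gradient_energy \<gamma> g h + (norm (u - x))\<^sup>2 / (2 * \<tau>)"
  fix X m assume X: "\<And>n. X n \<in> gradient_graph \<Omega>" "Cauchy X" "(\<lambda>n. ?G (X n)) \<longlonglongrightarrow> m"
  define u where "u n = fst (X n)" for n
  define g where "g n = fst (snd (X n))" for n
  define h where "h n = snd (snd (X n))" for n
  have Xn: "X n = (u n, g n, h n)" for n by (simp add: u_def g_def h_def)
  have graph: "u n \<in> L2 \<Omega>" "has_weak_partial \<Omega> 1 (u n) (g n)" "has_weak_partial \<Omega> 2 (u n) (h n)"
      "integrable lebesgue (rep_l2 (g n))" "integrable lebesgue (rep_l2 (h n))" for n
    using X(1)[of n] unfolding Xn by (auto simp: gradient_graph_def)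
  have in_L2: "g n \<in> L2 \<Omega>" "h n \<in> L2 \<Omega>" for n
    using graph(2,3)[of n] by (auto simp: has_weak_partial_iff)
  have "Cauchy (\<lambda>n. fst (X n))" using X(2) by (rule Cauchy_fst)
  then have Cu: "Cauchy u" by (simp add: u_def[abs_def])
  have Cs: "Cauchy (\<lambda>n. snd (X n))" using X(2) by (rule Cauchy_snd)
  have Cg: "Cauchy g" "Cauchy h"
    using Cauchy_fst[OF Cs] Cauchy_snd[OF Cs] by (simp_all add: g_def[abs_def] h_def[abs_def])
  obtain u0 where u0: "u0 \<in> L2 \<Omega>" "u \<longlonglongrightarrow> u0" using complete_L2[of \<Omega>] graph(1) Cu unfolding complete_def by blast
  obtain g0 where g0: "g0 \<in> L2 \<Omega>" "g \<longlonglongrightarrow> g0" using complete_L2[of \<Omega>] in_L2 Cg unfolding complete_def by blast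
  obtain h0 where h0: "h0 \<in> L2 \<Omega>" "h \<longlonglongrightarrow> h0" using complete_L2[of \<Omega>] in_L2 Cg unfolding complete_def by blast
  have wp: "has_weak_partial \<Omega> k u0 l"
    if "l \<in> L2 \<Omega>" "a \<longlonglongrightarrow> l" "\<And>n. has_weak_partial \<Omega> k (u n) (a n)" for k l a
    unfolding has_weak_partial_iff
  proof (intro conjI ballI that(1))
    fix \<phi> :: "real^2 \<Rightarrow> real" assume \<phi>: "\<phi> \<in> C1_compact \<Omega>"
    have "(\<lambda>n. inner (u n) (abs_l2 (partial_deriv k \<phi>))) \<longlonglongrightarrow> inner u0 (abs_l2 (partial_deriv k \<phi>))"
      by (intro tendsto_intros u0)
    moreover have "(\<lambda>n. - inner (a n) (abs_l2 \<phi>)) \<longlonglongrightarrow> - inner l (abs_l2 \<phi>)"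
      by (intro tendsto_intros that(2))
    moreover have "inner (u n) (abs_l2 (partial_deriv k \<phi>)) = - inner (a n) (abs_l2 \<phi>)" for n
      using that(3)[of n] \<phi> by (simp add: has_weak_partial_iff)
    ultimately show "inner u0 (abs_l2 (partial_deriv k \<phi>)) = - inner l (abs_l2 \<phi>)"
      using LIMSEQ_unique by simp
  qed
  define r where "r = m - (norm (u0 - x))\<^sup>2 / (2 * \<tau>) - \<gamma> / 2 * ((norm g0)\<^sup>2 + (norm h0)\<^sup>2)"
  have "(\<lambda>n. ?G (X n) - (norm (u n - x))\<^sup>2 / (2 * \<tau>) - \<gamma> / 2 * ((norm (g n))\<^sup>2 + (norm (h n))\<^sup>2)) \<longlonglongrightarrow> r"
    unfolding r_def using \<tau> by (intro tendsto_intros X(3) u0 g0 h0) simp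
  then have "(\<lambda>n. l1_norm (g n) + l1_norm (h n)) \<longlonglongrightarrow> r"
    by (simp add: Xn gradient_energy_def)
  note l1 = l1_norm_lower_semicontinuous[OF g0(2) graph(4) h0(2) graph(5) this]
  have "(u0, g0, h0) \<in> gradient_graph \<Omega>"
    using u0(1) wp[OF g0 graph(2)] wp[OF h0 graph(3)] l1(1,2) by (simp add: gradient_graph_def)
  moreover have "?G (u0, g0, h0) \<le> m"
    using l1(3) by (simp add: gradient_energy_def r_def)
  ultimately show "\<exists>l\<in>gradient_graph \<Omega>. ?G l \<le> m" by blast
qed

text \<open>
  By uniqueness of weak derivatives \<open>gradient_graph\<close> is the graph of a map on its first projection
  \<open>D\<close>, so convexity and proximal points pass from triples to functions.
\<close>

lemma Phi1_maximal_monotone: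
  assumes \<Omega>: "open \<Omega>" and \<gamma>: "\<gamma> > 0"
  shows "maximal_monotone (L2 \<Omega>) (subdifferential (L2 \<Omega>) (Phi1 \<Omega> \<gamma>))"
proof -
  define D where "D = fst ` gradient_graph \<Omega>"
  define f where "f u = gradient_energy \<gamma> (weak_partial \<Omega> 1 u) (weak_partial \<Omega> 2 u)" for u
  have f: "f u = gradient_energy \<gamma> g h" if "(u, g, h) \<in> gradient_graph \<Omega>" for u g h
    using that weak_partial_unique[OF \<Omega>, of 1 u g] weak_partial_unique[OF \<Omega>, of 2 u h]
    by (simp add: f_def gradient_graph_def)
  have D_E: "\<exists>g h. (u, g, h) \<in> gradient_graph \<Omega>" if "u \<in> D" for u
    using that by (force simp: D_def)
  have D_I: "u \<in> D" if "(u, g, h) \<in> gradient_graph \<Omega>" for u g h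
    using that unfolding D_def by (force intro: rev_image_eqI)
  have comb: "(1 - t) *\<^sub>R u + t *\<^sub>R v \<in> D \<and> f ((1 - t) *\<^sub>R u + t *\<^sub>R v) \<le> (1 - t) * f u + t * f v"
    if uv: "u \<in> D" "v \<in> D" and t: "0 \<le> t" "t \<le> 1" for u v t
  proof -
    obtain g h g' h' where gh: "(u, g, h) \<in> gradient_graph \<Omega>" "(v, g', h') \<in> gradient_graph \<Omega>"
      using D_E uv by blast
    note comb_graph = gradient_graph_combination[OF gh t]
    have "0 \<le> \<gamma> / 2 * (t * (1 - t)) * ((norm (g - g'))\<^sup>2 + (norm (h - h'))\<^sup>2)"
      using \<gamma> t by (intro mult_nonneg_nonneg) auto
    with gradient_energy_combination[OF gh t, of \<gamma>] show ?thesis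
      using D_I[OF comb_graph] f[OF comb_graph] f[OF gh(1)] f[OF gh(2)] by simp
  qed
  have "convex D" unfolding convex_alt using comb by blast
  then have conv: "convex_on D f" using comb by (intro convex_onI) auto
  show ?thesis
  proof (rule subdifferential_maximal_monotone[OF subspace_L2 complete_L2 _ _ _ conv])
    show "D \<subseteq> L2 \<Omega>" by (auto simp: D_def gradient_graph_def)
    show "Phi1 \<Omega> \<gamma> u = ereal (f u)" if "u \<in> D" for u
      using D_E[OF that] Phi1_eq_gradient_energy[OF \<Omega> \<gamma>] f by metis
    show "Phi1 \<Omega> \<gamma> u = \<infinity>" if "u \<in> L2 \<Omega> - D" for u
      using that D_I by (intro Phi1_infinite[OF \<Omega> \<gamma>]) auto
    fix x and \<tau> :: real assume "\<tau> > 0"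
    from gradient_graph_proximal_point[OF \<gamma> this, of \<Omega> x]
    obtain u g h where min: "(u, g, h) \<in> gradient_graph \<Omega>"
      "\<And>v g' h'. (v, g', h') \<in> gradient_graph \<Omega> \<Longrightarrow> gradient_energy \<gamma> g h + (norm (u - x))\<^sup>2 / (2 * \<tau>)
        \<le> gradient_energy \<gamma> g' h' + (norm (v - x))\<^sup>2 / (2 * \<tau>)"
      by fastforce
    have "f u + (norm (u - x))\<^sup>2 / (2 * \<tau>) \<le> f v + (norm (v - x))\<^sup>2 / (2 * \<tau>)" if v: "v \<in> D" for v
    proof -
      obtain g' h' where v': "(v, g', h') \<in> gradient_graph \<Omega>" using D_E[OF v] by blast
      show ?thesis using min(2)[OF v'] f[OF min(1)] f[OF v'] by simp
    qed
    then show "\<exists>u\<in>D. \<forall>v\<in>D. f u + (norm (u - x))\<^sup>2 / (2 * \<tau>) \<le> f v + (norm (v - x))\<^sup>2 / (2 * \<tau>)"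
      using D_I[OF min(1)] by blast
  qed
qed

theorem theorem2p1:
  fixes \<Omega> :: "(real^2) set" and \<gamma> :: real and i :: nat and u0 :: l2
  assumes "open \<Omega>" and "\<gamma> > 0" and "i \<in> {0, 1}"
    and "u0 \<in> op_domain (A_op \<Omega> \<gamma> i)"
  shows "\<exists>u. strong_solution (A_op \<Omega> \<gamma> i) u0 u \<and>
           (\<forall>v. strong_solution (A_op \<Omega> \<gamma> i) u0 v \<longrightarrow> (\<forall>t\<ge>0. v t = u t)) \<and>
           (\<forall>t\<ge>0. \<exists>d. (u has_vector_derivative d) (at_right t) \<and>
                      d + min_section (A_op \<Omega> \<gamma> i) (u t) = 0)"
proof -
  have "maximal_monotone (L2 \<Omega>) (A_op \<Omega> \<gamma> i)"
    using Phi0_maximal_monotone[of \<Omega>] Phi1_maximal_monotone[OF assms(1,2)] assms(3)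
    by (auto simp: A_op_def Phi_def)
  then show ?thesis using assms(4) by (rule maximal_monotone.evolution_equation)
qed

end
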